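(* Let $q$ be a real-valued function on $\mathbb{R}_+=(0,\infty)$ with $q\in L^1(0,c)$ for all $c>0$, and let $\Sigma\subset[0,\infty)$ be a closed unbounded set of Lebesgue measure zero. Write $\mathbb{R}_+\setminus\Sigma=\bigcup_{k=1}^\infty\Delta_k$ with $\Delta_k=(a_k,b_k)$ the (pairwise disjoint) component intervals, $d_k=|\Delta_k|$, and assume $\sup_k d_k<\infty$. Let $\mathrm{H}_{\Sigma,q}^N=\bigoplus_{k\in\mathbb{N}}\mathrm{H}_{q,k}^N$ in $L^2(\mathbb{R}_+)=\bigoplus_k L^2(\Delta_k)$, where $\mathrm{H}_{q,k}^N$ is the Neumann realization of $-\frac{d^2}{dx^2}+q(x)$ in $L^2(\Delta_k)$, and assume that $\mathrm{H}_{\Sigma,q}^N$ is lower semibounded. If $$\sup_{k\in\mathbb{N}}\frac{1}{d_k}\int_{\Delta_k}q_-(x)\,dx<\infty,\qquad q_-:=(|q|-q)/2,$$ then the spectrum of $\mathrm{H}_{\Sigma,q}^N$ is purely discrete if and only if both of the following hold: (i) $q$ satisfies Molchanov's condition: $\displaystyle\lim_{x\to\infty}\int_x^{x+\varepsilon}q(t)\,dt=+\infty$ for every $\varepsilon>0$; (ii) $\displaystyle\lim_{k\to\infty}\frac{1}{d_k}\int_{\Delta_k}q(x)\,dx=+\infty$.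
   Context: $\mathrm{H}_{q,k}^Nf=-f''+qf$ with domain $\{f\in W^{2,1}(\Delta_k): f'(a_k)=f'(b_k)=0,\ -f''+qf\in L^2(\Delta_k)\}$; it is self-adjoint in $L^2(\Delta_k)$. The orthogonal sum is taken in the Hilbert space sense: $f=\bigoplus f_k$ is in $\mathrm{dom}(\mathrm{H}_{\Sigma,q}^N)$ iff $f_k\in\mathrm{dom}(\mathrm{H}_{q,k}^N)$ for all $k$, $f\in L^2(\mathbb{R}_+)$ and $\sum_k\|\mathrm{H}_{q,k}^Nf_k\|^2<\infty$; it is self-adjoint. The enumeration of the intervals $\Delta_k$ is arbitrary. Purely discrete spectrum means that the spectrum consists of isolated eigenvalues of finite multiplicity. *)

theory Defs
  imports "HOL-Analysis.Analysis"
begin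

subsection \<open>Unbounded operators in \<open>L\<^sup>2\<close>\<close>

text \<open>
  Elements of the Hilbert space \<open>L\<^sup>2(M)\<close> are represented by square-integrable functions, two
  functions being identified when they agree almost everywhere. An operator in \<open>L\<^sup>2(M)\<close> is
  represented by its graph, that is, by the set of all pairs \<open>(f, u)\<close> such that \<open>f\<close> belongs to
  the domain and \<open>u\<close> represents the image of \<open>f\<close>.
\<close>

definition L2 :: "'a measure \<Rightarrow> ('a \<Rightarrow> complex) set" where
  "L2 M = {f \<in> borel_measurable M. integrable M (\<lambda>x. (cmod (f x))\<^sup>2)}"

definition L2_inner :: "'a measure \<Rightarrow> ('a \<Rightarrow> complex) \<Rightarrow> ('a \<Rightarrow> complex) \<Rightarrow> complex" where
  "L2_inner M f g = (LINT x|M. f x * cnj (g x))"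

definition L2_norm :: "'a measure \<Rightarrow> ('a \<Rightarrow> complex) \<Rightarrow> real" where
  "L2_norm M f = sqrt (LINT x|M. (cmod (f x))\<^sup>2)"

type_synonym 'a op_graph = "(('a \<Rightarrow> complex) \<times> ('a \<Rightarrow> complex)) set"

text \<open>For a symmetric operator the inner product below is real; \<open>Re\<close> only serves to obtain an
  element of an ordered type.\<close>

definition lower_semibounded :: "'a measure \<Rightarrow> 'a op_graph \<Rightarrow> bool" where
  "lower_semibounded M T \<longleftrightarrow>
     (\<exists>C. \<forall>(f, u) \<in> T. Re (L2_inner M u f) \<ge> C * (L2_norm M f)\<^sup>2)"

text \<open>\<open>T - z\<close> is onto and has a bounded inverse; the norm estimate includes injectivity.\<close>

definition resolvent_set :: "'a measure \<Rightarrow> 'a op_graph \<Rightarrow> complex set" where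
  "resolvent_set M T = {z.
     (\<forall>g \<in> L2 M. \<exists>(f, u) \<in> T. AE x in M. u x - z * f x = g x) \<and>
     (\<exists>C. \<forall>(f, u) \<in> T. L2_norm M f \<le> C * L2_norm M (\<lambda>x. u x - z * f x))}"

definition spectrum :: "'a measure \<Rightarrow> 'a op_graph \<Rightarrow> complex set" where
  "spectrum M T = - resolvent_set M T"

definition eigenspace :: "'a measure \<Rightarrow> 'a op_graph \<Rightarrow> complex \<Rightarrow> ('a \<Rightarrow> complex) set" where
  "eigenspace M T z = {f. \<exists>u. (f, u) \<in> T \<and> (AE x in M. u x = z * f x)}"

definition eigenvalue :: "'a measure \<Rightarrow> 'a op_graph \<Rightarrow> complex \<Rightarrow> bool" where
  "eigenvalue M T z \<longleftrightarrow> (\<exists>f \<in> eigenspace M T z. \<not> (AE x in M. f x = 0))"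

definition finite_multiplicity :: "'a measure \<Rightarrow> 'a op_graph \<Rightarrow> complex \<Rightarrow> bool" where
  "finite_multiplicity M T z \<longleftrightarrow>
     (\<exists>B. finite B \<and> B \<subseteq> L2 M \<and>
        (\<forall>f \<in> eigenspace M T z. \<exists>c. AE x in M. f x = (\<Sum>e\<in>B. c e * e x)))"

definition purely_discrete_spectrum :: "'a measure \<Rightarrow> 'a op_graph \<Rightarrow> bool" where
  "purely_discrete_spectrum M T \<longleftrightarrow>
     (\<forall>z \<in> spectrum M T. z isolated_in spectrum M T \<and> eigenvalue M T z \<and> finite_multiplicity M T z)"

subsection \<open>Neumann realizations\<close>

definition test_functions :: "real set \<Rightarrow> (real \<Rightarrow> real) set" where
  "test_functions S = {\<phi>. (\<forall>n. (deriv ^^ n) \<phi> differentiable_on UNIV) \<and>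
     compact (closure {x. \<phi> x \<noteq> 0}) \<and> closure {x. \<phi> x \<noteq> 0} \<subseteq> S}"

text \<open>Both \<open>f\<close> and its distributional derivative \<open>g\<close> are in \<open>L\<^sup>1\<close>, i.e.
  \<open>f \<in> W\<^sup>1\<^sup>,\<^sup>1\<close> with \<open>f' = g\<close>.\<close>

definition has_L1_weak_derivative ::
    "real set \<Rightarrow> (real \<Rightarrow> complex) \<Rightarrow> (real \<Rightarrow> complex) \<Rightarrow> bool" where
  "has_L1_weak_derivative S f g \<longleftrightarrow>
     integrable (lebesgue_on S) f \<and> integrable (lebesgue_on S) g \<and>
     (\<forall>\<phi> \<in> test_functions S.
        (LINT x|lebesgue_on S. f x * of_real (deriv \<phi> x)) =
        - (LINT x|lebesgue_on S. g x * of_real (\<phi> x)))"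

text \<open>
  The conditions on \<open>f\<^sub>1 = f'\<close> and \<open>f\<^sub>2 = f''\<close> say that \<open>f\<close> belongs to the Sobolev space
  \<open>W\<^sup>2\<^sup>,\<^sup>1(a, b)\<close>. The boundary values of \<open>f'\<close> are those of the representative of \<open>f'\<close>
  that is continuous on the closed interval, so \<open>f\<^sub>1\<close> is required to be that representative.
\<close>

definition neumann_realization :: "(real \<Rightarrow> real) \<Rightarrow> real \<Rightarrow> real \<Rightarrow> real op_graph" where
  "neumann_realization q a b = {(f, u). \<exists>f\<^sub>1 f\<^sub>2.
     has_L1_weak_derivative {a<..<b} f f\<^sub>1 \<and> has_L1_weak_derivative {a<..<b} f\<^sub>1 f\<^sub>2 \<and>
     continuous_on {a..b} f\<^sub>1 \<and> f\<^sub>1 a = 0 \<and> f\<^sub>1 b = 0 \<and>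
     u \<in> L2 (lebesgue_on {a<..<b}) \<and>
     (AE x in lebesgue_on {a<..<b}. u x = - f\<^sub>2 x + of_real (q x) * f x)}"

text \<open>
  Orthogonal sum in \<open>L\<^sup>2(X)\<close> of operators \<open>T k\<close> in \<open>L\<^sup>2(\<Delta> k)\<close>, where the \<open>\<Delta> k\<close> are pairwise
  disjoint and exhaust \<open>X\<close> up to a null set. The component in \<open>L\<^sup>2(\<Delta> k)\<close> of a function on \<open>X\<close> is
  its restriction to \<open>\<Delta> k\<close>; no restriction is written, as \<open>T k\<close> is meant to depend only on the
  values on \<open>\<Delta> k\<close>.
\<close>

definition orthogonal_sum ::
    "real set \<Rightarrow> (nat \<Rightarrow> real set) \<Rightarrow> (nat \<Rightarrow> real op_graph) \<Rightarrow> real op_graph" where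
  "orthogonal_sum X \<Delta> T = {(f, u). f \<in> L2 (lebesgue_on X) \<and> (\<forall>k. (f, u) \<in> T k) \<and>
     summable (\<lambda>k. (L2_norm (lebesgue_on (\<Delta> k)) u)\<^sup>2)}"

definition neumann_sum ::
    "(real \<Rightarrow> real) \<Rightarrow> (nat \<Rightarrow> real) \<Rightarrow> (nat \<Rightarrow> real) \<Rightarrow> real op_graph" where
  "neumann_sum q a b =
     orthogonal_sum {0<..} (\<lambda>k. {a k<..<b k}) (\<lambda>k. neumann_realization q (a k) (b k))"

end

theory Submission
  imports Defs
begin

text \<open>
  The orthogonal sum is handled entirely through the forms
  \<open>t\<^sub>k[y] = \<integral>\<^bsub>\<Delta>\<^sub>k\<^esub> |y'|\<^sup>2 + q |y|\<^sup>2\<close> on \<open>W\<^sup>1\<^sup>,\<^sup>2(\<Delta>\<^sub>k)\<close>: its spectrum is purely discrete iff the optimal lower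
  bounds \<open>\<lambda>\<^sub>k\<close> of \<open>t\<^sub>k\<close> tend to infinity. On a single interval, \<open>- y'' + q y - w y = g\<close> is a Volterra equation;
  unless \<open>w\<close> is an eigenvalue, solving the initial value problem and correcting by a multiple of the homogeneous
  solution gives a bounded inverse, so that no compactness is needed. In particular \<open>\<lambda>\<^sub>k\<close> is an
  eigenvalue, and eigenvalues \<open>\<lambda>\<^sub>k\<close> that do not tend to infinity either accumulate or have infinite multiplicity.

  Testing \<open>t\<^sub>k\<close> with constants yields (ii). Testing all \<open>t\<^sub>k\<close> simultaneously with the restrictions of one
  bump function supported in \<open>[x, x + \<epsilon>]\<close> yields (i). Conversely, the bound on \<open>q\<^sub>-\<close> makes \<open>q\<^sub>-\<close> form bounded with small
  relative bound, and \<open>\<integral> |y|\<^sup>2\<close> is controlled by \<open>\<integral> q\<^sub>+ |y|\<^sup>2\<close> and \<open>\<epsilon>\<^sup>2 \<integral> |y'|\<^sup>2\<close> on intervals of length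
  at most \<open>\<epsilon>\<close> on which the mean of \<open>q\<close> is large: the \<open>\<Delta>\<^sub>k\<close> themselves by (ii) if they are short, and pieces of
  length between \<open>\<epsilon>/2\<close> and \<open>\<epsilon>\<close> of the long ones by (i), since the long ones move off to infinity.
\<close>

subsection \<open>Absolutely continuous functions\<close>

text \<open>Since q is only integrable, neither q y nor y'' need be square-integrable by itself.
  Functions of class W^{2,1} are therefore handled as pairs of iterated antiderivatives, and the
  identities for the form come from integration by parts between them. The second obstacle is that
  the \<Delta>_k may be arbitrarily short, so that the Sobolev inequality |y|^2 \<le> (2/l)
  \<parallel>y\<parallel>^2 + 2 l \<parallel>y'\<parallel>^2, valid for l \<le> d_k, degenerates.
  The bound on the mean of q_- supplies exactly the missing factor d_k: for l = min(d_k, \<epsilon>)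
  the quotient d_k / l stays bounded, and the gradient term receives the small factor d_k l \<le>
  \<epsilon> sup d_k. Hence one constant serves all k. The Neumann condition is natural for the
  form: the form domain carries no boundary condition, so constants and restrictions of a smooth
  function to \<Delta>_k are admissible wherever the points of \<Sigma> lie. For all but finitely
  many k the form lies above Re z + 1 and the inverse on \<Delta>_k has norm at most 1; this is what
  allows the inverses on the single intervals to be put together.\<close>

text \<open>The derivative \<open>f\<close> matters only up to null sets, but \<open>F\<close> is
  its antiderivative at every point of the closed interval. Thus \<open>F\<close> is the continuous
  representative, and its boundary values make sense.\<close>

definition AC :: "real \<Rightarrow> real \<Rightarrow> (real \<Rightarrow> complex) \<Rightarrow> (real \<Rightarrow> complex) \<Rightarrow> bool" where
  "AC a b F f \<longleftrightarrow> f absolutely_integrable_on {a..b} \<and> (\<forall>x\<in>{a..b}. F x = F a + integral {a..x} f)"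

lemma AC_integrable: "AC a b F f \<Longrightarrow> f absolutely_integrable_on {a..b}"
  by (simp add: AC_def)

lemma AC_eq: "AC a b F f \<Longrightarrow> a \<le> x \<Longrightarrow> x \<le> b \<Longrightarrow> F x = F a + integral {a..x} f"
  unfolding AC_def by (metis atLeastAtMost_iff)

lemma AC_continuous:
  assumes "AC a b F f"
  shows "continuous_on {a..b} F"
proof -
  have "f integrable_on {a..b}"
    using AC_integrable[OF assms] by (simp add: absolutely_integrable_on_def)
  then have "continuous_on {a..b} (\<lambda>x. F a + integral {a..x} f)"
    by (rule continuous_on_add[OF continuous_on_const indefinite_integral_continuous_1])
  then show ?thesis
    by (rule continuous_on_eq) (metis AC_eq[OF assms] atLeastAtMost_iff)
qed

lemma AC_diff_eq:
  assumes "AC a b F f" "a \<le> x" "x \<le> y" "y \<le> b"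
  shows "F y - F x = integral {x..y} f"
proof -
  have "f integrable_on {a..y}"
    by (rule integrable_on_subinterval[of f "{a..b}"])
      (use AC_integrable[OF assms(1)] assms(2-4) in \<open>auto simp: absolutely_integrable_on_def\<close>)
  then have "integral {a..x} f + integral {x..y} f = integral {a..y} f"
    using assms by (intro Henstock_Kurzweil_Integration.integral_combine) auto
  moreover have "F x = F a + integral {a..x} f" "F y = F a + integral {a..y} f"
    by (rule AC_eq[OF assms(1)]; use assms(2-4) in linarith)+
  ultimately show ?thesis by (simp add: algebra_simps)
qed

lemma AC_I:
  assumes "f absolutely_integrable_on {a..b}" "\<And>x. a \<le> x \<Longrightarrow> x \<le> b \<Longrightarrow> F x = F a + integral {a..x} f"
  shows "AC a b F f"
  unfolding AC_def
proof (intro conjI ballI)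
  show "F x = F a + integral {a..x} f" if "x \<in> {a..b}" for x
    by (rule assms(2)) (use that in simp_all)
qed (rule assms(1))

lemma AC_indef:
  assumes "f absolutely_integrable_on {a..b}"
  shows "AC a b (\<lambda>x. c + integral {a..x} f) f"
  using assms by (rule AC_I) simp

lemma AC_subinterval:
  assumes "AC a b F f" "a \<le> c" "d \<le> b"
  shows "AC c d F f"
proof (rule AC_I)
  show "f absolutely_integrable_on {c..d}"
    by (rule absolutely_integrable_on_subinterval[where S="{a..b}"])
      (use AC_integrable[OF assms(1)] assms(2-3) in auto)
next
  fix x assume "c \<le> x" "x \<le> d"
  then show "F x = F c + integral {c..x} f"
    using AC_diff_eq[OF assms(1), of c x] assms by (simp add: algebra_simps)
qed

text \<open>The derivative may be altered on a null set, the function itself nowhere on the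
  interval. Equations that hold almost everywhere enter in this way.\<close>

lemma AC_cong:
  assumes "AC a b F f" "\<And>x. x \<in> {a..b} \<Longrightarrow> F x = G x"
    and "negligible N" "\<And>x. x \<in> {a..b} - N \<Longrightarrow> f x = g x" "a \<le> b"
  shows "AC a b G g"
proof (rule AC_I)
  show "g absolutely_integrable_on {a..b}"
    using assms by (intro absolutely_integrable_spike[OF AC_integrable[OF assms(1)] assms(3)]) auto
next
  fix x assume x: "a \<le> x" "x \<le> b"
  have "integral {a..x} f = integral {a..x} g"
    by (rule integral_spike[OF assms(3)]) (use assms(4) x in auto)
  moreover have "F x = F a + integral {a..x} f"
    using AC_eq[OF assms(1) x] .
  ultimately show "G x = G a + integral {a..x} g"
    using assms(2)[of x] assms(2)[of a] x assms(5) by auto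
qed

lemma AC_absolutely_integrable_initial: "AC a b F f \<Longrightarrow> x \<le> b \<Longrightarrow> f absolutely_integrable_on {a..x}"
  by (rule absolutely_integrable_on_subinterval[OF AC_integrable]) auto

lemma absolutely_integrable_imp_integrable_on: "(f::real \<Rightarrow> 'b::euclidean_space) absolutely_integrable_on S
    \<Longrightarrow> f integrable_on S"
  by (simp add: absolutely_integrable_on_def)

lemma AC_integrable_initial: "AC a b F f \<Longrightarrow> x \<le> b \<Longrightarrow> f integrable_on {a..x}"
  using AC_absolutely_integrable_initial absolutely_integrable_imp_integrable_on by blast

lemma AC_linear:
  assumes "AC a b F f" "bounded_linear L"
  shows "AC a b (\<lambda>x. L (F x)) (\<lambda>x. L (f x))"
proof (rule AC_I)
  show "(\<lambda>x. L (f x)) absolutely_integrable_on {a..b}"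
    using absolutely_integrable_linear[OF AC_integrable[OF assms(1)] assms(2)] by (simp add: o_def)
next
  fix x assume x: "a \<le> x" "x \<le> b"
  have "integral {a..x} (L \<circ> f) = L (integral {a..x} f)"
    using AC_integrable_initial[OF assms(1) x(2)] assms(2) by (rule integral_linear)
  moreover have "F x = F a + integral {a..x} f"
    using AC_eq[OF assms(1) x] .
  ultimately show "L (F x) = L (F a) + integral {a..x} (\<lambda>x. L (f x))"
    by (simp add: o_def linear_simps(1)[OF assms(2)])
qed

lemma AC_cmult: "AC a b F f \<Longrightarrow> AC a b (\<lambda>x. c * F x) (\<lambda>x. c * f x)"
  by (rule AC_linear[OF _ bounded_linear_mult_right])

lemma AC_cnj: "AC a b F f \<Longrightarrow> AC a b (\<lambda>x. cnj (F x)) (\<lambda>x. cnj (f x))"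
  by (rule AC_linear[OF _ bounded_linear_cnj])

lemma AC_add:
  assumes "AC a b F f" "AC a b G g"
  shows "AC a b (\<lambda>x. F x + G x) (\<lambda>x. f x + g x)"
proof (rule AC_I)
  show "(\<lambda>x. f x + g x) absolutely_integrable_on {a..b}"
    using assms[THEN AC_integrable] by auto
next
  fix x assume x: "a \<le> x" "x \<le> b"
  have "integral {a..x} (\<lambda>x. f x + g x) = integral {a..x} f + integral {a..x} g"
    by (intro Henstock_Kurzweil_Integration.integral_add AC_integrable_initial[OF assms(1) x(2)]
        AC_integrable_initial[OF assms(2) x(2)])
  moreover have "F x = F a + integral {a..x} f" "G x = G a + integral {a..x} g"
    using AC_eq[OF assms(1) x] AC_eq[OF assms(2) x] by blast+
  ultimately show "F x + G x = F a + G a + integral {a..x} (\<lambda>x. f x + g x)"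
    by (simp add: algebra_simps)
qed

lemma AC_const: "AC a b (\<lambda>x. c) (\<lambda>x. 0)"
  by (rule AC_I) auto

lemma AC_diff:
  assumes "AC a b F f" "AC a b G g"
  shows "AC a b (\<lambda>x. F x - G x) (\<lambda>x. f x - g x)"
  using AC_add[OF assms(1) AC_cmult[OF assms(2), of "-1"]] by simp

lemma absolutely_integrable_mult_continuous:
  fixes f G :: "real \<Rightarrow> 'a::{euclidean_space, real_normed_field}"
  assumes f: "f absolutely_integrable_on {a..b}" and G: "continuous_on {a..b} G"
  shows "(\<lambda>x. f x * G x) absolutely_integrable_on {a..b}"
proof -
  have "(\<lambda>x. G x * f x) absolutely_integrable_on {a..b}"
  proof (rule absolutely_integrable_bounded_measurable_product[where h = "(*)"])
    show "bilinear ((*) :: 'a \<Rightarrow> 'a \<Rightarrow> 'a)"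
      by (simp add: bilinear_conv_bounded_bilinear bounded_bilinear_mult)
    show "G \<in> borel_measurable (lebesgue_on {a..b})"
      using G by (simp add: continuous_imp_measurable_on_sets_lebesgue)
    show "bounded (G ` {a..b})"
      using G by (simp add: compact_continuous_image compact_imp_bounded)
  qed (use f in auto)
  then show ?thesis by (simp add: mult.commute)
qed

text \<open>Telescoping over a uniform partition of mesh below \<open>\<delta>\<close>: a bound on
  short increments by those of \<open>m\<close> becomes a bound on the whole interval.\<close>

lemma increment_bound:
  fixes P :: "real \<Rightarrow> 'a::real_normed_vector"
  assumes "a \<le> b" "\<delta> > 0"
    and incr: "\<And>x y. a \<le> x \<Longrightarrow> x \<le> y \<Longrightarrow> y \<le> b \<Longrightarrow> y - x < \<delta> \<Longrightarrow> norm (P y - P x) \<le> m y - m x"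
  shows "norm (P b - P a) \<le> m b - m a"
proof -
  obtain n where n: "real n * \<delta> > b - a"
    using \<open>\<delta> > 0\<close> by (meson reals_Archimedean3)
  then have n0: "n > 0"
    using \<open>a \<le> b\<close> by (cases n) auto
  define s where "s i = a + real i * ((b - a) / real n)" for i
  have step: "s (Suc i) - s i = (b - a) / real n" for i
    by (simp add: s_def distrib_right add_divide_distrib)
  have small: "0 \<le> (b - a) / real n" "(b - a) / real n < \<delta>"
    using n n0 \<open>a \<le> b\<close> by (auto simp: field_simps)
  have sn: "s n = b" and s0: "s 0 = a"
    using n0 by (auto simp: s_def)
  have le: "a \<le> s i" for i
    using \<open>a \<le> b\<close> by (simp add: s_def)
  have mono: "s i \<le> s j" if "i \<le> j" for i j
    unfolding s_def by (intro add_left_mono mult_right_mono small(1)) (use that in simp)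
  have "norm (P (s i) - P (s 0)) \<le> m (s i) - m (s 0)" if "i \<le> n" for i
    using that
  proof (induction i)
    case (Suc i)
    have "norm (P (s (Suc i)) - P (s i)) \<le> m (s (Suc i)) - m (s i)"
      using mono[of i "Suc i"] mono[of "Suc i" n] Suc.prems sn small step le by (intro incr) auto
    moreover have "P (s (Suc i)) - P (s 0) = (P (s (Suc i)) - P (s i)) + (P (s i) - P (s 0))"
      by simp
    ultimately show ?case
      using Suc norm_triangle_ineq[of "P (s (Suc i)) - P (s i)" "P (s i) - P (s 0)"] by auto
  qed auto
  from this[of n] show ?thesis by (simp add: sn s0)
qed

lemma norm_integral_mult_le:
  fixes f G :: "real \<Rightarrow> complex"
  assumes f: "f absolutely_integrable_on {x..y}" and G: "continuous_on {x..y} G"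
    and le: "\<And>t. t \<in> {x..y} \<Longrightarrow> cmod (G t) \<le> e"
  shows "cmod (integral {x..y} (\<lambda>t. f t * G t)) \<le> e * integral {x..y} (\<lambda>t. cmod (f t))"
proof -
  have "cmod (integral {x..y} (\<lambda>t. f t * G t)) \<le> integral {x..y} (\<lambda>t. e * cmod (f t))"
  proof (rule integral_norm_bound_integral)
    show "(\<lambda>t. f t * G t) integrable_on {x..y}"
      using absolutely_integrable_mult_continuous[OF f G] absolutely_integrable_imp_integrable_on by blast
    show "(\<lambda>t. e * cmod (f t)) integrable_on {x..y}"
      using f by (auto simp: absolutely_integrable_on_def intro: integrable_on_mult_right)
    fix t assume "t \<in> {x..y}"
    then show "cmod (f t * G t) \<le> e * cmod (f t)"
      using le[of t] by (simp add: norm_mult mult.commute mult_right_mono)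
  qed
  then show ?thesis by simp
qed

text \<open>The increment of the product over a short interval differs from that of the indefinite integral by
  \<open>\<integral>\<^sub>x\<^sup>y f(t) (G(y) - G(t)) dt + \<integral>\<^sub>x\<^sup>y g(t) (F(x) - F(t)) dt\<close>,
  which is arbitrarily small compared with \<open>\<integral>\<^sub>x\<^sup>y (|f| + |g|)\<close>.\<close>

lemma AC_mult:
  assumes F: "AC a b F f" and G: "AC a b G g"
  shows "AC a b (\<lambda>x. F x * G x) (\<lambda>x. f x * G x + F x * g x)"
proof (rule AC_I)
  have cF: "continuous_on {a..b} F" and cG: "continuous_on {a..b} G"
    using F G AC_continuous by auto
  have i1: "(\<lambda>x. f x * G x) absolutely_integrable_on {a..b}"
    by (rule absolutely_integrable_mult_continuous[OF AC_integrable[OF F] cG])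
  have i2: "(\<lambda>x. F x * g x) absolutely_integrable_on {a..b}"
    using absolutely_integrable_mult_continuous[OF AC_integrable[OF G] cF] by (simp add: mult.commute)
  show int: "(\<lambda>x. f x * G x + F x * g x) absolutely_integrable_on {a..b}"
    using i1 i2 by auto
  fix z assume z: "a \<le> z" "z \<le> b"
  let ?h = "\<lambda>x. f x * G x + F x * g x"
  define P where "P x = F x * G x - integral {a..x} ?h" for x
  define m where "m x = integral {a..x} (\<lambda>t. cmod (f t) + cmod (g t))" for x
  have nf: "(\<lambda>t. cmod (f t)) integrable_on {a..b}" "(\<lambda>t. cmod (g t)) integrable_on {a..b}"
    using F[THEN AC_integrable] G[THEN AC_integrable] by (auto simp: absolutely_integrable_on_def)
  have bound: "cmod (P z - P a) \<le> e * (m z - m a)" if "e > 0" for e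
  proof -
    have "uniformly_continuous_on {a..b} F" "uniformly_continuous_on {a..b} G"
      using cF cG by (auto intro: compact_uniformly_continuous)
    then obtain d1 d2 where d: "d1 > 0" "d2 > 0"
      and d1: "\<And>s t. s \<in> {a..b} \<Longrightarrow> t \<in> {a..b} \<Longrightarrow> dist t s < d1 \<Longrightarrow> dist (F t) (F s) < e"
      and d2: "\<And>s t. s \<in> {a..b} \<Longrightarrow> t \<in> {a..b} \<Longrightarrow> dist t s < d2 \<Longrightarrow> dist (G t) (G s) < e"
      using \<open>e > 0\<close> unfolding uniformly_continuous_on_def by metis
    have "cmod (P z - P a) \<le> e * m z - e * m a"
    proof (rule increment_bound[of _ _ "min d1 d2"])
      fix x y assume xy: "a \<le> x" "x \<le> y" "y \<le> z" "y - x < min d1 d2"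
      have sub: "{x..y} \<subseteq> {a..b}" using xy z by auto
      have fa: "f absolutely_integrable_on {x..y}" and ga: "g absolutely_integrable_on {x..y}"
        using absolutely_integrable_on_subinterval[OF AC_integrable[OF F] sub]
          absolutely_integrable_on_subinterval[OF AC_integrable[OF G] sub] by blast+
      have ffi: "f integrable_on {x..y}" and ggi: "g integrable_on {x..y}"
        using fa ga absolutely_integrable_imp_integrable_on by auto
      have ch: "integral {a..x} ?h + integral {x..y} ?h = integral {a..y} ?h"
        using int xy z by (intro Henstock_Kurzweil_Integration.integral_combine)
           (auto intro: integrable_on_subinterval[OF absolutely_integrable_imp_integrable_on[OF int]])
      have cm: "integral {a..x} (\<lambda>t. cmod (f t) + cmod (g t)) + integral {x..y} (\<lambda>t. cmod (f t)
          + cmod (g t)) = integral {a..y} (\<lambda>t. cmod (f t) + cmod (g t))"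
        using xy z by (intro Henstock_Kurzweil_Integration.integral_combine)
           (auto intro!: integrable_add intro: integrable_on_subinterval[OF nf(1)]
               integrable_on_subinterval[OF nf(2)])
      have j1: "(\<lambda>t. f t * G t) integrable_on {x..y}" and j2: "(\<lambda>t. F t * g t) integrable_on {x..y}"
        using integrable_on_subinterval[OF absolutely_integrable_imp_integrable_on[OF i1] sub]
            integrable_on_subinterval[OF absolutely_integrable_imp_integrable_on[OF i2] sub]
        by blast+
      \<comment> \<open>From F(y) G(y) - F(x) G(x) = (F(y) - F(x)) G(y) + F(x) (G(y) - G(x)), with
        both differences written as integrals.\<close>
      have eq: "integral {x..y} (\<lambda>t. f t * (G y - G t)) + integral {x..y} (\<lambda>t. g t * (F x - F t))
        = (F y * G y - F x * G x) - integral {x..y} ?h"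
      proof -
        have "integral {x..y} (\<lambda>t. f t * (G y - G t)) = (F y - F x) * G y - integral {x..y} (\<lambda>t. f t * G t)"
          using AC_diff_eq[OF F, of x y] xy z j1 ffi
          by (simp add: right_diff_distrib Henstock_Kurzweil_Integration.integral_diff integrable_on_mult_left)
        moreover have "integral {x..y} (\<lambda>t. g t * (F x - F t)) = (G y - G x) * F x - integral {x..y}
            (\<lambda>t. F t * g t)"
          using AC_diff_eq[OF G, of x y] xy z j2 ggi
          by (simp add: right_diff_distrib Henstock_Kurzweil_Integration.integral_diff
              integrable_on_mult_left integrable_on_mult_right mult.commute)
        moreover have "integral {x..y} ?h = integral {x..y} (\<lambda>t. f t * G t) + integral {x..y} (\<lambda>t. F t * g t)"
          using j1 j2 by (rule Henstock_Kurzweil_Integration.integral_add)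
        ultimately show ?thesis by (simp only:) (simp add: algebra_simps)
      qed
      have b1: "cmod (integral {x..y} (\<lambda>t. f t * (G y - G t))) \<le> e * integral {x..y} (\<lambda>t. cmod (f t))"
      proof (rule norm_integral_mult_le[OF fa])
        show "continuous_on {x..y} (\<lambda>t. G y - G t)"
          using cG sub by (intro continuous_intros) (rule continuous_on_subset)
        fix t assume "t \<in> {x..y}"
        then have "dist (G y) (G t) < e" using xy z by (intro d2) (auto simp: dist_real_def)
        then show "cmod (G y - G t) \<le> e" by (simp add: dist_norm)
      qed
      have b2: "cmod (integral {x..y} (\<lambda>t. g t * (F x - F t))) \<le> e * integral {x..y} (\<lambda>t. cmod (g t))"
      proof (rule norm_integral_mult_le[OF ga])
        show "continuous_on {x..y} (\<lambda>t. F x - F t)"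
          using cF sub by (intro continuous_intros) (rule continuous_on_subset)
        fix t assume "t \<in> {x..y}"
        then have "dist (F x) (F t) < e" using xy z by (intro d1) (auto simp: dist_real_def)
        then show "cmod (F x - F t) \<le> e" by (simp add: dist_norm)
      qed
      have "integral {x..y} (\<lambda>t. cmod (f t) + cmod (g t)) = integral {x..y} (\<lambda>t. cmod (f t))
          + integral {x..y} (\<lambda>t. cmod (g t))"
        using fa ga by (intro Henstock_Kurzweil_Integration.integral_add) (auto simp: absolutely_integrable_on_def)
      then have "m y - m x = integral {x..y} (\<lambda>t. cmod (f t)) + integral {x..y} (\<lambda>t. cmod (g t))"
        using cm by (simp add: m_def)
      moreover have "P y - P x = integral {x..y} (\<lambda>t. f t * (G y - G t)) + integral {x..y} (\<lambda>t. g t * (F x - F t))"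
        unfolding eq P_def ch[symmetric] by simp
      ultimately show "cmod (P y - P x) \<le> e * m y - e * m x"
        using b1 b2 norm_triangle_ineq[of "integral {x..y} (\<lambda>t. f t * (G y - G t))" "integral {x..y}
            (\<lambda>t. g t * (F x - F t))"]
        by (simp add: right_diff_distrib[symmetric] distrib_left)
    qed (use d z in auto)
    then show ?thesis by (simp add: right_diff_distrib)
  qed
  have "cmod (P z - P a) \<le> 0"
  proof (rule field_le_epsilon)
    fix e :: real assume "e > 0"
    have m: "m a = 0" "0 \<le> m z"
      using z by (auto simp: m_def intro!: Henstock_Kurzweil_Integration.integral_nonneg integrable_add
         integrable_on_subinterval[OF nf(1)] integrable_on_subinterval[OF nf(2)])
    \<comment> \<open>The summand 1 keeps the divisor positive when \<open>m z = 0\<close>.\<close>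
    have "cmod (P z - P a) \<le> e / (m z + 1) * (m z - m a)"
      using \<open>e > 0\<close> m by (intro bound) auto
    also have "\<dots> \<le> e" using \<open>e > 0\<close> m by (simp add: divide_simps)
    finally show "cmod (P z - P a) \<le> 0 + e" by simp
  qed
  then show "F z * G z = F a * G a + integral {a..z} ?h"
    by (simp add: P_def algebra_simps)
qed

subsection \<open>Test functions and weak derivatives\<close>

definition smooth :: "(real \<Rightarrow> real) \<Rightarrow> bool" where
  "smooth f \<longleftrightarrow> (\<forall>n. (deriv ^^ n) f differentiable_on UNIV)"

text \<open>Smoothness is obtained from a class of functions that differentiation does not leave, so
  that no formula for the n-th derivative has to be found.\<close>

lemma smooth_if_closed_under_deriv:
  assumes "\<And>f. f \<in> \<F> \<Longrightarrow> f differentiable_on UNIV \<and> deriv f \<in> \<F>" and "f \<in> \<F>"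
  shows "smooth f"
proof -
  have "(deriv ^^ n) f \<in> \<F>" for n
    using assms by (induction n) auto
  then show ?thesis
    using assms(1) by (auto simp: smooth_def)
qed

lemma smooth_deriv: "smooth f \<Longrightarrow> smooth (deriv f)"
  unfolding smooth_def using funpow_Suc_right[of _ deriv] by (metis comp_apply)

lemma smooth_DERIV: "smooth f \<Longrightarrow> (f has_real_derivative deriv f x) (at x)"
  unfolding smooth_def
  by (metis DERIV_deriv_iff_real_differentiable UNIV_I differentiable_on_def funpow_0)

lemma smooth_continuous: "smooth f \<Longrightarrow> continuous_on A f"
  using smooth_DERIV by (meson DERIV_continuous_on has_field_derivative_at_within)

lemma differentiable_on_UNIV_if_DERIV:
  assumes "\<And>x. (f has_real_derivative g x) (at x)"
  shows "f differentiable_on UNIV"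
  using assms unfolding differentiable_on_def real_differentiable_def by blast

lemma smooth_linear:
  assumes "smooth f" "smooth g"
  shows "smooth (\<lambda>x. f x + c * g x)"
proof -
  have *: "((\<lambda>x. f x + c * g x) has_real_derivative (deriv f x + c * deriv g x)) (at x)"
    if "smooth f" "smooth g" for f g :: "real \<Rightarrow> real" and x
    using smooth_DERIV[OF that(1)] smooth_DERIV[OF that(2)]
    by (intro DERIV_add DERIV_cmult)
  show ?thesis
  proof (rule smooth_if_closed_under_deriv[where \<F> = "{\<lambda>x. f x + c * g x | f g. smooth f \<and> smooth g}"], safe)
    fix f g :: "real \<Rightarrow> real" assume fg: "smooth f" "smooth g"
    show "(\<lambda>x. f x + c * g x) differentiable_on UNIV"
      using *[OF fg] by (rule differentiable_on_UNIV_if_DERIV)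
    have "deriv (\<lambda>x. f x + c * g x) = (\<lambda>x. deriv f x + c * deriv g x)"
      using *[OF fg] by (auto intro!: DERIV_imp_deriv)
    then show "\<exists>f' g'. deriv (\<lambda>x. f x + c * g x) = (\<lambda>x. f' x + c * g' x) \<and> smooth f' \<and> smooth g'"
      using fg smooth_deriv by blast
  qed (use assms in blast)
qed

lemma smooth_antiderivative:
  assumes "\<And>x. (f has_real_derivative g x) (at x)" "smooth g"
  shows "smooth f"
proof (rule smooth_if_closed_under_deriv[where \<F> = "insert f {g. smooth g}"])
  have "deriv f = g"
    using assms(1) by (auto intro!: DERIV_imp_deriv)
  moreover have "f differentiable_on UNIV"
    using assms(1) by (rule differentiable_on_UNIV_if_DERIV)
  moreover have "h differentiable_on UNIV" if "smooth h" for h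
    using that by (metis funpow_0 smooth_def)
  ultimately show "h differentiable_on UNIV \<and> deriv h \<in> insert f {g. smooth g}" if
      "h \<in> insert f {g. smooth g}" for h
    using that assms(2) smooth_deriv by auto
qed auto

text \<open>Differentiation turns a function of this form into another one, with a different polynomial and exponent.
  For \<open>p = 1\<close> and \<open>k = 0\<close> the functions tend to the indicator of \<open>(c, d)\<close> as \<open>s\<close> tends to \<open>0\<close>.\<close>

definition bump_term :: "real \<Rightarrow> real \<Rightarrow> real \<Rightarrow> real poly \<Rightarrow> nat \<Rightarrow> real \<Rightarrow> real" where
  "bump_term c d s p k x =
     (if c < x \<and> x < d then poly p x / ((x - c) * (d - x)) ^ k * exp (- s / ((x - c) * (d - x))) else 0)"

text \<open>The inequality u \<le> e^u at u = s/(m g), raised to the power m. It makes the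
  exponential beat every negative power of g as g tends to 0.\<close>

lemma exp_minus_inverse_le:
  fixes g s :: real
  assumes "g > 0" "s > 0" "m > 0"
  shows "exp (- s / g) \<le> (real m * g / s) ^ m"
proof -
  have "s / (real m * g) \<le> exp (s / (real m * g))"
    using exp_ge_add_one_self[of "s / (real m * g)"] by linarith
  then have "(s / (real m * g)) ^ m \<le> exp (s / (real m * g)) ^ m"
    using assms by (intro power_mono) auto
  also have "\<dots> = exp (s / g)"
    using assms by (simp add: exp_of_nat_mult[symmetric])
  finally have "inverse (exp (s / g)) \<le> inverse ((s / (real m * g)) ^ m)"
    using assms by (intro le_imp_inverse_le) auto
  then show ?thesis
    using assms by (simp add: exp_minus power_divide field_simps)
qed

text \<open>A quadratic bound around every point outside (c, d) makes the derivative there zero,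
  with the endpoints and the exterior points treated alike.\<close>

lemma bump_term_le_square:
  assumes "s > 0"
  obtains K where "K \<ge> 0" "\<And>x y. \<not> (c < y \<and> y < d) \<Longrightarrow> \<bar>bump_term c d s p k x\<bar> \<le> K * (x - y)\<^sup>2"
proof -
  obtain B where B: "\<And>x. x \<in> {c..d} \<Longrightarrow> \<bar>poly p x\<bar> \<le> B"
  proof -
    have "compact (poly p ` {c..d})" by (intro compact_continuous_image continuous_intros) auto
    then show ?thesis using that by (metis bounded_real compact_imp_bounded image_eqI)
  qed
  \<comment> \<open>\<open>k\<close> powers of \<open>g\<close> cancel the denominator; the two
    remaining ones give the square of the distance.\<close>
  define m where "m = k + 2"
  have m: "m > 0" by (simp add: m_def)
  define K where "K = \<bar>B\<bar> * (real m / s) ^ m * (d - c)\<^sup>2"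
  have "\<bar>bump_term c d s p k x\<bar> \<le> K * (x - y)\<^sup>2" if y: "\<not> (c < y \<and> y < d)" for x y
  proof (cases "c < x \<and> x < d")
    case True
    define g where "g = (x - c) * (d - x)"
    have g: "g > 0" using True by (simp add: g_def)
    \<comment> \<open>Since \<open>y\<close> lies on or beyond an endpoint, the factor of
      \<open>g\<close> that belongs to that endpoint is at most |x - y|; the other factor is at most
      d - c.\<close>
    have gle: "g \<le> (d - c) * \<bar>x - y\<bar>"
    proof (cases "y \<le> c")
      case True': True
      have "(x - c) * (d - x) \<le> (x - y) * (d - c)" using True True' by (intro mult_mono) auto
      then show ?thesis using True True' by (simp add: g_def mult.commute)
    next
      case False
      have "(x - c) * (d - x) \<le> (d - c) * (y - x)" using True False y by (intro mult_mono) auto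
      then show ?thesis using True False y by (simp add: g_def)
    qed
    have gm: "g ^ m = g ^ k * g\<^sup>2" by (simp add: m_def power_add power2_eq_square)
    have "\<bar>bump_term c d s p k x\<bar> = \<bar>poly p x\<bar> / g ^ k * exp (- s / g)"
      using True g by (simp add: bump_term_def g_def[symmetric] abs_mult)
    also have "\<dots> \<le> \<bar>B\<bar> / g ^ k * (real m * g / s) ^ m"
      using exp_minus_inverse_le[OF g assms m] B[of x] True g
      by (intro mult_mono divide_right_mono) auto
    also have "\<dots> = \<bar>B\<bar> * (real m / s) ^ m * g\<^sup>2"
      using g by (simp add: power_mult_distrib power_divide gm)
    also have "\<dots> \<le> \<bar>B\<bar> * (real m / s) ^ m * ((d - c) * \<bar>x - y\<bar>)\<^sup>2"
      using g gle assms by (intro mult_left_mono power_mono) auto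
    also have "\<dots> = K * (x - y)\<^sup>2"
      by (simp add: K_def power_mult_distrib mult.assoc)
    finally show ?thesis .
  next
    case False
    then show ?thesis using assms by (auto simp: bump_term_def K_def)
  qed
  moreover have "K \<ge> 0" using assms by (simp add: K_def)
  ultimately show thesis using that by blast
qed

lemma DERIV_zero_if_le_square:
  fixes f :: "real \<Rightarrow> real"
  assumes "\<And>x. \<bar>f x\<bar> \<le> K * (x - y)\<^sup>2"
  shows "(f has_real_derivative 0) (at y)"
proof -
  have f0: "f y = 0" using assms[of y] by simp
  have "((\<lambda>h. (f (y + h) - f y) / h) \<longlongrightarrow> 0) (at 0)"
  proof (rule Lim_null_comparison)
    show "\<forall>\<^sub>F h in at 0. norm ((f (y + h) - f y) / h) \<le> K * \<bar>h\<bar>"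
    proof (rule eventually_at_filter[THEN iffD2, OF always_eventually], intro allI impI)
      fix h :: real assume h: "h \<noteq> 0"
      have "\<bar>f (y + h)\<bar> \<le> K * \<bar>h\<bar> * \<bar>h\<bar>" using assms[of "y + h"] by (simp add: power2_eq_square mult.assoc)
      then show "norm ((f (y + h) - f y) / h) \<le> K * \<bar>h\<bar>"
        using h f0 by (simp add: pos_divide_le_eq)
    qed
    have "((\<lambda>h. K * \<bar>h\<bar>) \<longlongrightarrow> K * \<bar>0\<bar>) (at 0)" by (intro tendsto_intros)
    then show "((\<lambda>h. K * \<bar>h\<bar>) \<longlongrightarrow> 0) (at 0)" by simp
  qed
  then show ?thesis by (simp add: DERIV_def)
qed

text \<open>For g = (x - c)(d - x) the derivative of p g^(-k) e^(-s/g) is (p'/g^k - k p g'/g^(k+1) +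
  s p g'/g^(k+2)) e^(-s/g), brought to the common denominator g^(k+2).\<close>

lemma bump_term_DERIV:
  fixes c d s :: real
  assumes "s > 0"
  defines "g \<equiv> [:-c, 1:] * [:d, -1:]"
  shows "(bump_term c d s p k has_real_derivative
     bump_term c d s (pderiv p * g\<^sup>2 - smult (of_nat k) (p * pderiv g * g) + smult s (p * pderiv g)) (k
         + 2) y) (at y)"
proof (cases "c < y \<and> y < d")
  case True
  have gp: "poly g x = (x - c) * (d - x)" for x
    by (simp add: g_def algebra_simps)
  have gy: "poly g y > 0" using True by (simp add: gp)
  have "((\<lambda>x. poly p x / poly g x ^ k * exp (- s / poly g x)) has_real_derivative
     poly (pderiv p * g\<^sup>2 - smult (of_nat k) (p * pderiv g * g) + smult s (p * pderiv g)) y / poly g y ^ (k + 2)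
       * exp (- s / poly g y)) (at y)"
  proof -
    have D: "((\<lambda>x. poly p x * (inverse (poly g x) ^ k * exp (- s * inverse (poly g x)))) has_real_derivative
       poly (pderiv p) y * (inverse (poly g y) ^ k * exp (- s * inverse (poly g y)))
       + (of_nat k * (- (inverse (poly g y) * poly (pderiv g) y * inverse (poly g y)) * inverse (poly g y) ^
           (k - Suc 0)) * exp (- s * inverse (poly g y))
         + exp (- s * inverse (poly g y)) * (- s * - (inverse (poly g y) * poly (pderiv g) y * inverse (poly
             g y))) * inverse (poly g y) ^ k) * poly p y) (at y)"
      using gy by (intro DERIV_mult DERIV_power DERIV_inverse' DERIV_fun_exp DERIV_cmult poly_DERIV) auto
    \<comment> \<open>The identity in independent letters: \<open>I\<close> is 1/g, \<open>X\<close>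
      and \<open>Y\<close> are the powers \<open>I ^ k\<close> and \<open>I ^ (k - Suc 0)\<close>,
      \<open>K\<close> is k and \<open>E\<close> the exponential. The second relation carries the
      factor \<open>K\<close>, so that it holds for k = 0 as well, where the exponent is
      truncated.\<close>
    have alg: "p' * (X * E) + (K * (- (I * g' * I) * Y) * E + E * (- s * - (I * g' * I)) * X) * q
        = (p' * G\<^sup>2 - K * (q * g' * G) + s * (q * g')) * (X * I\<^sup>2) * E"
      if "G * I = 1" "K * Y = K * X * G" for p' q K I Y E X G g' :: real
      using that by algebra
    have "real k * inverse (poly g y) ^ (k - Suc 0) = real k * inverse (poly g y) ^ k * poly g y"
      using gy by (cases k) auto
    moreover have "poly (pderiv p * g\<^sup>2 - smult (of_nat k) (p * pderiv g * g)
        + smult s (p * pderiv g)) y / poly g y ^ (k + 2)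
       = (poly (pderiv p) y * (poly g y)\<^sup>2 - real k * (poly p y * poly (pderiv g) y * poly g y)
           + s * (poly p y * poly (pderiv g) y))
         * (inverse (poly g y) ^ k * (inverse (poly g y))\<^sup>2)"
      by (simp add: divide_inverse power_add power_inverse power2_eq_square)
    moreover have "- s / poly g x = - s * inverse (poly g x)" "poly p x / poly g x ^ k
        = poly p x * inverse (poly g x) ^ k" for x
      by (simp_all add: divide_inverse power_inverse)
    ultimately show ?thesis
      using DERIV_cong[OF D alg[of "poly g y" "inverse (poly g y)" "real k"]] gy
      by (simp only: mult.assoc) simp
  qed
  then have "(bump_term c d s p k has_real_derivative
     poly (pderiv p * g\<^sup>2 - smult (of_nat k) (p * pderiv g * g) + smult s (p * pderiv g)) y / poly g y ^ (k + 2)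
       * exp (- s / poly g y)) (at y)"
    by (rule has_field_derivative_transform_within_open[where S = "{c<..<d}"])
       (use True in \<open>auto simp: bump_term_def gp\<close>)
  then show ?thesis
    using True by (simp add: bump_term_def gp)
next
  case False
  obtain K where "\<And>x y. \<not> (c < y \<and> y < d) \<Longrightarrow> \<bar>bump_term c d s p k x\<bar> \<le> K * (x - y)\<^sup>2"
    using bump_term_le_square[OF assms(1)] by metis
  then have "(bump_term c d s p k has_real_derivative 0) (at y)"
    using False by (intro DERIV_zero_if_le_square) auto
  then show ?thesis
    using False by (auto simp: bump_term_def)
qed

lemma smooth_bump_term:
  assumes "s > 0"
  shows "smooth (bump_term c d s p k)"
proof (rule smooth_if_closed_under_deriv[where \<F> = "{bump_term c d s p k | p k. True}"], safe)
  fix p k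
  have *: "(bump_term c d s p k has_real_derivative
     bump_term c d s (pderiv p * ([:-c, 1:] * [:d, -1:])\<^sup>2
       - smult (of_nat k) (p * pderiv ([:-c, 1:] * [:d, -1:]) * ([:-c, 1:] * [:d, -1:]))
       + smult s (p * pderiv ([:-c, 1:] * [:d, -1:]))) (k + 2) y) (at y)" for y
    using bump_term_DERIV[OF assms] .
  then show "bump_term c d s p k differentiable_on UNIV"
    by (rule differentiable_on_UNIV_if_DERIV)
  show "\<exists>p' k'. deriv (bump_term c d s p k) = bump_term c d s p' k' \<and> True"
    using DERIV_imp_deriv[OF *] by blast
qed auto


section \<open>Test functions and integration by parts\<close>

lemma test_functionsD:
  assumes "\<phi> \<in> test_functions S"
  shows "smooth \<phi>" "compact (closure {x. \<phi> x \<noteq> 0})" "closure {x. \<phi> x \<noteq> 0} \<subseteq> S"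
  using assms by (auto simp: test_functions_def smooth_def)

lemma test_functionsI:
  assumes "smooth \<phi>" "\<And>x. \<phi> x \<noteq> 0 \<Longrightarrow> x \<in> {c..d}" "{c..d} \<subseteq> S"
  shows "\<phi> \<in> test_functions S"
proof -
  have "closure {x. \<phi> x \<noteq> 0} \<subseteq> {c..d}"
    using assms(2) by (intro closure_minimal) auto
  moreover from this have "compact (closure {x. \<phi> x \<noteq> 0})"
    by (meson bounded_closed_interval bounded_subset closed_closure compact_eq_bounded_closed)
  ultimately show ?thesis
    using assms by (auto simp: test_functions_def smooth_def)
qed

lemma integral_supp:
  fixes f :: "'a::euclidean_space \<Rightarrow> 'b::banach"
  assumes "T \<subseteq> S" "\<And>x. f x \<noteq> 0 \<Longrightarrow> x \<in> T"
  shows "integral S f = integral T f"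
proof -
  have "integral S f = integral S (\<lambda>x. if x \<in> T then f x else 0)"
    by (rule integral_cong) (use assms in auto)
  then show ?thesis
    using assms by (simp add: integral_restrict_Int Int_absorb2)
qed

lemma integral_of_real:
  fixes f :: "real \<Rightarrow> real"
  assumes "f integrable_on S"
  shows "integral S (\<lambda>x. complex_of_real (f x)) = of_real (integral S f)"
  using integral_linear[OF assms bounded_linear_of_real] by (simp add: o_def)

lemma integrable_lebesgue_on_Ioo:
  fixes f :: "real \<Rightarrow> 'a::euclidean_space"
  shows "integrable (lebesgue_on {a<..<b}) f \<longleftrightarrow> f absolutely_integrable_on {a..b}"
  unfolding absolutely_integrable_on_Icc_iff_Ioo
  by (simp add: set_integrable_def integrable_restrict_space)

lemma integral_lebesgue_on_Ioo:
  fixes f :: "real \<Rightarrow> 'a::euclidean_space"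
  assumes "f absolutely_integrable_on {a..b}"
  shows "integral\<^sup>L (lebesgue_on {a<..<b}) f = integral {a..b} f"
proof -
  have "integral\<^sup>L (lebesgue_on {a<..<b}) f = integral {a<..<b} f"
    using assms by (intro lebesgue_integral_eq_integral) (auto simp: integrable_lebesgue_on_Ioo)
  then show ?thesis by (simp add: integral_open_interval_real)
qed

lemma AC_of_C1:
  fixes \<phi> :: "real \<Rightarrow> real"
  assumes "smooth \<phi>" "a \<le> b"
  shows "AC a b (\<lambda>x. of_real (\<phi> x)) (\<lambda>x. of_real (deriv \<phi> x))"
proof (rule AC_I)
  have c: "continuous_on A (deriv \<phi>)" for A
    by (rule smooth_continuous[OF smooth_deriv[OF assms(1)]])
  show "(\<lambda>x. complex_of_real (deriv \<phi> x)) absolutely_integrable_on {a..b}"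
    by (intro absolutely_integrable_continuous_real continuous_intros c)
  fix x assume "a \<le> x" "x \<le> b"
  then have "(deriv \<phi> has_integral \<phi> x - \<phi> a) {a..x}"
    using smooth_DERIV[OF assms(1)]
    by (intro fundamental_theorem_of_calculus)
      (auto simp: has_real_derivative_iff_has_vector_derivative[symmetric] intro: has_field_derivative_at_within)
  then show "complex_of_real (\<phi> x) = of_real (\<phi> a) + integral {a..x} (\<lambda>x. of_real (deriv \<phi> x))"
    by (subst integral_of_real) (auto simp: integral_unique has_integral_integrable simp flip: of_real_add)
qed

lemma test_functions_boundary:
  assumes "\<phi> \<in> test_functions {a<..<b}"
  shows "\<phi> a = 0" "\<phi> b = 0"
  using test_functionsD(3)[OF assms] closure_subset[of "{x. \<phi> x \<noteq> 0}"] by force+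

lemma AC_test_function:
  assumes F: "AC a b F f" and "a \<le> b" and \<phi>: "\<phi> \<in> test_functions {a<..<b}"
  shows "integral {a..b} (\<lambda>x. F x * of_real (deriv \<phi> x)) = - integral {a..b} (\<lambda>x. f x * of_real (\<phi> x))"
    and "(\<lambda>x. F x * of_real (deriv \<phi> x)) absolutely_integrable_on {a..b}"
    and "(\<lambda>x. f x * of_real (\<phi> x)) absolutely_integrable_on {a..b}"
proof -
  have c: "continuous_on A (deriv \<phi>)" "continuous_on A \<phi>" for A
    using test_functionsD(1)[OF \<phi>] smooth_deriv smooth_continuous by blast+
  show 1: "(\<lambda>x. F x * of_real (deriv \<phi> x)) absolutely_integrable_on {a..b}"
    by (intro absolutely_integrable_continuous_real continuous_intros c AC_continuous[OF F])
  show 2: "(\<lambda>x. f x * of_real (\<phi> x)) absolutely_integrable_on {a..b}"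
    by (intro absolutely_integrable_mult_continuous AC_integrable[OF F] continuous_intros c)
  note AC_eq[OF AC_mult[OF F AC_of_C1[OF test_functionsD(1)[OF \<phi>] assms(2)]] assms(2) order_refl]
  then have "integral {a..b} (\<lambda>x. f x * of_real (\<phi> x) + F x * of_real (deriv \<phi> x)) = 0"
    by (simp add: test_functions_boundary[OF \<phi>])
  then show "integral {a..b} (\<lambda>x. F x * of_real (deriv \<phi> x)) = - integral {a..b} (\<lambda>x. f x * of_real (\<phi> x))"
    using 1 2 by (simp add: Henstock_Kurzweil_Integration.integral_add
        absolutely_integrable_imp_integrable_on eq_neg_iff_add_eq_0 add.commute)
qed

text \<open>The antiderivative starting at c vanishes to the left of c by the support of
  \<open>\<rho>\<close>, and to the right of d because \<open>\<rho>\<close> has mean zero.\<close>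

lemma test_function_antiderivative:
  fixes \<rho> :: "real \<Rightarrow> real"
  assumes \<rho>: "smooth \<rho>" and supp: "\<And>x. \<rho> x \<noteq> 0 \<Longrightarrow> x \<in> {c..d}" and "{c..d} \<subseteq> S" and "integral {c..d} \<rho> = 0"
      and "c \<le> d"
  obtains \<phi> where "\<phi> \<in> test_functions S" "deriv \<phi> = \<rho>"
proof -
  define \<phi> where "\<phi> x = integral {c..x} \<rho>" for x
  have cont: "continuous_on A \<rho>" for A
    by (rule smooth_continuous[OF \<rho>])
  have int: "\<rho> integrable_on {s..t}" for s t
    by (rule integrable_continuous_real[OF cont])
  have zero: "integral {s..t} \<rho> = 0" if "\<And>x. s < x \<Longrightarrow> x < t \<Longrightarrow> \<rho> x = 0" for s t
  proof -
    have "integral {s..t} \<rho> = integral {s..t} (\<lambda>x. 0::real)"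
      by (rule integral_spike[of "{s,t}"]) (use that in auto)
    then show ?thesis by simp
  qed
  \<comment> \<open>For x < c the interval from c to x is empty. Moving the lower limit to a point
    left of both x and c shows \<open>\<phi>\<close> near x as an ordinary indefinite integral, to
    which the fundamental theorem applies.\<close>
  have \<phi>_eq: "\<phi> x = integral {L..x} \<rho>" if "L \<le> c" "L \<le> x" for L x
  proof (cases "c \<le> x")
    case True
    then show ?thesis
      using Henstock_Kurzweil_Integration.integral_combine[of L c x \<rho>] int that zero[of L c] supp
      by (force simp: \<phi>_def)
  next
    case False
    then show ?thesis using zero[of L x] supp by (force simp: \<phi>_def)
  qed
  have der: "(\<phi> has_real_derivative \<rho> x) (at x)" for x
  proof -
    define L where "L = min x c - 1"
    have "((\<lambda>u. integral {L..u} \<rho>) has_real_derivative \<rho> x) (at x within {L..x + 1})"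
      by (intro integral_has_real_derivative cont) (auto simp: L_def)
    then have "((\<lambda>u. integral {L..u} \<rho>) has_real_derivative \<rho> x) (at x)"
      by (subst (asm) at_within_interior) (auto simp: L_def)
    then show ?thesis
      by (rule has_field_derivative_transform_within_open[where S = "{L<..}"])
          (auto simp: L_def intro!: \<phi>_eq[symmetric])
  qed
  have s: "\<phi> x = 0" if "x \<notin> {c..d}" for x
  proof (cases "x < c")
    case False
    then have "integral {c..d} \<rho> + integral {d..x} \<rho> = \<phi> x"
      unfolding \<phi>_def using that \<open>c \<le> d\<close> int by (intro Henstock_Kurzweil_Integration.integral_combine) auto
    moreover have "integral {d..x} \<rho> = 0"
      using supp by (intro zero) force
    ultimately show ?thesis using assms by simp
  qed (simp add: \<phi>_def)
  have "\<phi> \<in> test_functions S"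
    using s assms(3) smooth_antiderivative[OF der \<rho>] by (intro test_functionsI[of \<phi> c d]) auto
  moreover have "deriv \<phi> = \<rho>"
    using der by (auto intro!: DERIV_imp_deriv)
  ultimately show thesis using that by blast
qed

section \<open>Vanishing weak derivatives and continuous representatives\<close>

text \<open>Lebesgue differentiation with the one-sided averages over [x, x + t], where t is so
  small that the interval stays inside (a, b).\<close>

lemma AE_zero_if_integrals_zero:
  fixes h :: "real \<Rightarrow> complex"
  assumes h: "h absolutely_integrable_on {a..b}"
    and zero: "\<And>c d. a < c \<Longrightarrow> c < d \<Longrightarrow> d < b \<Longrightarrow> integral {c..d} h = 0"
  obtains N where "negligible N" "\<And>x. x \<in> {a<..<b} - N \<Longrightarrow> h x = 0"
proof -
  define f where "f x = (if x \<in> {a..b} then h x else 0)" for x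
  have "f integrable_on UNIV"
    using absolutely_integrable_imp_integrable_on[OF h] unfolding f_def integrable_restrict_UNIV .
  then have "f integrable_on cbox c d" for c d
    by (rule integrable_on_subcbox) auto
  then obtain N where N: "negligible N" "\<And>x e. \<lbrakk>x \<notin> N; 0 < e\<rbrakk> \<Longrightarrow>
     \<exists>d>0. \<forall>t. 0 < t \<and> t < d \<longrightarrow> norm (integral (cbox x (x + t *\<^sub>R One)) f /\<^sub>R t ^ DIM(real) - f x) < e"
    using integrable_ccontinuous_explicit[of f] by metis
  have "h x = 0" if x: "x \<in> {a<..<b} - N" for x
  proof (rule ccontr)
    assume "h x \<noteq> 0"
    then obtain d where d: "d > 0" "\<And>t. 0 < t \<Longrightarrow> t < d \<Longrightarrow> norm (integral {x..x + t} f /\<^sub>R t - f x) < norm (h x)"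
      using N(2)[of x "norm (h x)"] x by auto
    define t where "t = min (d / 2) ((b - x) / 2)"
    have t: "0 < t" "t < d" "x + t < b" using d(1) x by (auto simp: t_def min_def field_simps)
    have "integral {x..x + t} f = integral {x..x + t} h"
      by (rule integral_cong) (use x t in \<open>auto simp: f_def\<close>)
    also have "\<dots> = 0"
      using x t by (intro zero) auto
    finally show False
      using d(2)[OF t(1,2)] x by (simp add: f_def)
  qed
  then show thesis using N(1) that by blast
qed

text \<open>A bump minus the right multiple of a fixed bump \<psi>_0 has mean zero, hence is the
  derivative of a test function. With C as the mean of h weighted by \<psi>_0, this says that h - C
  is orthogonal to all bumps. In the limit of the bumps to indicators, the integrals of h - C over
  all subintervals vanish.\<close>

lemma du_Bois_Reymond:
  fixes h :: "real \<Rightarrow> complex"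
  assumes "a < b" and h: "h absolutely_integrable_on {a..b}"
    and orth: "\<And>\<phi>. \<phi> \<in> test_functions {a<..<b} \<Longrightarrow> integral {a..b} (\<lambda>x. h x * of_real (deriv \<phi> x)) = 0"
  obtains C N where "negligible N" "\<And>x. x \<in> {a<..<b} - N \<Longrightarrow> h x = C"
proof -
  define \<psi> where "\<psi> c d s = bump_term c d s 1 0" for c d s
  have \<psi>: "smooth (\<psi> c d s)" if "s > 0" for c d s
    using smooth_bump_term[OF that] by (simp add: \<psi>_def)
  have \<psi>c: "continuous_on A (\<psi> c d s)" if "s > 0" for A c d s
    using smooth_continuous[OF \<psi>[OF that]] .
  have \<psi>b: "0 \<le> \<psi> c d s x" "\<psi> c d s x \<le> 1" if "s > 0" for c d s x
    using that by (auto simp: \<psi>_def bump_term_def)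
  have \<psi>s: "\<psi> c d s x \<noteq> 0 \<Longrightarrow> c < x \<and> x < d" for c d s x
    by (auto simp: \<psi>_def bump_term_def split: if_splits)
  obtain c0 d0 where cd0: "a < c0" "c0 < d0" "d0 < b"
    using \<open>a < b\<close> by (meson dense)
  define \<psi>0 where "\<psi>0 = \<psi> c0 d0 1"
  define m0 where "m0 = integral {a..b} \<psi>0"
  have i\<psi>: "\<psi> c d s integrable_on {s1..t1}" if "s > 0" for c d s s1 t1
    by (rule integrable_continuous_real[OF \<psi>c[OF that]])
  have m0: "m0 \<noteq> 0"
  proof
    assume "m0 = 0"
    then have "\<forall>x\<in>{a..b}. \<psi>0 x = 0"
      using integral_eq_0_iff[of a b \<psi>0] \<psi>b[of 1 c0 d0] \<psi>c[of 1 "{a..b}" c0 d0] \<open>a < b\<close> by (simp add: m0_def \<psi>0_def)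
    moreover have "\<psi>0 ((c0 + d0) / 2) \<noteq> 0" using cd0 by (auto simp: \<psi>0_def \<psi>_def bump_term_def field_simps)
    ultimately show False using cd0 by (auto simp: field_simps)
  qed
  have ih: "(\<lambda>x. h x * of_real (\<psi> c d s x)) absolutely_integrable_on {a..b}" if "s > 0" for c d s
    by (intro absolutely_integrable_mult_continuous h continuous_intros \<psi>c that)
  define C where "C = integral {a..b} (\<lambda>x. h x * of_real (\<psi>0 x)) / of_real m0"
  have orth': "integral {a..b} (\<lambda>x. (h x - C) * of_real (\<psi> c d s x)) = 0"
    if cd: "a < c" "c < d" "d < b" and s: "s > 0" for c d s
  proof -
    \<comment> \<open>The multiple of \<open>\<psi>0\<close> whose subtraction leaves mean
      zero.\<close>
    define r where "r = integral {a..b} (\<psi> c d s) / m0"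
    define \<rho> where "\<rho> x = \<psi> c d s x + (- r) * \<psi>0 x" for x
    have "smooth \<rho>"
      unfolding \<rho>_def \<psi>0_def by (intro smooth_linear \<psi> s) auto
    moreover have supp: "\<And>x. \<rho> x \<noteq> 0 \<Longrightarrow> x \<in> {min c c0..max d d0}"
    proof -
      fix x assume "\<rho> x \<noteq> 0"
      then have "\<psi> c d s x \<noteq> 0 \<or> \<psi> c0 d0 1 x \<noteq> 0" by (auto simp: \<rho>_def \<psi>0_def)
      then show "x \<in> {min c c0..max d d0}" using \<psi>s[of c d s x] \<psi>s[of c0 d0 1 x] by auto
    qed
    moreover have sub: "{min c c0..max d d0} \<subseteq> {a<..<b}" using cd cd0 by auto
    moreover have "integral {min c c0..max d d0} \<rho> = 0"
    proof -
      have "integral {min c c0..max d d0} \<rho> = integral {a..b} \<rho>"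
        by (rule integral_supp[symmetric]) (use supp sub in auto)
      also have "\<dots> = integral {a..b} (\<psi> c d s) + (- r) * m0"
        unfolding \<rho>_def m0_def using i\<psi>[OF s, of c d] i\<psi>[of 1 c0 d0] 
        by (subst Henstock_Kurzweil_Integration.integral_add)
            (auto simp: \<psi>0_def intro!: integrable_neg integrable_on_mult_right)
      also have "\<dots> = 0" using m0 by (simp add: r_def)
      finally show ?thesis .
    qed
    ultimately obtain \<phi> where \<phi>: "\<phi> \<in> test_functions {a<..<b}" "deriv \<phi> = \<rho>"
      using cd cd0 by (elim test_function_antiderivative[of \<rho>]) auto
    have A1: "integral {a..b} (\<lambda>x. of_real (\<psi> c d s x)) = complex_of_real (integral {a..b} (\<psi> c d s))"
      by (rule integral_of_real[OF i\<psi>[OF s]])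
    have "0 = integral {a..b} (\<lambda>x. h x * of_real (\<psi> c d s x) - of_real r * (h x * of_real (\<psi>0 x)))"
      using orth[OF \<phi>(1)] by (simp add: \<phi>(2) \<rho>_def algebra_simps)
    also have "\<dots> = integral {a..b} (\<lambda>x. h x * of_real (\<psi> c d s x)) - of_real r * (C * of_real m0)"
      using absolutely_integrable_imp_integrable_on[OF ih[OF s, of c d]]
          absolutely_integrable_imp_integrable_on[OF ih[of 1 c0 d0]] m0
      by (subst Henstock_Kurzweil_Integration.integral_diff)
          (auto simp: \<psi>0_def C_def intro!: integrable_on_mult_right)
    also have "of_real r * (C * of_real m0) = C * of_real (integral {a..b} (\<psi> c d s))"
      using m0 by (simp add: r_def)
    also have "integral {a..b} (\<lambda>x. h x * of_real (\<psi> c d s x)) - C * of_real (integral {a..b} (\<psi> c d s))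
        = integral {a..b} (\<lambda>x. h x * of_real (\<psi> c d s x) - C * of_real (\<psi> c d s x))"
      using absolutely_integrable_imp_integrable_on[OF ih[OF s, of c d]] 
      by (subst Henstock_Kurzweil_Integration.integral_diff)
         (auto simp: A1[symmetric] intro!: integrable_on_mult_right integrable_continuous_real
             continuous_intros \<psi>c s)
    finally show ?thesis by (simp add: left_diff_distrib)
  qed
  have hC: "(\<lambda>x. h x - C) absolutely_integrable_on {a..b}"
    using h by auto
  have "integral {c..d} (\<lambda>x. h x - C) = 0" if cd: "a < c" "c < d" "d < b" for c d
  proof -
    \<comment> \<open>The parameter \<open>1 / real (Suc n)\<close> of the bumps tends to 0, so they
      converge to the indicator of (c, d); |h - C| is an integrable majorant.\<close>
    let ?f = "\<lambda>n x. (h x - C) * of_real (\<psi> c d (1 / real (Suc n)) x)"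
    let ?g = "\<lambda>x. if x \<in> {c<..<d} then h x - C else 0"
    have "(\<lambda>n. integral {a..b} (?f n)) \<longlonglongrightarrow> integral {a..b} ?g"
    proof (rule dominated_convergence(2)[where h = "\<lambda>x. norm (h x - C)"])
      show "?f n integrable_on {a..b}" for n
        by (intro absolutely_integrable_imp_integrable_on absolutely_integrable_mult_continuous hC
            continuous_intros \<psi>c) auto
      show "(\<lambda>x. norm (h x - C)) integrable_on {a..b}"
        using hC by (auto simp: absolutely_integrable_on_def)
      show "norm (?f n x) \<le> norm (h x - C)" for n x
        using \<psi>b[of "1 / real (Suc n)" c d x] by (simp add: norm_mult mult_left_le)
      show "(\<lambda>n. ?f n x) \<longlonglongrightarrow> ?g x" for x
      proof (cases "x \<in> {c<..<d}")
        case True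
        have "(\<lambda>n. exp (- (1 / real (Suc n)) / ((x - c) * (d - x)))) \<longlonglongrightarrow> exp (- 0 / ((x - c) * (d - x)))"
          by (intro tendsto_intros LIMSEQ_inverse_real_of_nat[unfolded inverse_eq_divide]) (use True in auto)
        then have "(\<lambda>n. (h x - C) * of_real (\<psi> c d (1 / real (Suc n)) x)) \<longlonglongrightarrow> (h x - C) * of_real 1"
          using True by (intro tendsto_intros) (simp add: \<psi>_def bump_term_def)
        then show ?thesis using True by simp
      qed (auto simp: \<psi>_def bump_term_def)
    qed
    then have "integral {a..b} ?g = 0"
      using orth'[OF cd] LIMSEQ_unique by (force simp: LIMSEQ_const_iff)
    also have "integral {a..b} ?g = integral {c<..<d} (\<lambda>x. h x - C)"
      using cd by (subst integral_restrict_Int) (auto intro!: arg_cong[where f = "\<lambda>S. integral S _"])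
    finally show ?thesis by (simp add: integral_open_interval_real)
  qed
  then obtain N where "negligible N" "\<And>x. x \<in> {a<..<b} - N \<Longrightarrow> h x - C = 0"
    using AE_zero_if_integrals_zero[OF hC] by metis
  then show thesis by (intro that[of N C]) auto
qed


lemma AE_lebesgue_on_iff_negligible:
  assumes "S \<in> sets lebesgue"
  shows "(AE x in lebesgue_on S. P x) \<longleftrightarrow> (\<exists>N. negligible N \<and> (\<forall>x\<in>S - N. P x))"
proof -
  have "S \<inter> space lebesgue \<in> sets lebesgue" using assms by simp
  then have "(AE x in lebesgue_on S. P x) \<longleftrightarrow> (\<exists>N. negligible N \<and> {x. \<not> (x \<in> S \<longrightarrow> P x)} \<subseteq> N)"
    by (simp add: AE_restrict_space_iff eventually_ae_filter_negligible)
  also have "\<dots> \<longleftrightarrow> (\<exists>N. negligible N \<and> (\<forall>x\<in>S - N. P x))"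
    by (intro arg_cong[where f = Ex]) auto
  finally show ?thesis .
qed

lemma sets_Ioo_lebesgue: "{a<..<b::real} \<in> sets lebesgue"
  by simp

text \<open>The antiderivative F of g has the same weak derivative as f, so f - F is orthogonal to
  all derivatives of test functions and therefore constant. The converse is integration by parts.
  This translates the distributional definition of the operators into statements about
  \<open>AC\<close>.\<close>

lemma has_L1_weak_derivative_iff_AC:
  assumes "a < b"
  shows "has_L1_weak_derivative {a<..<b} f g \<longleftrightarrow>
    (\<exists>F. AC a b F g \<and> (AE x in lebesgue_on {a<..<b}. f x = F x))"
proof
  assume w: "has_L1_weak_derivative {a<..<b} f g"
  then have f: "f absolutely_integrable_on {a..b}" and g: "g absolutely_integrable_on {a..b}"
    by (auto simp: has_L1_weak_derivative_def integrable_lebesgue_on_Ioo)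
  define F where "F x = 0 + integral {a..x} g" for x
  have F: "AC a b F g" unfolding F_def by (rule AC_indef[OF g])
  have h: "(\<lambda>x. f x - F x) absolutely_integrable_on {a..b}"
    using f absolutely_integrable_continuous_real[OF AC_continuous[OF F]] by auto
  have orth: "integral {a..b} (\<lambda>x. (f x - F x) * of_real (deriv \<phi> x)) = 0"
    if \<phi>: "\<phi> \<in> test_functions {a<..<b}" for \<phi>
  proof -
    have c: "continuous_on A (deriv \<phi>)" "continuous_on A \<phi>" for A
      using test_functionsD(1)[OF \<phi>] smooth_deriv smooth_continuous by blast+
    have 1: "(\<lambda>x. f x * of_real (deriv \<phi> x)) absolutely_integrable_on {a..b}"
      by (intro absolutely_integrable_mult_continuous f continuous_intros c)
    have 2: "(\<lambda>x. g x * of_real (\<phi> x)) absolutely_integrable_on {a..b}"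
      by (intro absolutely_integrable_mult_continuous g continuous_intros c)
    have "integral {a..b} (\<lambda>x. f x * of_real (deriv \<phi> x)) = - integral {a..b} (\<lambda>x. g x * of_real (\<phi> x))"
      using w \<phi> unfolding has_L1_weak_derivative_def integral_lebesgue_on_Ioo[OF 1, symmetric]
        integral_lebesgue_on_Ioo[OF 2, symmetric] by blast
    also have "\<dots> = integral {a..b} (\<lambda>x. F x * of_real (deriv \<phi> x))"
      using AC_test_function(1)[OF F less_imp_le[OF assms] \<phi>] by simp
    finally show ?thesis
      using 1 AC_test_function(2)[OF F less_imp_le[OF assms] \<phi>]
      by (simp add: left_diff_distrib Henstock_Kurzweil_Integration.integral_diff
          absolutely_integrable_imp_integrable_on)
  qed
  obtain C N where N: "negligible N" "\<And>x. x \<in> {a<..<b} - N \<Longrightarrow> f x - F x = C"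
    using du_Bois_Reymond[OF assms h orth] by metis
  have "AC a b (\<lambda>x. C + integral {a..x} g) g"
    by (rule AC_indef[OF g])
  moreover have "AE x in lebesgue_on {a<..<b}. f x = C + integral {a..x} g"
    unfolding AE_lebesgue_on_iff_negligible[OF sets_Ioo_lebesgue]
  proof (intro exI[of _ N] conjI ballI N(1))
    fix x assume "x \<in> {a<..<b} - N"
    from N(2)[OF this] show "f x = C + integral {a..x} g" by (simp add: F_def algebra_simps)
  qed
  ultimately show "\<exists>F. AC a b F g \<and> (AE x in lebesgue_on {a<..<b}. f x = F x)"
    by blast
next
  assume "\<exists>F. AC a b F g \<and> (AE x in lebesgue_on {a<..<b}. f x = F x)"
  then obtain F where F: "AC a b F g" and ae: "AE x in lebesgue_on {a<..<b}. f x = F x" by blast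
  obtain N where N: "negligible N" "\<And>x. x \<in> {a<..<b} - N \<Longrightarrow> f x = F x"
    using ae by (subst (asm) AE_lebesgue_on_iff_negligible) auto
  define N' where "N' = N \<union> {a, b}"
  have N': "negligible N'" "\<And>x. x \<in> {a..b} - N' \<Longrightarrow> f x = F x"
    using N by (auto simp: N'_def intro: negligible_Un) 
  have f: "f absolutely_integrable_on {a..b}"
    by (rule absolutely_integrable_spike[OF absolutely_integrable_continuous_real[OF AC_continuous[OF F]] N'])
  show "has_L1_weak_derivative {a<..<b} f g"
    unfolding has_L1_weak_derivative_def integrable_lebesgue_on_Ioo
  proof (intro conjI ballI f AC_integrable[OF F])
    fix \<phi> assume \<phi>: "\<phi> \<in> test_functions {a<..<b}"
    note t = AC_test_function[OF F less_imp_le[OF assms] \<phi>]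
    have c: "continuous_on A (deriv \<phi>)" for A
      using test_functionsD(1)[OF \<phi>] smooth_deriv smooth_continuous by blast
    have 1: "(\<lambda>x. f x * of_real (deriv \<phi> x)) absolutely_integrable_on {a..b}"
      by (intro absolutely_integrable_mult_continuous f continuous_intros c)
    have "integral {a..b} (\<lambda>x. f x * of_real (deriv \<phi> x)) = integral {a..b} (\<lambda>x. F x * of_real (deriv \<phi> x))"
      by (rule integral_spike[OF N'(1)]) (use N'(2) in auto)
    then show "(LINT x|lebesgue_on {a<..<b}. f x * of_real (deriv \<phi> x))
        = - (LINT x|lebesgue_on {a<..<b}. g x * of_real (\<phi> x))"
      using t(1) by (simp add: integral_lebesgue_on_Ioo[OF 1] integral_lebesgue_on_Ioo[OF t(3)])
  qed
qed

text \<open>The set of disagreement inside (a, b) is open and null, hence empty; continuity extends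
  this to the endpoints. It identifies the continuous f' of the operator domain with the absolutely
  continuous representative, so that the boundary conditions carry over.\<close>

lemma continuous_AE_eq:
  fixes f g :: "real \<Rightarrow> complex"
  assumes "a < b" "continuous_on {a..b} f" "continuous_on {a..b} g"
    and "AE x in lebesgue_on {a<..<b}. f x = g x" and "x \<in> {a..b}"
  shows "f x = g x"
proof -
  obtain N where N: "negligible N" "\<And>x. x \<in> {a<..<b} - N \<Longrightarrow> f x = g x"
    using assms(4) by (subst (asm) AE_lebesgue_on_iff_negligible) auto
  have cd: "continuous_on {a..b} (\<lambda>x. f x - g x)"
    by (intro continuous_intros assms)
  have "open ({a<..<b} \<inter> (\<lambda>x. f x - g x) -` (- {0}))"
    by (rule continuous_open_preimage[OF continuous_on_subset[OF cd]]) auto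
  moreover have "{a<..<b} \<inter> (\<lambda>x. f x - g x) -` (- {0}) \<subseteq> N"
    using N(2) by auto
  ultimately have "{a<..<b} \<inter> (\<lambda>x. f x - g x) -` (- {0}) = {}"
    using N(1) negligible_subset open_not_negligible by blast
  then have z: "f t - g t = 0" if "t \<in> {a<..<b}" for t
    using that by auto
  have "closure {a<..<b} = {a..b}" using assms(1) by simp
  then have "f x - g x = 0"
    using continuous_constant_on_closure[of "{a<..<b}" "\<lambda>x. f x - g x" 0 x, OF _ z] cd assms(5) by metis
  then show ?thesis by simp
qed

definition neumann_sol :: "real \<Rightarrow> real \<Rightarrow> (real \<Rightarrow> complex) \<Rightarrow> (real \<Rightarrow> complex) \<Rightarrow> (real \<Rightarrow> complex) \<Rightarrow> bool" where
  "neumann_sol a b y y1 y2 \<longleftrightarrow> AC a b y y1 \<and> AC a b y1 y2 \<and> y1 a = 0 \<and> y1 b = 0"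

text \<open>Only \<open>f\<close> and \<open>u\<close> are determined up to null sets; the
  representative \<open>y\<close> and its derivative \<open>y1\<close> satisfy their equations
  everywhere on the closed interval.\<close>

lemma neumann_realization_iff:
  assumes "a < b"
  shows "(f, u) \<in> neumann_realization q a b \<longleftrightarrow>
    (\<exists>y y1 y2. neumann_sol a b y y1 y2 \<and> (AE x in lebesgue_on {a<..<b}. f x = y x) \<and>
       u \<in> L2 (lebesgue_on {a<..<b}) \<and>
       (AE x in lebesgue_on {a<..<b}. u x = - y2 x + of_real (q x) * y x))"
proof
  assume "(f, u) \<in> neumann_realization q a b"
  then obtain f1 f2 where *: "has_L1_weak_derivative {a<..<b} f f1" "has_L1_weak_derivative {a<..<b} f1 f2"
     "continuous_on {a..b} f1" "f1 a = 0" "f1 b = 0" "u \<in> L2 (lebesgue_on {a<..<b})"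
     "AE x in lebesgue_on {a<..<b}. u x = - f2 x + of_real (q x) * f x"
    unfolding neumann_realization_def by blast
  obtain y where y: "AC a b y f1" "AE x in lebesgue_on {a<..<b}. f x = y x"
    using *(1) has_L1_weak_derivative_iff_AC[OF assms] by blast
  obtain y1 where y1: "AC a b y1 f2" "AE x in lebesgue_on {a<..<b}. f1 x = y1 x"
    using *(2) has_L1_weak_derivative_iff_AC[OF assms] by blast
  have "AC a b f1 f2"
    by (rule AC_cong[OF y1(1), of f1 "{}"])
       (use continuous_AE_eq[OF assms *(3) AC_continuous[OF y1(1)] y1(2)] assms in auto)
  moreover have "AE x in lebesgue_on {a<..<b}. u x = - f2 x + of_real (q x) * y x"
    using *(7) y(2) by eventually_elim auto
  ultimately show "\<exists>y y1 y2. neumann_sol a b y y1 y2 \<and> (AE x in lebesgue_on {a<..<b}. f x = y x) \<and>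
       u \<in> L2 (lebesgue_on {a<..<b}) \<and>
       (AE x in lebesgue_on {a<..<b}. u x = - y2 x + of_real (q x) * y x)"
    using y * by (auto simp: neumann_sol_def)
next
  assume "\<exists>y y1 y2. neumann_sol a b y y1 y2 \<and> (AE x in lebesgue_on {a<..<b}. f x = y x) \<and>
       u \<in> L2 (lebesgue_on {a<..<b}) \<and>
       (AE x in lebesgue_on {a<..<b}. u x = - y2 x + of_real (q x) * y x)"
  then obtain y y1 y2 where *: "neumann_sol a b y y1 y2" "AE x in lebesgue_on {a<..<b}. f x = y x"
       "u \<in> L2 (lebesgue_on {a<..<b})" "AE x in lebesgue_on {a<..<b}. u x = - y2 x + of_real (q x) * y x"
    by blast
  have "has_L1_weak_derivative {a<..<b} f y1" "has_L1_weak_derivative {a<..<b} y1 y2"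
    using * has_L1_weak_derivative_iff_AC[OF assms] by (auto simp: neumann_sol_def)
  moreover have "AE x in lebesgue_on {a<..<b}. u x = - y2 x + of_real (q x) * f x"
    using *(2,4) by eventually_elim auto
  ultimately show "(f, u) \<in> neumann_realization q a b"
    using * AC_continuous[of a b y1 y2] unfolding neumann_realization_def neumann_sol_def by blast
qed

subsection \<open>The Neumann problem as an initial value problem\<close>

lemma AC_ident: "AC a b (\<lambda>t. of_real t) (\<lambda>t. 1)"
proof (rule AC_I)
  show "complex_of_real x = of_real a + integral {a..x} (\<lambda>t. 1)" if "a \<le> x" "x \<le> b" for x
    using that by (simp add: scaleR_conv_of_real)
qed (intro absolutely_integrable_continuous_real continuous_intros)

lemma integral_norm_le:
  fixes f :: "real \<Rightarrow> complex"
  assumes "f absolutely_integrable_on {a..b}" "h integrable_on {a..b}" "\<And>t. t \<in> {a..b} \<Longrightarrow> cmod (f t) \<le> h t"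
  shows "cmod (integral {a..b} f) \<le> integral {a..b} h"
  using absolutely_integrable_imp_integrable_on[OF assms(1)] assms(2,3) by (rule integral_norm_bound_integral)

lemma norm_integrable: "f absolutely_integrable_on {a..b} \<Longrightarrow> (\<lambda>t. cmod (f t)) integrable_on {a..b::real}"
  by (auto simp: absolutely_integrable_on_def)

lemma integral_norm_mono:
  fixes f :: "real \<Rightarrow> complex"
  assumes "f absolutely_integrable_on {a..b}" "x \<le> b"
  shows "integral {a..x} (\<lambda>t. cmod (f t)) \<le> integral {a..b} (\<lambda>t. cmod (f t))"
proof (rule integral_subset_le)
  show "(\<lambda>t. cmod (f t)) integrable_on {a..x}"
    by (rule integrable_on_subinterval[OF norm_integrable[OF assms(1)]]) (use assms(2) in auto)
qed (use assms norm_integrable[OF assms(1)] in auto)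

text \<open>Integration by parts of h(t) (x - t), whose boundary terms vanish at t = x by the kernel
  and at t = a by \<open>y1 a = 0\<close>. A second-order problem with these data thus becomes one
  scalar Volterra equation.\<close>

lemma ode_integral_eq:
  assumes y: "AC a b y y1" and h: "AC a b y1 h" and "y1 a = 0" and x: "a \<le> x" "x \<le> b"
  shows "y x = y a + integral {a..x} (\<lambda>t. h t * of_real (x - t))"
proof -
  have l: "AC a x (\<lambda>t. of_real (x - t)) (\<lambda>t. 0 - 1)"
    using AC_diff[OF AC_const[of a x "of_real x"] AC_ident[of a x]] by simp
  have h': "AC a x y1 h" and y': "AC a x y y1"
    using AC_subinterval[OF h, of a x] AC_subinterval[OF y, of a x] x by auto
  have i1: "(\<lambda>t. h t * of_real (x - t)) integrable_on {a..x}"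
    by (rule absolutely_integrable_imp_integrable_on[OF absolutely_integrable_mult_continuous[OF
        AC_integrable[OF h'] AC_continuous[OF l]]])
  have i2: "y1 integrable_on {a..x}"
    by (rule absolutely_integrable_imp_integrable_on[OF AC_integrable[OF y']])
  have "integral {a..x} (\<lambda>t. h t * of_real (x - t) + y1 t * (0 - 1)) = 0"
    using AC_eq[OF AC_mult[OF h' l] x(1) order_refl] \<open>y1 a = 0\<close> by simp
  then have "integral {a..x} (\<lambda>t. h t * of_real (x - t)) = integral {a..x} y1"
    using i1 i2 by (simp add: Henstock_Kurzweil_Integration.integral_diff)
  then show ?thesis
    using AC_eq[OF y x] by simp
qed

text \<open>The inequality u \<le> e^u at u = \<kappa> s.\<close>

lemma kernel_bound:
  fixes \<kappa> s :: real
  assumes "\<kappa> > 0" "s \<ge> 0"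
  shows "exp (- \<kappa> * s) * s \<le> 1 / \<kappa>"
proof -
  have "\<kappa> * s \<le> exp (\<kappa> * s)"
    using exp_ge_add_one_self[of "\<kappa> * s"] by linarith
  then have "s \<le> exp (\<kappa> * s) / \<kappa>"
    using assms by (simp add: field_simps)
  then have "exp (- \<kappa> * s) * s \<le> exp (- \<kappa> * s) * (exp (\<kappa> * s) / \<kappa>)"
    by (rule mult_left_mono) simp
  also have "\<dots> = 1 / \<kappa>"
    by (simp add: exp_minus)
  finally show ?thesis .
qed

text \<open>The kernel \<open>x - t\<close> of the Volterra equation vanishes on the diagonal; with the weight
  \<open>e\<^sup>-\<^sup>\<kappa>\<^sup>x\<close> it is therefore bounded by \<open>1/\<kappa>\<close>, and the Volterra operator becomes a contraction.\<close>

lemma ode_apriori: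
  assumes y: "AC a b y y1" and h: "AC a b y1 (\<lambda>x. V x * y x - g x)" and y1: "y1 a = 0" and "a \<le> b"
    and V: "V absolutely_integrable_on {a..b}" and g: "g absolutely_integrable_on {a..b}"
    and \<kappa>: "\<kappa> > 0" "2 * integral {a..b} (\<lambda>t. cmod (V t)) \<le> \<kappa>"
    and x: "x \<in> {a..b}"
  shows "cmod (y x) \<le> 2 * exp (\<kappa> * (b - a)) * (cmod (y a) + (b - a) * integral {a..b} (\<lambda>t. cmod (g t)))"
proof -
  \<comment> \<open>The Volterra equation is evaluated only at a maximum point \<open>x0\<close> of
    the weighted modulus: there both sides are expressed by the same number \<open>M\<close>, which
    can be absorbed.\<close>
  define w where "w t = exp (- \<kappa> * (t - a)) * cmod (y t)" for t
  have "continuous_on {a..b} w"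
    unfolding w_def by (intro continuous_intros AC_continuous[OF y])
  moreover have "compact {a..b}" "{a..b} \<noteq> {}" using \<open>a \<le> b\<close> by auto
  ultimately obtain x0 where x0: "x0 \<in> {a..b}" "\<And>t. t \<in> {a..b} \<Longrightarrow> w t \<le> w x0"
    using continuous_attains_sup[of "{a..b}" w] by blast
  define M where "M = w x0"
  have M0: "M \<ge> 0" by (simp add: M_def w_def)
  have yM: "cmod (y t) \<le> M * exp (\<kappa> * (t - a))" if "t \<in> {a..b}" for t
  proof -
    have "w t \<le> M" using x0(2)[OF that] by (simp add: M_def)
    then have "w t * exp (\<kappa> * (t - a)) \<le> M * exp (\<kappa> * (t - a))" by (rule mult_right_mono) simp
    moreover have "w t * exp (\<kappa> * (t - a)) = cmod (y t)"
      by (simp add: w_def mult.assoc[symmetric] mult.commute[of _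
          "exp (\<kappa> * (t - a))"] exp_minus_inverse exp_add[symmetric])
    ultimately show ?thesis by simp
  qed
  define Gi where "Gi = integral {a..b} (\<lambda>t. cmod (g t))"
  define Vi where "Vi = integral {a..b} (\<lambda>t. cmod (V t))"
  have x0': "a \<le> x0" "x0 \<le> b" using x0 by auto
  have Vx: "V absolutely_integrable_on {a..x0}" and gx: "g absolutely_integrable_on {a..x0}"
    by (rule absolutely_integrable_on_subinterval[OF V] absolutely_integrable_on_subinterval[OF g]; use x0'
        in auto)+
  have G0: "0 \<le> Gi" unfolding Gi_def by (intro Henstock_Kurzweil_Integration.integral_nonneg norm_integrable g) auto
  have "M \<le> cmod (y a) + (M / \<kappa> * Vi + (b - a) * Gi)"
  proof -
    let ?k = "\<lambda>t. (V t * y t - g t) * of_real (x0 - t)"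
    have ki: "?k absolutely_integrable_on {a..x0}"
      by (intro absolutely_integrable_mult_continuous continuous_intros
          absolutely_integrable_on_subinterval[OF AC_integrable[OF h]]) (use x0' in auto)
    have "exp (- \<kappa> * (x0 - a)) * cmod (integral {a..x0} ?k) = cmod (integral {a..x0}
        (\<lambda>t. of_real (exp (- \<kappa> * (x0 - a))) * ?k t))"
      by (simp add: norm_mult)
    also have "\<dots> \<le> integral {a..x0} (\<lambda>t. M / \<kappa> * cmod (V t) + (b - a) * cmod (g t))"
    proof (rule integral_norm_le)
      show "(\<lambda>t. of_real (exp (- \<kappa> * (x0 - a))) * ?k t) absolutely_integrable_on {a..x0}"
        using ki by (rule set_integrable_mult_right)
      show "(\<lambda>t. M / \<kappa> * cmod (V t) + (b - a) * cmod (g t)) integrable_on {a..x0}"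
        by (intro integrable_add integrable_on_mult_right norm_integrable Vx gx)
      fix t assume t: "t \<in> {a..x0}"
      have e1: "exp (- \<kappa> * (x0 - a)) * (x0 - t) * exp (\<kappa> * (t - a)) \<le> 1 / \<kappa>"
      proof -
        have "exp (- \<kappa> * (x0 - a)) * (x0 - t) * exp (\<kappa> * (t - a))
            = (exp (- \<kappa> * (x0 - a)) * exp (\<kappa> * (t - a))) * (x0 - t)"
          by simp
        also have "exp (- \<kappa> * (x0 - a)) * exp (\<kappa> * (t - a)) = exp (- \<kappa> * (x0 - t))"
          unfolding exp_add[symmetric] by (simp add: algebra_simps)
        also have "exp (- \<kappa> * (x0 - t)) * (x0 - t) \<le> 1 / \<kappa>"
          by (rule kernel_bound[OF \<kappa>(1)]) (use t in simp)
        finally show ?thesis .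
      qed
      have "cmod (of_real (exp (- \<kappa> * (x0 - a))) * ?k t)
          = exp (- \<kappa> * (x0 - a)) * (cmod (V t * y t - g t) * (x0 - t))"
        using t by (simp add: norm_mult del: of_real_diff)
      also have "\<dots> \<le> exp (- \<kappa> * (x0 - a)) * ((cmod (V t) * (M * exp (\<kappa> * (t - a))) + cmod (g t)) * (x0 - t))"
      proof -
        have "cmod (V t * y t - g t) \<le> cmod (V t) * cmod (y t) + cmod (g t)"
          by (metis norm_mult norm_triangle_ineq4)
        also have "\<dots> \<le> cmod (V t) * (M * exp (\<kappa> * (t - a))) + cmod (g t)"
          using yM[of t] t x0' by (intro add_right_mono mult_left_mono) auto
        finally show ?thesis using t by (intro mult_left_mono mult_right_mono) auto
      qed
      also have "\<dots> = M * cmod (V t) * (exp (- \<kappa> * (x0 - a)) * (x0 - t) * exp (\<kappa> * (t - a)))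
          + exp (- \<kappa> * (x0 - a)) * (x0 - t) * cmod (g t)"
        by (simp add: algebra_simps)
      also have "\<dots> \<le> M * cmod (V t) * (1 / \<kappa>) + (b - a) * cmod (g t)"
      proof (intro add_mono mult_left_mono mult_right_mono e1)
        have "exp (- \<kappa> * (x0 - a)) * (x0 - t) \<le> 1 * (b - a)"
          using t x0' \<kappa>(1) by (intro mult_mono) (auto simp: mult_nonneg_nonneg)
        then show "exp (- \<kappa> * (x0 - a)) * (x0 - t) \<le> b - a" by simp
      qed (use M0 in auto)
      finally show "cmod (of_real (exp (- \<kappa> * (x0 - a))) * ?k t) \<le> M / \<kappa> * cmod (V t) + (b - a) * cmod (g t)"
        by simp
    qed
    also have "\<dots> = M / \<kappa> * integral {a..x0} (\<lambda>t. cmod (V t)) + (b - a) * integral {a..x0} (\<lambda>t. cmod (g t))"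
      by (simp only: integral_mult_right Henstock_Kurzweil_Integration.integral_add[OF
            integrable_on_mult_right[OF norm_integrable[OF Vx]] integrable_on_mult_right[OF
                norm_integrable[OF gx]]])
    also have "\<dots> \<le> M / \<kappa> * Vi + (b - a) * Gi"
      unfolding Vi_def Gi_def using M0 \<kappa>(1) \<open>a \<le> b\<close> x0'
      by (intro add_mono mult_left_mono integral_norm_mono V g) auto
    finally have I: "exp (- \<kappa> * (x0 - a)) * cmod (integral {a..x0} ?k) \<le> M / \<kappa> * Vi + (b - a) * Gi" .
    have "M = exp (- \<kappa> * (x0 - a)) * cmod (y a + integral {a..x0} ?k)"
      using ode_integral_eq[OF y h y1 x0'] by (simp add: M_def w_def)
    also have "\<dots> \<le> exp (- \<kappa> * (x0 - a)) * (cmod (y a) + cmod (integral {a..x0} ?k))"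
      by (intro mult_left_mono norm_triangle_ineq) auto
    also have "\<dots> = exp (- \<kappa> * (x0 - a)) * cmod (y a) + exp (- \<kappa> * (x0 - a)) * cmod (integral {a..x0} ?k)"
      by (simp add: distrib_left)
    also have "\<dots> \<le> 1 * cmod (y a) + (M / \<kappa> * Vi + (b - a) * Gi)"
      using I x0' \<kappa>(1) by (intro add_mono mult_right_mono) auto
    finally show ?thesis by simp
  qed
  \<comment> \<open>The choice of \<open>\<kappa>\<close> leaves half of \<open>M\<close> on the
    left; this is the origin of the factor 2 in the estimate.\<close>
  moreover have "M / \<kappa> * Vi \<le> M / 2"
  proof -
    have "M * (2 * Vi) \<le> M * \<kappa>" using \<kappa>(2) M0 unfolding Vi_def by (rule mult_left_mono)
    then show ?thesis using \<kappa>(1) by (simp add: field_simps)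
  qed
  moreover have "M \<le> 2 * (u + X)" if "M \<le> u + (Z + X)" "Z \<le> M / 2" for u X Z :: real
    using that by (simp add: field_simps)
  ultimately have "M \<le> 2 * (cmod (y a) + (b - a) * Gi)" by blast
  then have "M * exp (\<kappa> * (x - a)) \<le> 2 * (cmod (y a) + (b - a) * Gi) * exp (\<kappa> * (b - a))"
    using x \<kappa>(1) M0 G0 \<open>a \<le> b\<close> by (intro mult_mono) auto
  from order_trans[OF yM[OF x] this] show ?thesis
    by (simp add: Gi_def algebra_simps)
qed

text \<open>Banach's fixed point theorem for the Volterra equation in the exponentially weighted sup
  norm. The weight permits a contraction on the whole interval at once, without continuation from
  short subintervals.\<close>

lemma ode_exists:
  assumes "a \<le> b" and V: "V absolutely_integrable_on {a..b}" and g: "g absolutely_integrable_on {a..b}"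
  obtains y y1 where "AC a b y y1" "AC a b y1 (\<lambda>x. V x * y x - g x)" "y a = \<alpha>" "y1 a = 0"
proof -
  define Vi where "Vi = integral {a..b} (\<lambda>t. cmod (V t))"
  have Vi: "Vi \<ge> 0" unfolding Vi_def by (intro Henstock_Kurzweil_Integration.integral_nonneg norm_integrable V) auto
  \<comment> \<open>Twice the L^1 norm of V gives the contraction constant 1/2; the summand 1 keeps
    \<open>\<kappa>\<close> positive when V vanishes.\<close>
  define \<kappa> where "\<kappa> = 2 * Vi + 1"
  have \<kappa>: "\<kappa> > 0" "2 * Vi \<le> \<kappa>" using Vi by (auto simp: \<kappa>_def)
  \<comment> \<open>The unknown is z(x) = e^(-\<kappa> (x - a)) y(x), so that the plain sup distance
    of z is the weighted one of y.\<close>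
  define h where "h z t = V t * (of_real (exp (\<kappa> * (t - a))) * z t) - g t" for z :: "real \<Rightarrow> complex" and t
  \<comment> \<open>The kernel x - t is split into its two terms. Both are then built from
    indefinite integrals, which makes continuity and the derivative of the fixed point
    immediate.\<close>
  define K where "K z x = \<alpha> + (of_real x * integral {a..x} (h z) - integral {a..x} (\<lambda>t. h z t * of_real t))" for z x
  have hi: "h z absolutely_integrable_on {a..b}" if "continuous_on {a..b} z" for z
    unfolding h_def
    by (intro set_integral_diff(1) g absolutely_integrable_mult_continuous V continuous_intros that)
  have hti: "(\<lambda>t. h z t * of_real t) absolutely_integrable_on {a..b}" if "continuous_on {a..b} z" for z
    by (intro absolutely_integrable_mult_continuous hi that continuous_intros)
  have Kc: "continuous_on {a..b} (K z)" if "continuous_on {a..b} z" for z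
    unfolding K_def
    using indefinite_integral_continuous_1[OF absolutely_integrable_imp_integrable_on[OF hi[OF that]]]
        indefinite_integral_continuous_1[OF absolutely_integrable_imp_integrable_on[OF hti[OF that]]]
    by (intro continuous_on_add continuous_on_diff continuous_on_mult continuous_on_const
        continuous_on_of_real continuous_on_id)
  \<comment> \<open>Functions on [a, b] are extended constantly beyond the endpoints by
    \<open>clamp\<close>; the iteration then takes place in the complete space of bounded continuous
    functions on the line.\<close>
  have "\<exists>G :: real \<Rightarrow>\<^sub>C complex. \<forall>x. apply_bcontfun G x
      = of_real (exp (- \<kappa> * (clamp a b x - a))) * K (apply_bcontfun z) (clamp a b x)" for z
  proof -
    have "continuous_on (cbox a b) (\<lambda>x. of_real (exp (- \<kappa> * (x - a))) * K (apply_bcontfun z) x)"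
      unfolding box_real by (intro continuous_intros Kc) auto
    then show ?thesis by (rule continuous_on_cbox_bcontfunE) blast
  qed
  then obtain \<Phi> :: "(real \<Rightarrow>\<^sub>C complex) \<Rightarrow> (real \<Rightarrow>\<^sub>C complex)" where
    \<Phi>: "\<And>z x. apply_bcontfun (\<Phi> z) x = of_real (exp (- \<kappa> * (clamp a b x - a))) * K (apply_bcontfun z) (clamp a b x)"
    by metis
  have contr: "dist (\<Phi> z) (\<Phi> w) \<le> 1 / 2 * dist z w" for z w
  proof (rule dist_bound)
    fix x0
    define x where "x = clamp a b x0"
    have x: "a \<le> x" "x \<le> b"
      using clamp_in_interval[of a b x0] \<open>a \<le> b\<close> unfolding x_def by auto
    have sub: "f absolutely_integrable_on {a..b} \<Longrightarrow> f absolutely_integrable_on {a..x}" for f :: "real \<Rightarrow> complex"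
      by (rule absolutely_integrable_on_subinterval) (use x in auto)
    have cz: "continuous_on {a..b} (apply_bcontfun z)" "continuous_on {a..b} (apply_bcontfun w)" by auto
    note i = sub[OF hi[OF cz(1)]] sub[OF hti[OF cz(1)]] sub[OF hi[OF cz(2)]] sub[OF hti[OF cz(2)]]
    note j = i[THEN absolutely_integrable_imp_integrable_on]
    have "K z x - K w x = integral {a..x} (\<lambda>t. (h z t - h w t) * of_real (x - t))"
    proof -
      have "integral {a..x} (\<lambda>t. (h z t - h w t) * of_real (x - t))
        = integral {a..x} (\<lambda>t. (of_real x * h z t - h z t * of_real t) - (of_real x * h w t - h w t * of_real t))"
        by (rule integral_cong) (simp add: algebra_simps)
      also have "\<dots> = K z x - K w x"
        using j by (simp add: Henstock_Kurzweil_Integration.integral_diff integrable_diff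
            integrable_on_mult_right K_def)
      finally show ?thesis ..
    qed
    also have "(\<lambda>t. (h z t - h w t) * of_real (x - t)) =
        (\<lambda>t. V t * (of_real (exp (\<kappa> * (t - a))) * (z t - w t) * of_real (x - t)))"
      by (simp add: h_def algebra_simps)
    finally have eq: "of_real (exp (- \<kappa> * (x - a))) * K z x - of_real (exp (- \<kappa> * (x - a))) * K w x
       = integral {a..x} (\<lambda>t. of_real (exp (- \<kappa> * (x - a))) * (V t * (of_real (exp (\<kappa> * (t - a))) * (z t - w
           t) * of_real (x - t))))"
      by (simp add: right_diff_distrib[symmetric])
    have "cmod \<dots> \<le> integral {a..x} (\<lambda>t. (dist z w / \<kappa>) * cmod (V t))"
    proof (rule integral_norm_le)
      show "(\<lambda>t. of_real (exp (- \<kappa> * (x - a))) * (V t * (of_real (exp (\<kappa> * (t - a))) * (z t - w t) * of_real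
          (x - t)))) absolutely_integrable_on {a..x}"
        by (intro set_integrable_mult_right absolutely_integrable_mult_continuous sub V continuous_intros) auto
      show "(\<lambda>t. (dist z w / \<kappa>) * cmod (V t)) integrable_on {a..x}"
        by (intro integrable_on_mult_right norm_integrable sub V)
      fix t assume t: "t \<in> {a..x}"
      have "exp (- \<kappa> * (x - a)) * exp (\<kappa> * (t - a)) = exp (- \<kappa> * (x - t))"
        unfolding exp_add[symmetric] by (simp add: algebra_simps)
      then have e1: "exp (- \<kappa> * (x - a)) * (exp (\<kappa> * (t - a)) * (x - t)) \<le> 1 / \<kappa>"
        using kernel_bound[OF \<kappa>(1), of "x - t"] t by (simp add: mult.assoc[symmetric])
      have "cmod (of_real (exp (- \<kappa> * (x - a))) * (V t * (of_real (exp (\<kappa> * (t - a))) * (z t - w t) *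
          of_real (x - t))))
         = cmod (z t - w t) * cmod (V t) * (exp (- \<kappa> * (x - a)) * (exp (\<kappa> * (t - a)) * (x - t)))"
        using t by (simp add: norm_mult del: of_real_diff)
      also have "\<dots> \<le> dist z w * cmod (V t) * (1 / \<kappa>)"
        using dist_bounded[of z t w] t e1 by (intro mult_mono mult_nonneg_nonneg) (auto simp: dist_norm)
      finally show "cmod (of_real (exp (- \<kappa> * (x - a))) * (V t * (of_real (exp (\<kappa> * (t - a))) * (z t - w t)
          * of_real (x - t)))) \<le> dist z w / \<kappa> * cmod (V t)"
        by simp
    qed
    also have "\<dots> \<le> dist z w / \<kappa> * Vi"
      unfolding Vi_def integral_mult_right using \<kappa>(1) by (intro mult_left_mono integral_norm_mono V x) auto
    also have "\<dots> \<le> 1 / 2 * dist z w"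
      using \<kappa> mult_left_mono[OF \<kappa>(2), of "dist z w"] by (simp add: field_simps)
    finally show "dist (\<Phi> z x0) (\<Phi> w x0) \<le> 1 / 2 * dist z w"
      using eq by (simp add: \<Phi> dist_norm x_def[symmetric])
  qed
  obtain z where z: "\<Phi> z = z"
    using banach_fix_type[of "1 / 2" \<Phi>] contr by auto
  have zK: "apply_bcontfun z x = of_real (exp (- \<kappa> * (x - a))) * K z x" if "x \<in> {a..b}" for x
    using \<Phi>[of z x] clamp_cancel_cbox[of x a b] that unfolding z box_real by simp
  have cz: "continuous_on {a..b} (apply_bcontfun z)" by auto
  define y1 where "y1 x = 0 + integral {a..x} (h z)" for x
  have y1: "AC a b y1 (h z)" unfolding y1_def by (rule AC_indef[OF hi[OF cz]])
  have I: "AC a b (\<lambda>x. 0 + integral {a..x} (\<lambda>t. h z t * of_real t)) (\<lambda>t. h z t * of_real t)"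
    by (rule AC_indef[OF hti[OF cz]])
  have "AC a b (\<lambda>x. \<alpha> + (of_real x * y1 x - (0 + integral {a..x} (\<lambda>t. h z t * of_real t))))
     (\<lambda>x. 0 + ((1 * y1 x + of_real x * h z x) - h z x * of_real x))"
    by (rule AC_add[OF AC_const AC_diff[OF AC_mult[OF AC_ident y1] I]])
  then have y: "AC a b (K z) y1"
    by (simp add: K_def[abs_def] y1_def[abs_def] mult.commute)
  have hz: "h z x = V x * K z x - g x" if "x \<in> {a..b}" for x
  proof -
    have "of_real (exp (\<kappa> * (x - a))) * apply_bcontfun z x = K z x"
      unfolding zK[OF that] mult.assoc[symmetric] of_real_mult[symmetric] exp_add[symmetric] by simp
    then show ?thesis by (simp add: h_def)
  qed
  have y1': "AC a b y1 (\<lambda>x. V x * K z x - g x)"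
    by (rule AC_cong[OF y1 _ negligible_empty]) (use hz \<open>a \<le> b\<close> in auto)
  show thesis
    by (rule that[OF y y1']) (auto simp: K_def y1_def)
qed


section \<open>Eigenvalues and resolvent on a single interval\<close>

text \<open>For integrable q a solution with y'(a) = 0 and y(a) = 0 vanishes identically. The
  normalization therefore excludes only the zero solution, and it makes the eigenfunction
  unique.\<close>

definition neumann_eig :: "(real \<Rightarrow> real) \<Rightarrow> real \<Rightarrow> real \<Rightarrow> complex \<Rightarrow> bool" where
  "neumann_eig q a b w \<longleftrightarrow>
     (\<exists>y y1. neumann_sol a b y y1 (\<lambda>x. (of_real (q x) - w) * y x) \<and> y a = 1)"

lemma AC_cong_deriv:
  assumes "AC a b F f" "\<And>x. f x = g x"
  shows "AC a b F g"
proof -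
  have "f = g" using assms(2) by (rule ext)
  then show ?thesis using assms(1) by simp
qed

lemma potential_integrable:
  fixes q :: "real \<Rightarrow> real"
  assumes "q absolutely_integrable_on {a..b}"
  shows "(\<lambda>x. complex_of_real (q x) - w) absolutely_integrable_on {a..b}"
proof (rule set_integral_diff(1))
  show "(\<lambda>x. complex_of_real (q x)) absolutely_integrable_on {a..b}"
    using absolutely_integrable_linear[OF assms bounded_linear_of_real[where 'a = complex]] by (simp add: o_def)
qed (rule absolutely_integrable_continuous_real[OF continuous_on_const])

lemma neumann_sol_diff:
  assumes "neumann_sol a b y y1 (\<lambda>x. V x * y x - g x)" "neumann_sol a b z z1 (\<lambda>x. V x * z x - h x)"
  shows "neumann_sol a b (\<lambda>x. y x - z x) (\<lambda>x. y1 x - z1 x) (\<lambda>x. V x * (y x - z x) - (g x - h x))"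
proof -
  have *: "AC a b y y1" "AC a b z z1" "AC a b y1 (\<lambda>x. V x * y x - g x)" "AC a b z1 (\<lambda>x. V x * z x - h x)"
    "y1 a = 0" "y1 b = 0" "z1 a = 0" "z1 b = 0"
    using assms unfolding neumann_sol_def by blast+
  have "AC a b (\<lambda>x. y1 x - z1 x) (\<lambda>x. V x * (y x - z x) - (g x - h x))"
    by (rule AC_cong_deriv[OF AC_diff[OF *(3,4)]]) (simp add: algebra_simps)
  then show ?thesis
    using AC_diff[OF *(1,2)] * by (simp add: neumann_sol_def)
qed

lemma neumann_sol_cmult:
  assumes "neumann_sol a b y y1 (\<lambda>x. V x * y x)"
  shows "neumann_sol a b (\<lambda>x. c * y x) (\<lambda>x. c * y1 x) (\<lambda>x. V x * (c * y x))"
proof -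
  have *: "AC a b y y1" "AC a b y1 (\<lambda>x. V x * y x)" "y1 a = 0" "y1 b = 0"
    using assms unfolding neumann_sol_def by blast+
  have "AC a b (\<lambda>x. c * y1 x) (\<lambda>x. V x * (c * y x))"
    by (rule AC_cong_deriv[OF AC_cmult[OF *(2)]]) (simp add: algebra_simps)
  then show ?thesis
    using AC_cmult[OF *(1)] * by (simp add: neumann_sol_def)
qed

text \<open>The a priori estimate with zero data and zero right-hand side.\<close>

lemma ode_zero:
  assumes "AC a b y y1" "AC a b y1 (\<lambda>x. V x * y x)" "y1 a = 0" "y a = 0" "a \<le> b"
    and V: "V absolutely_integrable_on {a..b}" and x: "x \<in> {a..b}"
  shows "y x = 0"
proof -
  have "0 \<le> integral {a..b} (\<lambda>t. cmod (V t))"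
    by (intro Henstock_Kurzweil_Integration.integral_nonneg norm_integrable V) auto
  then have "cmod (y x) \<le> 2 * exp ((2 * integral {a..b} (\<lambda>t. cmod (V t)) + 1) * (b - a)) * (cmod (y a)
      + (b - a) * integral {a..b} (\<lambda>t. cmod 0))"
    using assms by (intro ode_apriori[of a b y y1 V "\<lambda>_. 0"]) auto
  then show ?thesis using assms by simp
qed

lemma neumann_eigI:
  assumes "neumann_sol a b y y1 (\<lambda>x. (of_real (q x) - w) * y x)" "x \<in> {a..b}" "y x \<noteq> 0"
    and q: "q absolutely_integrable_on {a..b}"
  shows "neumann_eig q a b w"
proof -
  have "y a \<noteq> 0"
    using ode_zero[of a b y y1 "\<lambda>x. of_real (q x) - w" x] assms potential_integrable[OF q, of w]
    by (auto simp: neumann_sol_def)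
  then show ?thesis
    using neumann_sol_cmult[OF assms(1), of "inverse (y a)"] unfolding neumann_eig_def by auto
qed

text \<open>Shooting: \<open>c\<close> solves the homogeneous and \<open>p\<close> the inhomogeneous
  initial value problem, and p - r c meets the condition at b for r = p'(b)/c'(b). The denominator
  is nonzero precisely because w is not an eigenvalue. The bound from L^1 to the sup norm is what
  the Volterra estimate yields; on a bounded interval it contains the L^2 bound.\<close>

lemma neumann_resolvent:
  assumes "a < b" and q: "q absolutely_integrable_on {a..b}" and w: "\<not> neumann_eig q a b w"
  obtains K where "K \<ge> 0" "\<And>g. g absolutely_integrable_on {a..b} \<Longrightarrow>
    \<exists>y y1. neumann_sol a b y y1 (\<lambda>x. (of_real (q x) - w) * y x - g x) \<and>
      (\<forall>x\<in>{a..b}. cmod (y x) \<le> K * integral {a..b} (\<lambda>t. cmod (g t)))"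
proof -
  define V where "V x = of_real (q x) - w" for x
  have V: "V absolutely_integrable_on {a..b}"
    unfolding V_def by (rule potential_integrable[OF q])
  define Vi where "Vi = integral {a..b} (\<lambda>t. cmod (V t))"
  have Vi: "Vi \<ge> 0" unfolding Vi_def by (intro Henstock_Kurzweil_Integration.integral_nonneg norm_integrable V) auto
  define E where "E = 2 * exp ((2 * Vi + 1) * (b - a))"
  have E: "E \<ge> 0" by (simp add: E_def)
  have ap: "cmod (y x) \<le> E * (cmod (y a) + (b - a) * integral {a..b} (\<lambda>t. cmod (g t)))"
    if "AC a b y y1" "AC a b y1 (\<lambda>x. V x * y x - g x)" "y1 a = 0" "g absolutely_integrable_on {a..b}"
        "x \<in> {a..b}" for y y1 g x
    unfolding E_def using \<open>a < b\<close> V Vi that by (intro ode_apriori[of a b y y1 V g]) (auto simp: Vi_def)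
  have z: "(\<lambda>_. 0 :: complex) absolutely_integrable_on {a..b}" by simp
  obtain c c1 where c: "AC a b c c1" "AC a b c1 (\<lambda>x. V x * c x - 0)" "c a = 1" "c1 a = 0"
    by (rule ode_exists[OF less_imp_le[OF assms(1)] V z, of 1])
  have c1: "c1 b \<noteq> 0"
  proof
    assume "c1 b = 0"
    then have "neumann_sol a b c c1 (\<lambda>x. (of_real (q x) - w) * c x)"
      using c by (simp add: neumann_sol_def V_def)
    then show False using w c(3) unfolding neumann_eig_def by blast
  qed
  have cb: "cmod (c x) \<le> E" if "x \<in> {a..b}" for x
    using ap[OF c(1,2,4) z that] c(3) by simp
  \<comment> \<open>The first summand bounds |p|; in the second, the quotient bounds the shooting
    coefficient r and the last \<open>E\<close> bounds |c|.\<close>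
  define K where "K = E * (b - a) + (E * (b - a) * Vi + 1) / cmod (c1 b) * E"
  show thesis
  proof (rule that[of K])
    show "K \<ge> 0" unfolding K_def using E Vi \<open>a < b\<close>
        by (intro add_nonneg_nonneg mult_nonneg_nonneg divide_nonneg_nonneg) auto
    fix g :: "real \<Rightarrow> complex" assume g: "g absolutely_integrable_on {a..b}"
    define Gi where "Gi = integral {a..b} (\<lambda>t. cmod (g t))"
    have Gi: "Gi \<ge> 0" unfolding Gi_def by (intro Henstock_Kurzweil_Integration.integral_nonneg
        norm_integrable g) auto
    obtain p p1 where p: "AC a b p p1" "AC a b p1 (\<lambda>x. V x * p x - g x)" "p a = 0" "p1 a = 0"
      by (rule ode_exists[OF less_imp_le[OF assms(1)] V g, of 0])
    have pb: "cmod (p x) \<le> E * (b - a) * Gi" if "x \<in> {a..b}" for x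
      using ap[OF p(1,2,4) g that] p(3) by (simp add: Gi_def)
    define r where "r = p1 b / c1 b"
    have "cmod (p1 b) \<le> (E * (b - a) * Vi + 1) * Gi"
    proof -
      have "cmod (p1 b) = cmod (integral {a..b} (\<lambda>x. V x * p x - g x))"
        using AC_eq[OF p(2), of b] p(4) \<open>a < b\<close> by simp
      also have "\<dots> \<le> integral {a..b} (\<lambda>x. E * (b - a) * Gi * cmod (V x) + cmod (g x))"
      proof (rule integral_norm_le[OF AC_integrable[OF p(2)]])
        show "(\<lambda>x. E * (b - a) * Gi * cmod (V x) + cmod (g x)) integrable_on {a..b}"
          by (intro integrable_add integrable_on_mult_right norm_integrable V g)
        fix x assume x: "x \<in> {a..b}"
        have "cmod (V x * p x - g x) \<le> cmod (p x) * cmod (V x) + cmod (g x)"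
          by (metis mult.commute norm_mult norm_triangle_ineq4)
        also have "\<dots> \<le> E * (b - a) * Gi * cmod (V x) + cmod (g x)"
          using pb[OF x] by (intro add_right_mono mult_right_mono) auto
        finally show "cmod (V x * p x - g x) \<le> E * (b - a) * Gi * cmod (V x) + cmod (g x)" .
      qed
      also have "\<dots> = E * (b - a) * Gi * Vi + Gi"
        by (simp only: integral_mult_right Vi_def Gi_def Henstock_Kurzweil_Integration.integral_add[OF
            integrable_on_mult_right[OF norm_integrable[OF V]] norm_integrable[OF g]])
      finally show ?thesis by (simp add: algebra_simps)
    qed
    then have rb: "cmod r \<le> (E * (b - a) * Vi + 1) / cmod (c1 b) * Gi"
      using c1 by (simp add: r_def norm_divide divide_right_mono)
    have 1: "AC a b (\<lambda>x. p x - r * c x) (\<lambda>x. p1 x - r * c1 x)"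
      by (rule AC_diff[OF p(1) AC_cmult[OF c(1)]])
    have 2: "AC a b (\<lambda>x. p1 x - r * c1 x) (\<lambda>x. (of_real (q x) - w) * (p x - r * c x) - g x)"
      by (rule AC_cong_deriv[OF AC_diff[OF p(2) AC_cmult[OF c(2)]]]) (simp add: V_def algebra_simps)
    have "neumann_sol a b (\<lambda>x. p x - r * c x) (\<lambda>x. p1 x - r * c1 x)
        (\<lambda>x. (of_real (q x) - w) * (p x - r * c x) - g x)"
      using 1 2 c p c1 by (simp add: neumann_sol_def r_def)
    moreover have "cmod (p x - r * c x) \<le> K * Gi" if x: "x \<in> {a..b}" for x
    proof -
      have "cmod (p x - r * c x) \<le> cmod (p x) + cmod r * cmod (c x)"
        by (metis norm_mult norm_triangle_ineq4)
      also have "\<dots> \<le> E * (b - a) * Gi + (E * (b - a) * Vi + 1) / cmod (c1 b) * Gi * E"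
        by (intro add_mono mult_mono pb cb x rb mult_nonneg_nonneg divide_nonneg_nonneg)
            (use E Vi Gi \<open>a < b\<close> in auto)
      also have "\<dots> = K * Gi" by (simp add: K_def algebra_simps)
      finally show ?thesis .
    qed
    ultimately show "\<exists>y y1. neumann_sol a b y y1 (\<lambda>x. (of_real (q x) - w) * y x - g x) \<and>
      (\<forall>x\<in>{a..b}. cmod (y x) \<le> K * integral {a..b} (\<lambda>t. cmod (g t)))"
      unfolding Gi_def by blast
  qed
qed

lemma neumann_unique:
  assumes "a < b" and q: "q absolutely_integrable_on {a..b}" and w: "\<not> neumann_eig q a b w"
    and y: "neumann_sol a b y y1 (\<lambda>x. (of_real (q x) - w) * y x - g x)"
    and z: "neumann_sol a b z z1 (\<lambda>x. (of_real (q x) - w) * z x - g x)"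
    and x: "x \<in> {a..b}"
  shows "y x = z x"
proof (rule ccontr)
  assume "y x \<noteq> z x"
  then show False
    using neumann_eigI[OF _ x _ q, of "\<lambda>x. y x - z x" "\<lambda>x. y1 x - z1 x" w] neumann_sol_diff[OF y z] w by simp
qed

text \<open>The Wronskian y z' - y' z has derivative (w - v) y z and vanishes at both ends. No
  complex conjugate occurs in the product.\<close>

lemma wronskian:
  assumes "a \<le> b" and y: "neumann_sol a b y y1 (\<lambda>x. (of_real (q x) - w) * y x)"
    and z: "neumann_sol a b z z1 (\<lambda>x. (of_real (q x) - v) * z x)" and "w \<noteq> v"
  shows "integral {a..b} (\<lambda>x. y x * z x) = 0"
proof -
  have *: "AC a b y y1" "AC a b y1 (\<lambda>x. (of_real (q x) - w) * y x)" "AC a b z z1" "AC a b z1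
      (\<lambda>x. (of_real (q x) - v) * z x)"
    "y1 a = 0" "y1 b = 0" "z1 a = 0" "z1 b = 0"
    using y z unfolding neumann_sol_def by blast+
  have "AC a b (\<lambda>x. y x * z1 x - y1 x * z x) (\<lambda>x. (w - v) * (y x * z x))"
    by (rule AC_cong_deriv[OF AC_diff[OF AC_mult[OF *(1,4)] AC_mult[OF *(2,3)]]]) (simp add: algebra_simps)
  from AC_eq[OF this assms(1) order_refl] show ?thesis
    using *(5-8) \<open>w \<noteq> v\<close> by simp
qed

lemma neumann_sol_cnj:
  assumes "neumann_sol a b y y1 (\<lambda>x. (of_real (q x) - w) * y x)"
  shows "neumann_sol a b (\<lambda>x. cnj (y x)) (\<lambda>x. cnj (y1 x)) (\<lambda>x. (of_real (q x) - cnj w) * cnj (y x))"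
  using assms AC_cnj[of a b y y1] AC_cnj[of a b y1 "\<lambda>x. (of_real (q x) - w) * y x"]
  by (simp add: neumann_sol_def)

lemma integral_norm_square_pos:
  fixes y :: "real \<Rightarrow> complex"
  assumes "a < b" "continuous_on {a..b} y" "y a \<noteq> 0"
  shows "integral {a..b} (\<lambda>x. (cmod (y x))\<^sup>2) > 0"
proof -
  have c: "continuous_on {a..b} (\<lambda>x. (cmod (y x))\<^sup>2)" by (intro continuous_intros assms)
  have "integral {a..b} (\<lambda>x. (cmod (y x))\<^sup>2) \<noteq> 0"
    using integral_eq_0_iff[OF c assms(1)] assms by force
  moreover have "integral {a..b} (\<lambda>x. (cmod (y x))\<^sup>2) \<ge> 0"
    by (intro Henstock_Kurzweil_Integration.integral_nonneg integrable_continuous_real c) auto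
  ultimately show ?thesis by linarith
qed

lemma integral_mult_cnj:
  fixes y :: "real \<Rightarrow> complex"
  assumes "continuous_on {a..b} y"
  shows "integral {a..b} (\<lambda>x. y x * cnj (y x)) = complex_of_real (integral {a..b} (\<lambda>x. (cmod (y x))\<^sup>2))"
proof -
  have "(\<lambda>x. y x * cnj (y x)) = (\<lambda>x. complex_of_real ((cmod (y x))\<^sup>2))"
    using complex_norm_square by metis
  then show ?thesis
    by (simp only:) (intro integral_of_real integrable_continuous_real continuous_intros assms)
qed

text \<open>The conjugate of an eigenfunction for w is one for the conjugate of w. Were the two
  eigenvalues different, the Wronskian identity would give \<integral> |y|^2 = 0.\<close>

lemma neumann_eig_real:
  assumes "a < b" and e: "neumann_eig q a b w"
  shows "w \<in> \<real>"
proof (rule ccontr)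
  assume "w \<notin> \<real>"
  then have "w \<noteq> cnj w" by (metis Reals_cnj_iff)
  obtain y y1 where y: "neumann_sol a b y y1 (\<lambda>x. (of_real (q x) - w) * y x)" "y a = 1"
    using e unfolding neumann_eig_def by blast
  have c: "continuous_on {a..b} y" using y(1) AC_continuous unfolding neumann_sol_def by blast
  show False
    using wronskian[OF less_imp_le[OF assms(1)] y(1) neumann_sol_cnj[OF y(1)] \<open>w \<noteq> cnj w\<close>]
      integral_mult_cnj[OF c] integral_norm_square_pos[OF assms(1) c] y(2) by simp
qed

text \<open>Eigenfunctions \<open>c\<close>, \<open>d\<close> for \<open>w \<noteq> v\<close> satisfy \<open>\<integral> c d = 0\<close>, but \<open>d\<close> tends to the real function
  \<open>c\<close> as \<open>v\<close> tends to \<open>w\<close>.\<close>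

lemma neumann_eig_isolated:
  assumes "a < b" and q: "q absolutely_integrable_on {a..b}" and e: "neumann_eig q a b w"
  obtains \<delta> where "\<delta> > 0" "\<And>v. v \<noteq> w \<Longrightarrow> cmod (v - w) < \<delta> \<Longrightarrow> \<not> neumann_eig q a b v"
proof -
  have wr: "cnj w = w" using neumann_eig_real[OF assms(1) e] by (simp add: Reals_cnj_iff)
  obtain c c1 where c: "neumann_sol a b c c1 (\<lambda>x. (of_real (q x) - w) * c x)" "c a = 1"
    using e unfolding neumann_eig_def by blast
  have cc: "continuous_on {a..b} c" using c(1) AC_continuous unfolding neumann_sol_def by blast
  have ci: "c absolutely_integrable_on {a..b}" by (rule absolutely_integrable_continuous_real[OF cc])
  define V where "V v x = of_real (q x) - v" for v :: complex and x
  have V: "V v absolutely_integrable_on {a..b}" for v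
    unfolding V_def by (rule potential_integrable[OF q])
  \<comment> \<open>Since w is real, the conjugate of c solves the same initial value problem. Only
    for real c is \<integral> c^2 the positive number \<open>I\<close>.\<close>
  have cnj_c: "cnj (c x) = c x" if "x \<in> {a..b}" for x
  proof -
    have d: "neumann_sol a b (\<lambda>x. cnj (c x) - c x) (\<lambda>x. cnj (c1 x) - c1 x)
        (\<lambda>x. V w x * (cnj (c x) - c x) - (0 - 0))"
      by (rule neumann_sol_diff[where V = "V w" and g = "\<lambda>_. 0" and h = "\<lambda>_. 0"])
         (use neumann_sol_cnj[OF c(1)] c(1) wr in \<open>simp_all add: V_def\<close>)
    then have "cnj (c x) - c x = 0"
      using ode_zero[of a b "\<lambda>x. cnj (c x) - c x" "\<lambda>x. cnj (c1 x) - c1 x" "V w" x] c(2) assms(1) V that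
      by (simp add: neumann_sol_def)
    then show ?thesis by simp
  qed
  define I where "I = integral {a..b} (\<lambda>x. (cmod (c x))\<^sup>2)"
  have I: "I > 0" unfolding I_def using integral_norm_square_pos[OF assms(1) cc] c(2) by simp
  have I_eq: "integral {a..b} (\<lambda>x. c x * c x) = of_real I"
    unfolding I_def integral_mult_cnj[OF cc, symmetric] by (rule integral_cong) (simp add: cnj_c)
  \<comment> \<open>Large enough for the a priori estimate with every v at distance less than 1 from
    w, so that \<open>E\<close> and \<open>L\<close> do not depend on v.\<close>
  define \<kappa> where "\<kappa> = 2 * (integral {a..b} (\<lambda>t. cmod (V w t)) + (b - a)) + 1"
  define E where "E = 2 * exp (\<kappa> * (b - a))"
  define Ci where "Ci = integral {a..b} (\<lambda>t. cmod (c t))"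
  have Ci: "Ci \<ge> 0" unfolding Ci_def by (intro Henstock_Kurzweil_Integration.integral_nonneg norm_integrable
      ci) auto
  define L where "L = E * (b - a) * Ci * Ci"
  have L: "L \<ge> 0" using assms Ci by (simp add: L_def E_def)
  have "\<not> neumann_eig q a b v" if v: "v \<noteq> w" "cmod (v - w) < min 1 (I / (L + 1))" for v
  proof
    assume "neumann_eig q a b v"
    then obtain d d1 where d: "neumann_sol a b d d1 (\<lambda>x. (of_real (q x) - v) * d x)" "d a = 1"
      unfolding neumann_eig_def by blast
    have dc: "continuous_on {a..b} d" using d(1) AC_continuous unfolding neumann_sol_def by blast
    have zero: "integral {a..b} (\<lambda>x. c x * d x) = 0"
      using wronskian[OF less_imp_le[OF assms(1)] c(1) d(1)] v(1) by auto
    \<comment> \<open>d - c solves the equation for v with right-hand side (v - w) c and zero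
      initial data. Its size is therefore of order |v - w|.\<close>
    define g where "g x = (v - w) * c x" for x
    have gi: "g absolutely_integrable_on {a..b}" unfolding g_def by (intro set_integrable_mult_right ci)
    have "neumann_sol a b (\<lambda>x. d x - c x) (\<lambda>x. d1 x - c1 x) (\<lambda>x. V v x * (d x - c x) - (0 - - g x))"
      by (rule neumann_sol_diff[where V = "V v" and g = "\<lambda>_. 0" and h = "\<lambda>x. - g x"])
         (use d c in \<open>simp_all add: V_def g_def algebra_simps\<close>)
    then have sol: "AC a b (\<lambda>x. d x - c x) (\<lambda>x. d1 x - c1 x)" "AC a b (\<lambda>x. d1 x - c1 x)
        (\<lambda>x. V v x * (d x - c x) - g x)" "d1 a - c1 a = 0"
      unfolding neumann_sol_def by simp_all
    have "integral {a..b} (\<lambda>t. cmod (V v t)) \<le> integral {a..b} (\<lambda>t. cmod (V w t) + 1)"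
    proof (rule integral_le)
      show "cmod (V v t) \<le> cmod (V w t) + 1" for t
        using norm_triangle_ineq[of "V w t" "w - v"] v(2) by (simp add: V_def norm_minus_commute)
    qed (intro integrable_add norm_integrable V integrable_on_const; simp)+
    also have "\<dots> = integral {a..b} (\<lambda>t. cmod (V w t)) + (b - a)"
      using assms(1) norm_integrable[OF V[of w]] by (subst Henstock_Kurzweil_Integration.integral_add) auto
    finally have k: "2 * integral {a..b} (\<lambda>t. cmod (V v t)) \<le> \<kappa>" by (simp add: \<kappa>_def)
    have "0 \<le> integral {a..b} (\<lambda>t. cmod (V v t))"
      by (intro Henstock_Kurzweil_Integration.integral_nonneg norm_integrable V) auto
    moreover have "0 \<le> integral {a..b} (\<lambda>t. cmod (V w t))"
      by (intro Henstock_Kurzweil_Integration.integral_nonneg norm_integrable V) auto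
    ultimately have k0: "\<kappa> > 0" using assms(1) by (simp add: \<kappa>_def)
    have db: "cmod (d x - c x) \<le> E * ((b - a) * (cmod (v - w) * Ci))" if "x \<in> {a..b}" for x
      using ode_apriori[OF sol less_imp_le[OF assms(1)] V gi k0 k that] d(2) c(2)
      by (simp add: E_def Ci_def g_def norm_mult)
    have "of_real I = integral {a..b} (\<lambda>x. c x * c x - c x * d x)"
      using zero cc dc I_eq by (subst Henstock_Kurzweil_Integration.integral_diff)
        (auto intro!: integrable_continuous_real continuous_intros)
    then have "I = cmod (integral {a..b} (\<lambda>x. c x * c x - c x * d x))"
      using I by (metis abs_of_pos norm_of_real)
    also have "\<dots> \<le> integral {a..b} (\<lambda>x. E * ((b - a) * (cmod (v - w) * Ci)) * cmod (c x))"
    proof (rule integral_norm_le)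
      show "(\<lambda>x. c x * c x - c x * d x) absolutely_integrable_on {a..b}"
        by (intro absolutely_integrable_continuous_real continuous_intros cc dc)
      show "(\<lambda>x. E * ((b - a) * (cmod (v - w) * Ci)) * cmod (c x)) integrable_on {a..b}"
        by (intro integrable_on_mult_right norm_integrable ci)
      fix x assume x: "x \<in> {a..b}"
      have "cmod (c x * c x - c x * d x) = cmod (d x - c x) * cmod (c x)"
        by (simp add: right_diff_distrib[symmetric] norm_mult norm_minus_commute)
      also have "\<dots> \<le> E * ((b - a) * (cmod (v - w) * Ci)) * cmod (c x)"
        by (intro mult_right_mono db x) auto
      finally show "cmod (c x * c x - c x * d x) \<le> E * ((b - a) * (cmod (v - w) * Ci)) * cmod (c x)" .
    qed
    also have "\<dots> = L * cmod (v - w)" by (simp add: L_def Ci_def)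
    also have "\<dots> \<le> L * (I / (L + 1))" using v(2) L by (intro mult_left_mono) auto
    also have "\<dots> < I" using L I by (simp add: field_simps)
    finally show False by simp
  qed
  moreover have "min 1 (I / (L + 1)) > 0" using L I by simp
  ultimately show thesis using that by blast
qed

subsection \<open>Quadratic forms\<close>

definition form_dom :: "real \<Rightarrow> real \<Rightarrow> (real \<Rightarrow> complex) \<Rightarrow> (real \<Rightarrow> complex) \<Rightarrow> bool" where
  "form_dom a b y y1 \<longleftrightarrow> AC a b y y1 \<and> (\<lambda>x. (cmod (y1 x))\<^sup>2) integrable_on {a..b}"

definition sq_norm :: "real \<Rightarrow> real \<Rightarrow> (real \<Rightarrow> complex) \<Rightarrow> real" where
  "sq_norm a b y = integral {a..b} (\<lambda>x. (cmod (y x))\<^sup>2)"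

definition qform :: "(real \<Rightarrow> real) \<Rightarrow> real \<Rightarrow> real \<Rightarrow> (real \<Rightarrow> complex) \<Rightarrow> (real \<Rightarrow> complex) \<Rightarrow> real" where
  "qform q a b y y1 = integral {a..b} (\<lambda>x. (cmod (y1 x))\<^sup>2 + q x * (cmod (y x))\<^sup>2)"

lemma continuous_square_integrable:
  fixes y :: "real \<Rightarrow> complex"
  shows "continuous_on {a..b} y \<Longrightarrow> (\<lambda>x. (cmod (y x))\<^sup>2) integrable_on {a..b}"
  by (intro integrable_continuous_real continuous_intros)

lemma sq_norm_nonneg: "continuous_on {a..b} y \<Longrightarrow> 0 \<le> sq_norm a b y"
  unfolding sq_norm_def by (intro Henstock_Kurzweil_Integration.integral_nonneg continuous_square_integrable) auto

lemma form_dom_AC: "form_dom a b y y1 \<Longrightarrow> AC a b y y1"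
  by (simp add: form_dom_def)

lemma form_dom_continuous: "form_dom a b y y1 \<Longrightarrow> continuous_on {a..b} y"
  using AC_continuous form_dom_AC by blast

lemma weighted_square_integrable:
  fixes q :: "real \<Rightarrow> real" and y :: "real \<Rightarrow> complex"
  assumes "q absolutely_integrable_on {a..b}" "continuous_on {a..b} y"
  shows "(\<lambda>x. q x * (cmod (y x))\<^sup>2) integrable_on {a..b}"
  by (intro absolutely_integrable_imp_integrable_on absolutely_integrable_mult_continuous assms continuous_intros)

lemma qform_eq:
  assumes "form_dom a b y y1" "q absolutely_integrable_on {a..b}"
  shows "qform q a b y y1 = integral {a..b} (\<lambda>x. (cmod (y1 x))\<^sup>2) + integral {a..b} (\<lambda>x. q x * (cmod (y x))\<^sup>2)"
  unfolding qform_def using assms weighted_square_integrable[OF assms(2) form_dom_continuous[OF assms(1)]]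
  by (intro Henstock_Kurzweil_Integration.integral_add) (auto simp: form_dom_def)

lemma qform_shift:
  assumes "form_dom a b y y1" "q absolutely_integrable_on {a..b}"
  shows "qform (\<lambda>x. q x - l) a b y y1 = qform q a b y y1 - l * sq_norm a b y"
proof -
  have "(\<lambda>x. q x - l) absolutely_integrable_on {a..b}"
    by (intro set_integral_diff(1) assms absolutely_integrable_continuous_real continuous_on_const)
  moreover have "integral {a..b} (\<lambda>x. (q x - l) * (cmod (y x))\<^sup>2) = integral {a..b}
      (\<lambda>x. q x * (cmod (y x))\<^sup>2) - l * sq_norm a b y"
    using weighted_square_integrable[OF assms(2) form_dom_continuous[OF assms(1)]]
      continuous_square_integrable[OF form_dom_continuous[OF assms(1)]]
    by (simp add: left_diff_distrib sq_norm_def Henstock_Kurzweil_Integration.integral_diff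
        integrable_on_mult_right)
  ultimately show ?thesis
    using qform_eq[OF assms(1)] assms(2) by simp
qed

text \<open>As \<open>z1\<close> is continuous, the cross term in |y' - t z'|^2 is an integrable
  function times a continuous one.\<close>

lemma form_dom_diff:
  assumes "form_dom a b y y1" "AC a b z z1" "continuous_on {a..b} z1"
  shows "form_dom a b (\<lambda>x. y x - of_real t * z x) (\<lambda>x. y1 x - of_real t * z1 x)"
proof -
  have ac: "AC a b (\<lambda>x. y x - of_real t * z x) (\<lambda>x. y1 x - of_real t * z1 x)"
    by (rule AC_diff[OF form_dom_AC[OF assms(1)] AC_cmult[OF assms(2)]])
  have eq: "(cmod (y1 x - of_real t * z1 x))\<^sup>2 = (cmod (y1 x))\<^sup>2
      + (t\<^sup>2 * (cmod (z1 x))\<^sup>2 - 2 * t * Re (y1 x * cnj (z1 x)))" for x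
    unfolding cmod_power2 by (simp add: power2_eq_square algebra_simps)
  have "(\<lambda>x. y1 x * cnj (z1 x)) integrable_on {a..b}"
    by (intro absolutely_integrable_imp_integrable_on absolutely_integrable_mult_continuous AC_integrable[OF
        form_dom_AC[OF assms(1)]] continuous_intros assms)
  from integrable_linear[OF this bounded_linear_Re] have "(\<lambda>x. Re (y1 x * cnj (z1 x))) integrable_on {a..b}"
    by (simp add: o_def)
  then have "(\<lambda>x. (cmod (y1 x - of_real t * z1 x))\<^sup>2) integrable_on {a..b}"
    unfolding eq using assms(1) continuous_square_integrable[OF assms(3)]
    by (intro integrable_add integrable_diff integrable_on_mult_right) (auto simp: form_dom_def)
  then show ?thesis using ac by (simp add: form_dom_def)
qed

text \<open>Integration by parts of f times the conjugate of z'. The boundary terms vanish by the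
  Neumann conditions on z alone, so that f is free at the endpoints.\<close>

lemma green_identity:
  assumes f: "AC a b f f1" and z: "neumann_sol a b z z1 (\<lambda>x. of_real (V x) * z x - y x)"
    and V: "V absolutely_integrable_on {a..b}" and y: "y absolutely_integrable_on {a..b}" and "a \<le> b"
  shows "(\<lambda>x. f1 x * cnj (z1 x) + of_real (V x) * (f x * cnj (z x))) integrable_on {a..b}"
    and "integral {a..b} (\<lambda>x. f1 x * cnj (z1 x) + of_real (V x) * (f x * cnj (z x))) = integral {a..b}
        (\<lambda>x. f x * cnj (y x))"
proof -
  have z': "AC a b z z1" "AC a b z1 (\<lambda>x. of_real (V x) * z x - y x)" "z1 a = 0" "z1 b = 0"
    using z unfolding neumann_sol_def by blast+
  have Vc: "(\<lambda>x. complex_of_real (V x)) absolutely_integrable_on {a..b}"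
    using absolutely_integrable_linear[OF V bounded_linear_of_real[where 'a = complex]] by (simp add: o_def)
  have yc: "(\<lambda>x. cnj (y x)) absolutely_integrable_on {a..b}"
    using absolutely_integrable_linear[OF y bounded_linear_cnj] by (simp add: o_def)
  have i1: "(\<lambda>x. f1 x * cnj (z1 x)) integrable_on {a..b}"
    by (intro absolutely_integrable_imp_integrable_on absolutely_integrable_mult_continuous AC_integrable[OF
        f] continuous_intros AC_continuous[OF z'(2)])
  have i2: "(\<lambda>x. of_real (V x) * (f x * cnj (z x))) integrable_on {a..b}"
    by (intro absolutely_integrable_imp_integrable_on absolutely_integrable_mult_continuous Vc
        continuous_intros AC_continuous[OF f] AC_continuous[OF z'(1)])
  have i3: "(\<lambda>x. cnj (y x) * f x) integrable_on {a..b}"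
    by (intro absolutely_integrable_imp_integrable_on absolutely_integrable_mult_continuous yc AC_continuous[OF f])
  then have i3': "(\<lambda>x. f x * cnj (y x)) integrable_on {a..b}" by (simp add: mult.commute)
  show "(\<lambda>x. f1 x * cnj (z1 x) + of_real (V x) * (f x * cnj (z x))) integrable_on {a..b}"
    by (rule integrable_add[OF i1 i2])
  have "integral {a..b} (\<lambda>x. f1 x * cnj (z1 x) + f x * cnj (of_real (V x) * z x - y x)) = 0"
    using AC_eq[OF AC_mult[OF f AC_cnj[OF z'(2)]] \<open>a \<le> b\<close> order_refl] z'(3,4) by simp
  moreover have "integral {a..b} (\<lambda>x. f1 x * cnj (z1 x) + of_real (V x) * (f x * cnj (z x)))
      - integral {a..b} (\<lambda>x. f x * cnj (y x))
      = integral {a..b} (\<lambda>x. (f1 x * cnj (z1 x) + of_real (V x) * (f x * cnj (z x))) - f x * cnj (y x))"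
    by (rule Henstock_Kurzweil_Integration.integral_diff[OF integrable_add[OF i1 i2] i3', symmetric])
  moreover have "(\<lambda>x. (f1 x * cnj (z1 x) + of_real (V x) * (f x * cnj (z x))) - f x * cnj (y x))
     = (\<lambda>x. f1 x * cnj (z1 x) + f x * cnj (of_real (V x) * z x - y x))"
    by (simp add: algebra_simps)
  ultimately show "integral {a..b} (\<lambda>x. f1 x * cnj (z1 x) + of_real (V x) * (f x * cnj (z x)))
      = integral {a..b} (\<lambda>x. f x * cnj (y x))"
    by simp
qed

lemma integral_Re:
  assumes "f integrable_on S"
  shows "integral S (\<lambda>x. Re (f x)) = Re (integral S f)" "(\<lambda>x. Re (f x)) integrable_on S"
  using integral_linear[OF assms bounded_linear_Re] integrable_linear[OF assms bounded_linear_Re] by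
      (simp_all add: o_def)

text \<open>The form at y - t z is expanded in t. The Green identity turns the cross term into
  \<parallel>y\<parallel>^2 (with f = y) and the quadratic term into \<langle>z, y\<rangle> (with f
  = z).\<close>

lemma qform_diff_resolvent:
  assumes y: "form_dom a b y y1" and z: "neumann_sol a b z z1 (\<lambda>x. of_real (V x) * z x - y x)"
    and V: "V absolutely_integrable_on {a..b}" and "a \<le> b"
  shows "qform V a b (\<lambda>x. y x - of_real t * z x) (\<lambda>x. y1 x - of_real t * z1 x) =
    qform V a b y y1 - 2 * t * sq_norm a b y + t\<^sup>2 * Re (integral {a..b} (\<lambda>x. z x * cnj (y x)))"
proof -
  have cy: "continuous_on {a..b} y" by (rule form_dom_continuous[OF y])
  have yi: "y absolutely_integrable_on {a..b}" by (rule absolutely_integrable_continuous_real[OF cy])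
  have zAC: "AC a b z z1" using z unfolding neumann_sol_def by blast
  note G1 = green_identity[OF form_dom_AC[OF y] z V yi \<open>a \<le> b\<close>] and G2 = green_identity[OF zAC z V yi \<open>a \<le> b\<close>]
  let ?A = "\<lambda>x. (cmod (y1 x))\<^sup>2 + V x * (cmod (y x))\<^sup>2"
  let ?B = "\<lambda>x. y1 x * cnj (z1 x) + of_real (V x) * (y x * cnj (z x))"
  let ?C = "\<lambda>x. z1 x * cnj (z1 x) + of_real (V x) * (z x * cnj (z x))"
  have A: "?A integrable_on {a..b}"
    using y weighted_square_integrable[OF V cy] by (intro integrable_add) (auto simp: form_dom_def)
  have "(cmod (y1 x - of_real t * z1 x))\<^sup>2 + V x * (cmod (y x - of_real t * z x))\<^sup>2
      = ?A x - 2 * t * Re (?B x) + t\<^sup>2 * Re (?C x)" for x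
    unfolding cmod_power2 by (simp add: power2_eq_square algebra_simps)
  then have "qform V a b (\<lambda>x. y x - of_real t * z x) (\<lambda>x. y1 x - of_real t * z1 x)
     = integral {a..b} (\<lambda>x. ?A x - 2 * t * Re (?B x) + t\<^sup>2 * Re (?C x))"
    unfolding qform_def by (rule integral_cong)
  also have "\<dots> = integral {a..b} ?A - 2 * t * Re (integral {a..b} ?B) + t\<^sup>2 * Re (integral {a..b} ?C)"
  proof -
    have "integral {a..b} (\<lambda>x. ?A x - 2 * t * Re (?B x) + t\<^sup>2 * Re (?C x))
      = integral {a..b} (\<lambda>x. ?A x - 2 * t * Re (?B x)) + integral {a..b} (\<lambda>x. t\<^sup>2 * Re (?C x))"
      by (intro Henstock_Kurzweil_Integration.integral_add integrable_diff A integrable_on_mult_right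
          integral_Re(2) G1(1) G2(1))
    also have "integral {a..b} (\<lambda>x. ?A x - 2 * t * Re (?B x)) = integral {a..b} ?A - integral {a..b}
        (\<lambda>x. 2 * t * Re (?B x))"
      by (intro Henstock_Kurzweil_Integration.integral_diff A integrable_on_mult_right integral_Re(2) G1(1))
    finally show ?thesis
      by (simp only: integral_mult_right integral_Re(1)[OF G1(1)] integral_Re(1)[OF G2(1)])
  qed
  also have "\<dots> = qform V a b y y1 - 2 * t * sq_norm a b y + t\<^sup>2 * Re (integral {a..b} (\<lambda>x. z x * cnj (y x)))"
    unfolding G1(2) G2(2) integral_mult_cnj[OF cy] by (simp add: qform_def sq_norm_def)
  finally show ?thesis .
qed

section \<open>Pointwise bounds on the form domain and the negative part of q\<close>

text \<open>The integral of (f - m)^2 is nonnegative for the mean m of f.\<close>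

lemma Cauchy_Schwarz_const:
  fixes f :: "real \<Rightarrow> real"
  assumes "c \<le> d" "f integrable_on {c..d}" "(\<lambda>x. (f x)\<^sup>2) integrable_on {c..d}"
  shows "(integral {c..d} f)\<^sup>2 \<le> (d - c) * integral {c..d} (\<lambda>x. (f x)\<^sup>2)"
proof (cases "c = d")
  case False
  define J where "J = integral {c..d} f"
  define m where "m = J / (d - c)"
  have dc: "d - c > 0" using False assms(1) by simp
  have "0 \<le> integral {c..d} (\<lambda>x. ((f x)\<^sup>2 - 2 * m * f x) + m\<^sup>2)"
  proof (rule Henstock_Kurzweil_Integration.integral_nonneg)
    show "(\<lambda>x. ((f x)\<^sup>2 - 2 * m * f x) + m\<^sup>2) integrable_on {c..d}"
      by (intro integrable_add integrable_diff assms integrable_on_mult_right integrable_const_ivl)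
    show "0 \<le> ((f x)\<^sup>2 - 2 * m * f x) + m\<^sup>2" for x
      using zero_le_power2[of "f x - m"] by (simp add: power2_diff algebra_simps)
  qed
  also have "\<dots> = integral {c..d} (\<lambda>x. (f x)\<^sup>2 - 2 * m * f x) + integral {c..d} (\<lambda>x. m\<^sup>2)"
    by (intro Henstock_Kurzweil_Integration.integral_add integrable_diff assms integrable_on_mult_right
        integrable_const_ivl)
  also have "\<dots> = (integral {c..d} (\<lambda>x. (f x)\<^sup>2) - 2 * m * J) + m\<^sup>2 * (d - c)"
    using assms by (simp add: Henstock_Kurzweil_Integration.integral_diff integrable_on_mult_right J_def)
  finally have "0 \<le> (d - c) * ((integral {c..d} (\<lambda>x. (f x)\<^sup>2) - 2 * m * J) + m\<^sup>2 * (d - c))"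
    using dc by simp
  also have "\<dots> = (d - c) * integral {c..d} (\<lambda>x. (f x)\<^sup>2) - 2 * (m * (d - c)) * J + (m * (d - c))\<^sup>2"
    by (simp add: power2_eq_square algebra_simps)
  also have "m * (d - c) = J" using dc by (simp add: m_def)
  finally show ?thesis by (simp add: J_def power2_eq_square)
qed simp

text \<open>For the solution \<open>z\<close> of \<open>- z'' + (q - l) z = y\<close> and the shifted form \<open>s = t - l \<ge> 0\<close> one has
  \<open>0 \<le> s[y - \<tau> z] = s[y] - 2 \<tau> \<parallel>y\<parallel>\<^sup>2 + \<tau>\<^sup>2 \<langle>z, y\<rangle>\<close>, and the last term is at most
  \<open>\<tau>\<^sup>2\<close> times a multiple of \<open>\<parallel>y\<parallel>\<^sup>2\<close>.\<close>

lemma form_dom_gap: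
  assumes "a < b" and q: "q absolutely_integrable_on {a..b}"
    and lower: "\<And>y y1. form_dom a b y y1 \<Longrightarrow> l * sq_norm a b y \<le> qform q a b y y1"
    and ne: "\<not> neumann_eig q a b (of_real l)"
  obtains \<delta> where "\<delta> > 0" "\<And>y y1. form_dom a b y y1 \<Longrightarrow> (l + \<delta>) * sq_norm a b y \<le> qform q a b y y1"
proof -
  obtain K where K: "K \<ge> 0" "\<And>g. g absolutely_integrable_on {a..b} \<Longrightarrow>
    \<exists>y y1. neumann_sol a b y y1 (\<lambda>x. (of_real (q x) - of_real l) * y x - g x) \<and>
      (\<forall>x\<in>{a..b}. cmod (y x) \<le> K * integral {a..b} (\<lambda>t. cmod (g t)))"
    using neumann_resolvent[OF assms(1) q ne] by blast
  define V where "V x = q x - l" for x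
  have V: "V absolutely_integrable_on {a..b}"
    unfolding V_def by (intro set_integral_diff(1) q absolutely_integrable_continuous_real continuous_on_const)
  \<comment> \<open>\<open>t\<close> is at once the step and the size of the gap: K (b - a) t \<le>
    1 gives -2 t + t^2 K (b - a) \<le> -t. The summand 1 covers K = 0.\<close>
  define t where "t = 1 / (K * (b - a) + 1)"
  have Kba: "K * (b - a) \<ge> 0" using K(1) assms(1) by simp
  have t: "t > 0" using Kba by (simp add: t_def)
  have tK: "t * (K * (b - a)) \<le> 1" using Kba by (simp add: t_def field_simps)
  have "(l + t) * sq_norm a b y \<le> qform q a b y y1" if y: "form_dom a b y y1" for y y1
  proof -
    have cy: "continuous_on {a..b} y" by (rule form_dom_continuous[OF y])
    have yi: "y absolutely_integrable_on {a..b}" by (rule absolutely_integrable_continuous_real[OF cy])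
    obtain z z1 where z: "neumann_sol a b z z1 (\<lambda>x. (of_real (q x) - of_real l) * z x - y x)"
      and zb: "\<And>x. x \<in> {a..b} \<Longrightarrow> cmod (z x) \<le> K * integral {a..b} (\<lambda>t. cmod (y t))"
      using K(2)[OF yi] by blast
    have z': "neumann_sol a b z z1 (\<lambda>x. of_real (V x) * z x - y x)"
      using z by (simp add: V_def)
    have zAC: "AC a b z z1" and cz1: "continuous_on {a..b} z1" and cz: "continuous_on {a..b} z"
      using z AC_continuous unfolding neumann_sol_def by blast+
    define J where "J = integral {a..b} (\<lambda>t. cmod (y t))"
    have J: "J\<^sup>2 \<le> (b - a) * sq_norm a b y"
      unfolding J_def sq_norm_def using assms(1)
      by (intro Cauchy_Schwarz_const continuous_square_integrable cy integrable_continuous_real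
          continuous_intros) auto
    have J0: "J \<ge> 0" unfolding J_def by (intro Henstock_Kurzweil_Integration.integral_nonneg norm_integrable
        yi) auto
    have "Re (integral {a..b} (\<lambda>x. z x * cnj (y x))) \<le> cmod (integral {a..b} (\<lambda>x. z x * cnj (y x)))"
      by (rule complex_Re_le_cmod)
    also have "\<dots> \<le> integral {a..b} (\<lambda>x. K * J * cmod (y x))"
    proof (rule integral_norm_le)
      show "(\<lambda>x. z x * cnj (y x)) absolutely_integrable_on {a..b}"
        by (intro absolutely_integrable_continuous_real continuous_intros cz cy)
      show "(\<lambda>x. K * J * cmod (y x)) integrable_on {a..b}"
        by (intro integrable_on_mult_right norm_integrable yi)
      show "cmod (z x * cnj (y x)) \<le> K * J * cmod (y x)" if "x \<in> {a..b}" for x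
        using zb[OF that] by (simp add: norm_mult J_def mult_right_mono)
    qed
    also have "\<dots> = K * J\<^sup>2" by (simp add: J_def power2_eq_square)
    also have "\<dots> \<le> K * ((b - a) * sq_norm a b y)" using J K(1) by (rule mult_left_mono)
    finally have R: "Re (integral {a..b} (\<lambda>x. z x * cnj (y x))) \<le> K * (b - a) * sq_norm a b y" by simp
    have fd: "form_dom a b (\<lambda>x. y x - of_real t * z x) (\<lambda>x. y1 x - of_real t * z1 x)"
      by (rule form_dom_diff[OF y zAC cz1])
    have "0 \<le> qform V a b (\<lambda>x. y x - of_real t * z x) (\<lambda>x. y1 x - of_real t * z1 x)"
      unfolding V_def qform_shift[OF fd q] using lower[OF fd] by simp
    also have "\<dots> = qform V a b y y1 - 2 * t * sq_norm a b y + t\<^sup>2 * Re (integral {a..b} (\<lambda>x. z x * cnj (y x)))"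
      by (rule qform_diff_resolvent[OF y z' V less_imp_le[OF assms(1)]])
    also have "\<dots> \<le> qform V a b y y1 - 2 * t * sq_norm a b y + t\<^sup>2 * (K * (b - a) * sq_norm a b y)"
      using R by (intro add_left_mono mult_left_mono) auto
    also have "t\<^sup>2 * (K * (b - a) * sq_norm a b y) = t * (t * (K * (b - a))) * sq_norm a b y"
      by (simp add: power2_eq_square)
    also have "qform V a b y y1 - 2 * t * sq_norm a b y + \<dots> \<le> qform V a b y y1 - 2 * t * sq_norm a b y
        + t * 1 * sq_norm a b y"
      using t tK sq_norm_nonneg[OF cy] by (intro add_left_mono mult_right_mono mult_left_mono) auto
    also have "qform V a b y y1 = qform q a b y y1 - l * sq_norm a b y"
      unfolding V_def by (rule qform_shift[OF y q])
    finally show ?thesis by (simp add: algebra_simps)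
  qed
  then show thesis using t that by blast
qed

text \<open>|y(x)| \<le> |y(t)| + \<integral> |y'|, squared by means of (u + v)^2 \<le> 2 u^2 + 2
  v^2 and the Cauchy-Schwarz inequality.\<close>

lemma form_dom_square_diff:
  assumes y: "form_dom a b y y1" and sub: "a \<le> c" "c \<le> d" "d \<le> b" and x: "x \<in> {c..d}" and t: "t \<in> {c..d}"
  shows "(cmod (y x))\<^sup>2 \<le> 2 * (cmod (y t))\<^sup>2 + 2 * ((d - c) * integral {c..d} (\<lambda>s. (cmod (y1 s))\<^sup>2))"
proof -
  have AC: "AC c d y y1" by (rule AC_subinterval[OF form_dom_AC[OF y]]) (use sub in auto)
  have s2: "(\<lambda>s. (cmod (y1 s))\<^sup>2) integrable_on {c..d}"
    by (rule integrable_on_subinterval[of _ "{a..b}"]) (use y sub in \<open>auto simp: form_dom_def\<close>)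
  define J where "J = integral {c..d} (\<lambda>s. cmod (y1 s))"
  have J: "J\<^sup>2 \<le> (d - c) * integral {c..d} (\<lambda>s. (cmod (y1 s))\<^sup>2)"
    unfolding J_def by (rule Cauchy_Schwarz_const[OF sub(2) norm_integrable[OF AC_integrable[OF AC]] s2])
  have *: "cmod (y v - y u) \<le> J" if "u \<in> {c..d}" "v \<in> {c..d}" "u \<le> v" for u v
  proof -
    have uv: "y1 absolutely_integrable_on {u..v}"
      by (rule absolutely_integrable_on_subinterval[OF AC_integrable[OF AC]]) (use that in auto)
    have "cmod (y v - y u) = cmod (integral {u..v} y1)"
      using AC_diff_eq[OF AC, of u v] that by simp
    also have "\<dots> \<le> integral {u..v} (\<lambda>s. cmod (y1 s))"
      by (rule integral_norm_le[OF uv norm_integrable[OF uv]]) simp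
    also have "\<dots> \<le> J"
      unfolding J_def using that norm_integrable[OF uv] norm_integrable[OF AC_integrable[OF AC]]
      by (intro integral_subset_le) auto
    finally show ?thesis .
  qed
  have "cmod (y x - y t) \<le> J"
    using *[of x t] *[of t x] x t by (cases "x \<le> t") (auto simp: norm_minus_commute)
  then have "cmod (y x) \<le> cmod (y t) + J"
    using norm_triangle_sub[of "y x" "y t"] by simp
  then have "(cmod (y x))\<^sup>2 \<le> (cmod (y t) + J)\<^sup>2"
    by (intro power_mono) auto
  also have "\<dots> \<le> 2 * (cmod (y t))\<^sup>2 + 2 * J\<^sup>2"
    using sum_squares_bound[of "cmod (y t)" J] by (simp add: power2_sum)
  finally show ?thesis using J by simp
qed

text \<open>The previous comparison of |y(x)| with |y(t)|, averaged over t in an interval of length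
  l that contains x. The free length l trades the norm against the gradient.\<close>

lemma form_dom_sup_bound:
  assumes y: "form_dom a b y y1" and l: "0 < l" "l \<le> b - a" and x: "x \<in> {a..b}"
  shows "l * (cmod (y x))\<^sup>2 \<le> 2 * sq_norm a b y + 2 * l\<^sup>2 * integral {a..b} (\<lambda>s. (cmod (y1 s))\<^sup>2)"
proof -
  \<comment> \<open>Left end of an interval of length \<open>l\<close> that contains x and is
    shifted to the left where it would leave [a, b].\<close>
  define c where "c = min x (b - l)"
  have c: "a \<le> c" "c + l \<le> b" "x \<in> {c..c + l}"
    using x l by (auto simp: c_def)
  have cy: "continuous_on {a..b} y" by (rule form_dom_continuous[OF y])
  define S where "S = integral {c..c + l} (\<lambda>s. (cmod (y1 s))\<^sup>2)"
  have y2: "(\<lambda>s. (cmod (y s))\<^sup>2) integrable_on {c..c+l}"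
    by (rule integrable_on_subinterval[OF continuous_square_integrable[OF cy]]) (use c in auto)
  have s2: "(\<lambda>s. (cmod (y1 s))\<^sup>2) integrable_on {c..c+l}"
    by (rule integrable_on_subinterval[of _ "{a..b}"]) (use y c in \<open>auto simp: form_dom_def\<close>)
  have "l * (cmod (y x))\<^sup>2 = integral {c..c + l} (\<lambda>t. (cmod (y x))\<^sup>2)"
    using l by simp
  also have "\<dots> \<le> integral {c..c + l} (\<lambda>t. 2 * (cmod (y t))\<^sup>2 + 2 * (l * S))"
  proof (rule integral_le)
    show "(\<lambda>t. 2 * (cmod (y t))\<^sup>2 + 2 * (l * S)) integrable_on {c..c + l}"
      by (intro integrable_add integrable_on_mult_right y2 integrable_const_ivl)
    show "(cmod (y x))\<^sup>2 \<le> 2 * (cmod (y t))\<^sup>2 + 2 * (l * S)" if "t \<in> {c..c + l}" for t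
      using form_dom_square_diff[OF y c(1) _ c(2) c(3) that] l by (simp add: S_def)
  qed (rule integrable_const_ivl)
  also have "\<dots> = 2 * integral {c..c + l} (\<lambda>t. (cmod (y t))\<^sup>2) + 2 * l\<^sup>2 * S"
    unfolding Henstock_Kurzweil_Integration.integral_add[OF integrable_on_mult_right[OF y2] integrable_const_ivl]
      integral_mult_right using l by (simp add: power2_eq_square)
  also have "\<dots> \<le> 2 * sq_norm a b y + 2 * l\<^sup>2 * integral {a..b} (\<lambda>s. (cmod (y1 s))\<^sup>2)"
    unfolding S_def sq_norm_def using y c s2 y2 continuous_square_integrable[OF cy]
    by (intro add_mono mult_left_mono integral_subset_le) (auto simp: form_dom_def)
  finally show ?thesis .
qed

text \<open>The sup bound for l = min(b - a, \<epsilon>), multiplied by \<integral> q \<le> C (b -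
  a). The norm receives the coefficient 2 C (b - a)/l, bounded because l is either b - a itself or
  equal to \<epsilon> while b - a \<le> D. The gradient receives 2 C (b - a) l \<le> 2 C D
  \<epsilon>. Thus \<open>C'\<close> depends on \<open>C\<close> and \<open>D\<close> only, however
  short the interval is.\<close>

lemma negative_part_form_bound:
  fixes C D :: real
  assumes "C \<ge> 0" "D > 0"
  obtains C' where "C' \<ge> 0" "\<And>a b q y y1. a < b \<Longrightarrow> b - a \<le> D \<Longrightarrow> q absolutely_integrable_on {a..b} \<Longrightarrow>
     (\<And>x. q x \<ge> 0) \<Longrightarrow> integral {a..b} q \<le> C * (b - a) \<Longrightarrow> form_dom a b y y1 \<Longrightarrow>
     integral {a..b} (\<lambda>x. q x * (cmod (y x))\<^sup>2) \<le> 1 / 2 * integral {a..b} (\<lambda>x. (cmod (y1 x))\<^sup>2)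
         + C' * sq_norm a b y"
proof -
  \<comment> \<open>Makes 2 C D \<epsilon> at most 1/2, also for C = 0.\<close>
  define \<epsilon> where "\<epsilon> = 1 / (4 * C * D + 1)"
  have CD: "C * D \<ge> 0" using assms by simp
  have \<epsilon>: "\<epsilon> > 0" "2 * C * D * \<epsilon> \<le> 1 / 2" using CD by (auto simp: \<epsilon>_def field_simps)
  define C' where "C' = 2 * C * (1 + D / \<epsilon>)"
  have "integral {a..b} (\<lambda>x. q x * (cmod (y x))\<^sup>2) \<le> 1 / 2 * integral {a..b} (\<lambda>x. (cmod (y1 x))\<^sup>2)
      + C' * sq_norm a b y"
    if ab: "a < b" "b - a \<le> D" and q: "q absolutely_integrable_on {a..b}" "\<And>x. q x \<ge> 0"
      "integral {a..b} q \<le> C * (b - a)" and y: "form_dom a b y y1" for a b :: real and q :: "real \<Rightarrow> real" and y y1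
  proof -
    define l where "l = min (b - a) \<epsilon>"
    have l: "0 < l" "l \<le> b - a" "l \<le> \<epsilon>" using ab \<epsilon> by (auto simp: l_def)
    define S where "S = integral {a..b} (\<lambda>s. (cmod (y1 s))\<^sup>2)"
    have cy: "continuous_on {a..b} y" by (rule form_dom_continuous[OF y])
    have N: "sq_norm a b y \<ge> 0" by (rule sq_norm_nonneg[OF cy])
    have S: "S \<ge> 0" unfolding S_def
      by (rule Henstock_Kurzweil_Integration.integral_nonneg) (use y in \<open>auto simp: form_dom_def\<close>)
    define B where "B = (2 * sq_norm a b y + 2 * l\<^sup>2 * S) / l"
    have B0: "B \<ge> 0" unfolding B_def using N S l by simp
    have B: "(cmod (y x))\<^sup>2 \<le> B" if "x \<in> {a..b}" for x
      using form_dom_sup_bound[OF y l(1,2) that] l(1) by (simp add: B_def S_def field_simps)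
    have "integral {a..b} (\<lambda>x. q x * (cmod (y x))\<^sup>2) \<le> integral {a..b} (\<lambda>x. q x * B)"
      using B q(2) by (intro integral_le weighted_square_integrable q cy integrable_on_mult_left
          absolutely_integrable_imp_integrable_on mult_left_mono) auto
    also have "\<dots> = integral {a..b} q * B" by simp
    also have "\<dots> \<le> C * (b - a) * B" using q(3) B0 by (rule mult_right_mono)
    also have "\<dots> = 2 * C * ((b - a) / l) * sq_norm a b y + 2 * C * (b - a) * l * S"
      using l(1) by (simp add: B_def field_simps power2_eq_square)
    also have "\<dots> \<le> C' * sq_norm a b y + 1 / 2 * S"
    proof (intro add_mono mult_right_mono N S)
      have "(b - a) / l \<le> 1 + D / \<epsilon>"
      proof (cases "b - a \<le> \<epsilon>")
        case True
        then show ?thesis using ab \<epsilon> assms by (simp add: l_def)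
      next
        case False
        then have "(b - a) / l \<le> D / \<epsilon>" using ab \<epsilon> by (simp add: l_def divide_right_mono)
        then show ?thesis by simp
      qed
      then show "2 * C * ((b - a) / l) \<le> C'" unfolding C'_def using assms by (intro mult_left_mono) auto
      have "2 * C * (b - a) * l \<le> 2 * C * D * \<epsilon>" using assms ab l by (intro mult_mono) auto
      then show "2 * C * (b - a) * l \<le> 1 / 2" using \<epsilon>(2) by linarith
    qed
    finally show ?thesis by (simp add: S_def)
  qed
  moreover have "C' \<ge> 0" using assms \<epsilon> by (simp add: C'_def)
  ultimately show thesis using that[of C'] by blast
qed

lemma negative_part_integrable:
  fixes q :: "real \<Rightarrow> real"
  assumes "q absolutely_integrable_on S"
  shows "(\<lambda>x. (\<bar>q x\<bar> - q x) / 2) absolutely_integrable_on S" "(\<lambda>x. (\<bar>q x\<bar> + q x) / 2) absolutely_integrable_on S"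
proof -
  have "(\<lambda>x. \<bar>q x\<bar>) absolutely_integrable_on S"
    using absolutely_integrable_norm[OF assms] by (simp add: o_def)
  then show "(\<lambda>x. (\<bar>q x\<bar> - q x) / 2) absolutely_integrable_on S" "(\<lambda>x. (\<bar>q x\<bar>
      + q x) / 2) absolutely_integrable_on S"
    using assms by (auto intro!: set_integrable_divide)
qed

text \<open>Half of the gradient pays for q_-. The other half and the whole of q_+ are kept, since
  together they must later dominate a large multiple of the norm.\<close>

lemma qform_lower_bound:
  fixes C D :: real
  assumes "C \<ge> 0" "D > 0"
  obtains C' where "C' \<ge> 0" "\<And>a b q y y1. a < b \<Longrightarrow> b - a \<le> D \<Longrightarrow> q absolutely_integrable_on {a..b} \<Longrightarrow>
     integral {a..b} (\<lambda>x. (\<bar>q x\<bar> - q x) / 2) \<le> C * (b - a) \<Longrightarrow> form_dom a b y y1 \<Longrightarrow>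
     1 / 2 * integral {a..b} (\<lambda>x. (cmod (y1 x))\<^sup>2) + integral {a..b} (\<lambda>x. (\<bar>q x\<bar>
         + q x) / 2 * (cmod (y x))\<^sup>2) - C' * sq_norm a b y
       \<le> qform q a b y y1"
proof (rule negative_part_form_bound[OF assms])
  fix C' :: real
  assume C': "C' \<ge> 0" and bound: "\<And>a b q y y1. a < b \<Longrightarrow> b - a \<le> D \<Longrightarrow> q absolutely_integrable_on {a..b} \<Longrightarrow>
     (\<And>x. q x \<ge> 0) \<Longrightarrow> integral {a..b} q \<le> C * (b - a) \<Longrightarrow> form_dom a b y y1 \<Longrightarrow>
     integral {a..b} (\<lambda>x. q x * (cmod (y x))\<^sup>2) \<le> 1 / 2 * integral {a..b} (\<lambda>x. (cmod (y1 x))\<^sup>2)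
         + C' * sq_norm a b y"
  show thesis
  proof (rule that[OF C'])
    fix a b :: real and q :: "real \<Rightarrow> real" and y y1
    assume ab: "a < b" "b - a \<le> D" and q: "q absolutely_integrable_on {a..b}"
      "integral {a..b} (\<lambda>x. (\<bar>q x\<bar> - q x) / 2) \<le> C * (b - a)" and y: "form_dom a b y y1"
    note qm = negative_part_integrable(1)[OF q(1)] and qp = negative_part_integrable(2)[OF q(1)]
    note cy = form_dom_continuous[OF y]
    have "integral {a..b} (\<lambda>x. (\<bar>q x\<bar> - q x) / 2 * (cmod (y x))\<^sup>2) \<le> 1 / 2 * integral {a..b}
        (\<lambda>x. (cmod (y1 x))\<^sup>2) + C' * sq_norm a b y"
      by (rule bound[OF ab qm _ q(2) y]) simp
    moreover have "integral {a..b} (\<lambda>x. (\<bar>q x\<bar> + q x) / 2 * (cmod (y x))\<^sup>2) - integral {a..b}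
        (\<lambda>x. (\<bar>q x\<bar> - q x) / 2 * (cmod (y x))\<^sup>2)
      = integral {a..b} (\<lambda>x. (\<bar>q x\<bar> + q x) / 2 * (cmod (y x))\<^sup>2 - (\<bar>q x\<bar> - q x) / 2 * (cmod (y x))\<^sup>2)"
      by (intro Henstock_Kurzweil_Integration.integral_diff[symmetric] weighted_square_integrable qm qp cy)
    moreover have "\<dots> = integral {a..b} (\<lambda>x. q x * (cmod (y x))\<^sup>2)"
      by (rule integral_cong) (simp add: field_simps)
    ultimately show "1 / 2 * integral {a..b} (\<lambda>x. (cmod (y1 x))\<^sup>2) + integral {a..b} (\<lambda>x. (\<bar>q x\<bar>
        + q x) / 2 * (cmod (y x))\<^sup>2) - C' * sq_norm a b y
       \<le> qform q a b y y1"
      unfolding qform_eq[OF y q(1)] by linarith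
  qed
qed

text \<open>If the supremum of all lower bounds of the form were not an eigenvalue, the gap lemma
  would produce a larger lower bound. No minimizing sequence is involved.\<close>

lemma lowest_eigenvalue:
  assumes "a < b" and q: "q absolutely_integrable_on {a..b}"
  obtains l where "neumann_eig q a b (of_real l)" "\<And>y y1. form_dom a b y y1 \<Longrightarrow> l * sq_norm a b y \<le> qform q a b y y1"
proof -
  define \<Lambda> where "\<Lambda> = {l. \<forall>y y1. form_dom a b y y1 \<longrightarrow> l * sq_norm a b y \<le> qform q a b y y1}"
  \<comment> \<open>On one fixed interval the mean of q_- is itself an admissible constant.\<close>
  define C where "C = integral {a..b} (\<lambda>x. (\<bar>q x\<bar> - q x) / 2) / (b - a)"
  have C: "C \<ge> 0" unfolding C_def using assms(1)
    by (intro divide_nonneg_nonneg Henstock_Kurzweil_Integration.integral_nonneg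
        absolutely_integrable_imp_integrable_on negative_part_integrable(1) q) auto
  have D: "b - a > 0" using assms(1) by simp
  have CI: "integral {a..b} (\<lambda>x. (\<bar>q x\<bar> - q x) / 2) \<le> C * (b - a)"
    unfolding C_def times_divide_eq_left using D by (subst nonzero_mult_div_cancel_right) auto
  obtain C' where C': "C' \<ge> 0" and bound: "\<And>y y1. form_dom a b y y1 \<Longrightarrow>
     1 / 2 * integral {a..b} (\<lambda>x. (cmod (y1 x))\<^sup>2) + integral {a..b} (\<lambda>x. (\<bar>q x\<bar>
         + q x) / 2 * (cmod (y x))\<^sup>2) - C' * sq_norm a b y
       \<le> qform q a b y y1"
  proof (rule qform_lower_bound[OF C D])
    fix C' :: real
    assume *: "0 \<le> C'" and **: "\<And>a' b' q y y1. a' < b' \<Longrightarrow> b' - a' \<le> b - a \<Longrightarrow> q absolutely_integrable_on {a'..b'} \<Longrightarrow>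
     integral {a'..b'} (\<lambda>x. (\<bar>q x\<bar> - q x) / 2) \<le> C * (b' - a') \<Longrightarrow> form_dom a' b' y y1 \<Longrightarrow>
     1 / 2 * integral {a'..b'} (\<lambda>x. (cmod (y1 x))\<^sup>2) + integral {a'..b'} (\<lambda>x. (\<bar>q x\<bar>
         + q x) / 2 * (cmod (y x))\<^sup>2) - C' * sq_norm a' b' y
       \<le> qform q a' b' y y1"
    show thesis
      by (rule that[OF *]) (rule **[OF assms(1) order_refl q CI])
  qed
  have "- C' \<in> \<Lambda>"
    unfolding \<Lambda>_def
  proof safe
    fix y y1 assume y: "form_dom a b y y1"
    have "0 \<le> integral {a..b} (\<lambda>x. (cmod (y1 x))\<^sup>2)"
      by (rule Henstock_Kurzweil_Integration.integral_nonneg) (use y in \<open>auto simp: form_dom_def\<close>)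
    moreover have "0 \<le> integral {a..b} (\<lambda>x. (\<bar>q x\<bar> + q x) / 2 * (cmod (y x))\<^sup>2)"
      by (intro Henstock_Kurzweil_Integration.integral_nonneg weighted_square_integrable
          negative_part_integrable q form_dom_continuous[OF y]) auto
    ultimately show "- C' * sq_norm a b y \<le> qform q a b y y1"
      using bound[OF y] by linarith
  qed
  have one: "form_dom a b (\<lambda>_. 1) (\<lambda>_. 0)"
    by (simp add: form_dom_def AC_const integrable_0)
  \<comment> \<open>The constant function 1 bounds every lower bound of the form by the mean of
    q.\<close>
  have bdd: "bdd_above \<Lambda>"
  proof (rule bdd_aboveI)
    fix l assume "l \<in> \<Lambda>"
    then have "l * sq_norm a b (\<lambda>_. 1) \<le> qform q a b (\<lambda>_. 1) (\<lambda>_. 0)" using one unfolding \<Lambda>_def by blast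
    then show "l \<le> integral {a..b} q / (b - a)"
      using assms(1) by (simp add: sq_norm_def qform_def field_simps)
  qed
  define l where "l = Sup \<Lambda>"
  have low: "l * sq_norm a b y \<le> qform q a b y y1" if y: "form_dom a b y y1" for y y1
  proof (cases "sq_norm a b y = 0")
    case True
    then show ?thesis using \<open>- C' \<in> \<Lambda>\<close> y unfolding \<Lambda>_def by fastforce
  next
    case False
    then have N: "sq_norm a b y > 0" using sq_norm_nonneg[OF form_dom_continuous[OF y]] by simp
    have "l \<le> qform q a b y y1 / sq_norm a b y"
      unfolding l_def
    proof (rule cSup_least)
      show "m \<le> qform q a b y y1 / sq_norm a b y" if "m \<in> \<Lambda>" for m
        using that y N unfolding \<Lambda>_def by (simp add: field_simps)
    qed (use \<open>- C' \<in> \<Lambda>\<close> in auto)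
    then show ?thesis using N by (simp add: field_simps)
  qed
  have "neumann_eig q a b (of_real l)"
  proof (rule ccontr)
    assume "\<not> neumann_eig q a b (of_real l)"
    then obtain \<delta> where "\<delta> > 0" "\<And>y y1. form_dom a b y y1 \<Longrightarrow> (l + \<delta>) * sq_norm a b y \<le> qform q a b y y1"
      using form_dom_gap[OF assms low] by blast
    then have "l + \<delta> \<in> \<Lambda>" unfolding \<Lambda>_def by blast
    then have "l + \<delta> \<le> l" unfolding l_def using bdd by (rule cSup_upper)
    then show False using \<open>\<delta> > 0\<close> by simp
  qed
  then show thesis using low that by blast
qed

text \<open>Integration by parts of y' times the conjugate of y: on the operator domain the real
  part of \<langle>H y, y\<rangle> is the form.\<close>

lemma neumann_sol_form:
  assumes y: "neumann_sol a b y y1 y2" and q: "q absolutely_integrable_on {a..b}" and "a \<le> b"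
  shows "form_dom a b y y1"
    and "(\<lambda>x. Re ((- y2 x + of_real (q x) * y x) * cnj (y x))) integrable_on {a..b}"
    and "integral {a..b} (\<lambda>x. Re ((- y2 x + of_real (q x) * y x) * cnj (y x))) = qform q a b y y1"
proof -
  have y': "AC a b y y1" "AC a b y1 y2" "y1 a = 0" "y1 b = 0"
    using y unfolding neumann_sol_def by blast+
  show fd: "form_dom a b y y1"
    using y'(1) continuous_square_integrable[OF AC_continuous[OF y'(2)]] by (simp add: form_dom_def)
  have i1: "(\<lambda>x. y2 x * cnj (y x)) integrable_on {a..b}"
    by (intro absolutely_integrable_imp_integrable_on absolutely_integrable_mult_continuous AC_integrable[OF
        y'(2)] continuous_intros AC_continuous[OF y'(1)])
  have i2: "(\<lambda>x. y1 x * cnj (y1 x)) integrable_on {a..b}"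
    by (intro integrable_continuous_real continuous_intros AC_continuous[OF y'(2)])
  have qi: "(\<lambda>x. q x * (cmod (y x))\<^sup>2) integrable_on {a..b}"
    by (rule weighted_square_integrable[OF q AC_continuous[OF y'(1)]])
  have eq: "Re ((- y2 x + of_real (q x) * y x) * cnj (y x)) = q x * (cmod (y x))\<^sup>2 - Re (y2 x * cnj (y x))" for x
    unfolding cmod_power2 by (simp add: power2_eq_square algebra_simps)
  show "(\<lambda>x. Re ((- y2 x + of_real (q x) * y x) * cnj (y x))) integrable_on {a..b}"
    unfolding eq by (intro integrable_diff qi integral_Re(2) i1)
  have "integral {a..b} (\<lambda>x. y2 x * cnj (y x) + y1 x * cnj (y1 x)) = 0"
    using AC_eq[OF AC_mult[OF y'(2) AC_cnj[OF y'(1)]] \<open>a \<le> b\<close> order_refl] y'(3,4) by simp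
  then have "integral {a..b} (\<lambda>x. y2 x * cnj (y x)) = - of_real (integral {a..b} (\<lambda>x. (cmod (y1 x))\<^sup>2))"
    using Henstock_Kurzweil_Integration.integral_add[OF i1 i2] integral_mult_cnj[OF AC_continuous[OF y'(2)]]
    by (simp add: eq_neg_iff_add_eq_0)
  then have "integral {a..b} (\<lambda>x. Re (y2 x * cnj (y x))) = - integral {a..b} (\<lambda>x. (cmod (y1 x))\<^sup>2)"
    by (simp only: integral_Re(1)[OF i1]) simp
  then show "integral {a..b} (\<lambda>x. Re ((- y2 x + of_real (q x) * y x) * cnj (y x))) = qform q a b y y1"
    unfolding eq qform_eq[OF fd q] using Henstock_Kurzweil_Integration.integral_diff[OF qi integral_Re(2)[OF
        i1]] by simp
qed

subsection \<open>Operators in \<open>L\<^sup>2\<close> and their orthogonal sum\<close>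

text \<open>Completeness of Lebesgue measure, applied to the extensions by zero.\<close>

lemma measurable_AE_cong:
  fixes f g :: "real \<Rightarrow> complex"
  assumes S: "S \<in> sets lebesgue" and g: "g \<in> borel_measurable (lebesgue_on S)" and ae:
      "AE x in lebesgue_on S. f x = g x"
  shows "f \<in> borel_measurable (lebesgue_on S)"
proof -
  have "(\<lambda>x. if x \<in> S then g x else 0) \<in> borel_measurable lebesgue"
    using g S by (simp add: borel_measurable_if)
  moreover have "AE x in lebesgue. (if x \<in> S then g x else 0) = (if x \<in> S then f x else 0)"
    using ae S by (auto simp: AE_restrict_space_iff elim: eventually_mono)
  ultimately have "(\<lambda>x. if x \<in> S then f x else 0) \<in> borel_measurable lebesgue"
    by (rule borel_measurable_AE)
  then show ?thesis using S by (simp add: borel_measurable_if)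
qed

lemma L2_norm_sq: "(L2_norm M f)\<^sup>2 = (LINT x|M. (cmod (f x))\<^sup>2)"
  unfolding L2_norm_def by (rule real_sqrt_pow2) (rule Bochner_Integration.integral_nonneg, simp)

lemma L2_norm_nonneg: "0 \<le> L2_norm M f"
  unfolding L2_norm_def by (rule real_sqrt_ge_zero) (rule Bochner_Integration.integral_nonneg, simp)

lemma L2_AE_cong:
  fixes f g :: "real \<Rightarrow> complex"
  assumes S: "S \<in> sets lebesgue" and g: "g \<in> L2 (lebesgue_on S)" and ae: "AE x in lebesgue_on S. f x = g x"
  shows "f \<in> L2 (lebesgue_on S)" "L2_norm (lebesgue_on S) f = L2_norm (lebesgue_on S) g"
proof -
  have gm: "g \<in> borel_measurable (lebesgue_on S)" using g by (simp add: L2_def)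
  have fm: "f \<in> borel_measurable (lebesgue_on S)" by (rule measurable_AE_cong[OF S gm ae])
  have m: "(\<lambda>x. (cmod (f x))\<^sup>2) \<in> borel_measurable (lebesgue_on S)"
      "(\<lambda>x. (cmod (g x))\<^sup>2) \<in> borel_measurable (lebesgue_on S)"
    using fm gm by measurable
  have ae': "AE x in lebesgue_on S. (cmod (f x))\<^sup>2 = (cmod (g x))\<^sup>2"
    using ae by eventually_elim simp
  show "f \<in> L2 (lebesgue_on S)"
    using g fm integrable_cong_AE[OF m ae'] by (simp add: L2_def)
  show "L2_norm (lebesgue_on S) f = L2_norm (lebesgue_on S) g"
    using integral_cong_AE[OF m ae'] by (simp add: L2_norm_def)
qed

lemma L2_iff_Ioo:
  "f \<in> L2 (lebesgue_on {a<..<b::real}) \<longleftrightarrow>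
     f \<in> borel_measurable (lebesgue_on {a<..<b}) \<and> (\<lambda>x. (cmod (f x))\<^sup>2) integrable_on {a..b}"
  unfolding L2_def by (auto simp: integrable_lebesgue_on_Ioo intro!:
      absolutely_integrable_on_iff_nonneg[THEN iffD2] dest: absolutely_integrable_imp_integrable_on)

lemma L2_norm_sq_Ioo:
  assumes "f \<in> L2 (lebesgue_on {a<..<b::real})"
  shows "(L2_norm (lebesgue_on {a<..<b}) f)\<^sup>2 = sq_norm a b f"
  using assms unfolding L2_norm_sq sq_norm_def
  by (intro integral_lebesgue_on_Ioo) (simp add: L2_def integrable_lebesgue_on_Ioo)

lemma L2_linear:
  assumes f: "f \<in> L2 M" and g: "g \<in> L2 M"
  shows "(\<lambda>x. f x + c * g x) \<in> L2 M"
proof -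
  have m: "f \<in> borel_measurable M" "g \<in> borel_measurable M" using f g by (auto simp: L2_def)
  have "integrable M (\<lambda>x. 2 * (cmod (f x))\<^sup>2 + 2 * (cmod c)\<^sup>2 * (cmod (g x))\<^sup>2)"
    using f g by (auto simp: L2_def intro!: integrable_add)
  then have "integrable M (\<lambda>x. (cmod (f x + c * g x))\<^sup>2)"
  proof (rule Bochner_Integration.integrable_bound)
    show "(\<lambda>x. (cmod (f x + c * g x))\<^sup>2) \<in> borel_measurable M" using m by measurable
    have "(cmod (f x + c * g x))\<^sup>2 \<le> 2 * (cmod (f x))\<^sup>2 + 2 * (cmod c)\<^sup>2 * (cmod (g x))\<^sup>2" for x
    proof -
      have "(cmod (f x + c * g x))\<^sup>2 \<le> (cmod (f x) + cmod c * cmod (g x))\<^sup>2"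
        by (intro power_mono) (metis norm_mult norm_triangle_ineq, simp)
      also have "\<dots> \<le> 2 * (cmod (f x))\<^sup>2 + 2 * (cmod c * cmod (g x))\<^sup>2"
        using sum_squares_bound[of "cmod (f x)" "cmod c * cmod (g x)"] by (simp add: power2_sum)
      finally show ?thesis by (simp add: power_mult_distrib)
    qed
    then show "AE x in M. norm ((cmod (f x + c * g x))\<^sup>2) \<le> norm (2 * (cmod (f x))\<^sup>2
        + 2 * (cmod c)\<^sup>2 * (cmod (g x))\<^sup>2)"
      by (intro always_eventually allI) simp
  qed
  then show ?thesis using m by (simp add: L2_def)
qed

lemma continuous_L2:
  assumes "continuous_on {a..b::real} y"
  shows "y \<in> L2 (lebesgue_on {a<..<b})"
  unfolding L2_iff_Ioo using continuous_square_integrable[OF assms]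
  by (auto intro!: continuous_imp_measurable_on_sets_lebesgue continuous_on_subset[OF assms])

lemma L2_Ioo_integrable:
  assumes "g \<in> L2 (lebesgue_on {a<..<b::real})"
  shows "g absolutely_integrable_on {a..b}"
    and "a \<le> b \<Longrightarrow> (integral {a..b} (\<lambda>t. cmod (g t)))\<^sup>2 \<le> (b - a) * sq_norm a b g"
proof -
  have m: "g \<in> borel_measurable (lebesgue_on {a<..<b})" and i: "(\<lambda>x. (cmod (g x))\<^sup>2) integrable_on {a..b}"
    using assms by (auto simp: L2_iff_Ioo)
  have "g absolutely_integrable_on {a<..<b}"
  proof (rule measurable_bounded_by_integrable_imp_absolutely_integrable[OF m])
    show "(\<lambda>x. 1 + (cmod (g x))\<^sup>2) integrable_on {a<..<b}"
      using i by (intro integrable_add) (auto simp: integrable_on_open_interval_real)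
    show "cmod (g x) \<le> 1 + (cmod (g x))\<^sup>2" for x
    proof -
      have "2 * cmod (g x) \<le> 1 + (cmod (g x))\<^sup>2"
        using sum_squares_bound[of 1 "cmod (g x)"] by simp
      moreover have "0 \<le> cmod (g x)" by simp
      ultimately show ?thesis by linarith
    qed
  qed simp
  then show g: "g absolutely_integrable_on {a..b}" by (simp add: absolutely_integrable_on_Icc_iff_Ioo)
  show "(integral {a..b} (\<lambda>t. cmod (g t)))\<^sup>2 \<le> (b - a) * sq_norm a b g" if "a \<le> b"
    unfolding sq_norm_def by (rule Cauchy_Schwarz_const[OF that norm_integrable[OF g] i])
qed

lemma sq_norm_AE_cong:
  assumes "AE x in lebesgue_on {a<..<b::real}. f x = g x"
  shows "sq_norm a b f = sq_norm a b g"
proof -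
  obtain N where N: "negligible N" "\<And>x. x \<in> {a<..<b} - N \<Longrightarrow> f x = g x"
    using assms by (subst (asm) AE_lebesgue_on_iff_negligible) auto
  show ?thesis unfolding sq_norm_def
    by (rule integral_spike[of "N \<union> {a, b}"]) (use N in \<open>auto intro: negligible_Un\<close>)
qed

text \<open>Confirms that the graph sees only the values on its own interval, as the orthogonal sum
  presupposes. This permits functions to be extended by zero and to be glued from pieces.\<close>

lemma neumann_realization_cong:
  assumes "a < b" "\<And>x. x \<in> {a<..<b} \<Longrightarrow> f x = f' x" "\<And>x. x \<in> {a<..<b} \<Longrightarrow> u x = u' x"
    and "(f', u') \<in> neumann_realization q a b"
  shows "(f, u) \<in> neumann_realization q a b"
proof -
  have ae: "AE x in lebesgue_on {a<..<b}. f x = f' x" "AE x in lebesgue_on {a<..<b}. u x = u' x"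
    using assms(2,3) by (auto intro!: AE_I2)
  obtain y y1 y2 where *: "neumann_sol a b y y1 y2" "AE x in lebesgue_on {a<..<b}. f' x = y x"
       "u' \<in> L2 (lebesgue_on {a<..<b})" "AE x in lebesgue_on {a<..<b}. u' x = - y2 x + of_real (q x) * y x"
    using assms(4) neumann_realization_iff[OF assms(1)] by blast
  have "AE x in lebesgue_on {a<..<b}. f x = y x"
    using ae(1) *(2) by eventually_elim simp
  moreover have "AE x in lebesgue_on {a<..<b}. u x = - y2 x + of_real (q x) * y x"
    using ae(2) *(4) by eventually_elim simp
  moreover have "u \<in> L2 (lebesgue_on {a<..<b})"
    by (rule L2_AE_cong(1)[OF _ *(3) ae(2)]) simp
  ultimately show ?thesis
    using *(1) neumann_realization_iff[OF assms(1)] by blast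
qed

text \<open>Writing \<open>u - w f = g\<close>, an element of the graph is a Neumann solution of the inhomogeneous
  equation \<open>- y'' + q y - w y = g\<close>.\<close>

lemma neumann_realizationE:
  assumes "a < b" and q: "q absolutely_integrable_on {a..b}" and fu: "(f, u) \<in> neumann_realization q a b"
  obtains y y1 g where "neumann_sol a b y y1 (\<lambda>x. (of_real (q x) - w) * y x - g x)"
    "AE x in lebesgue_on {a<..<b}. f x = y x" "AE x in lebesgue_on {a<..<b}. u x - w * f x = g x"
    "g \<in> L2 (lebesgue_on {a<..<b})" "f \<in> L2 (lebesgue_on {a<..<b})" "u \<in> L2 (lebesgue_on {a<..<b})"
proof -
  obtain y y1 y2 where *: "neumann_sol a b y y1 y2" "AE x in lebesgue_on {a<..<b}. f x = y x"
       "u \<in> L2 (lebesgue_on {a<..<b})" "AE x in lebesgue_on {a<..<b}. u x = - y2 x + of_real (q x) * y x"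
    using fu neumann_realization_iff[OF assms(1)] by blast
  define g where "g x = (of_real (q x) - w) * y x - y2 x" for x
  have y: "continuous_on {a..b} y" using *(1) AC_continuous unfolding neumann_sol_def by blast
  have f: "f \<in> L2 (lebesgue_on {a<..<b})"
    by (rule L2_AE_cong(1)[OF _ continuous_L2[OF y] *(2)]) simp
  have "neumann_sol a b y y1 (\<lambda>x. (of_real (q x) - w) * y x - g x)"
    using *(1) by (simp add: g_def)
  moreover have ug: "AE x in lebesgue_on {a<..<b}. u x - w * f x = g x"
    using *(2,4) by eventually_elim (simp add: g_def algebra_simps)
  moreover have "AE x in lebesgue_on {a<..<b}. g x = u x + (- w) * f x"
    using ug by eventually_elim simp
  then have "g \<in> L2 (lebesgue_on {a<..<b})"
    by (rule L2_AE_cong(1)[OF sets_Ioo_lebesgue L2_linear[OF *(3) f, of "- w"]])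
  ultimately show thesis using *(2,3) f that by blast
qed

lemma neumann_realizationI:
  assumes "a < b" and y: "neumann_sol a b y y1 (\<lambda>x. (of_real (q x) - w) * y x - g x)"
    and g: "g \<in> L2 (lebesgue_on {a<..<b})"
  shows "(y, \<lambda>x. w * y x + g x) \<in> neumann_realization q a b"
proof -
  have yc: "continuous_on {a..b} y" using y AC_continuous unfolding neumann_sol_def by blast
  have "(\<lambda>x. w * y x + g x) \<in> L2 (lebesgue_on {a<..<b})"
    using L2_linear[OF g continuous_L2[OF yc], of w] by (simp add: add.commute)
  then show ?thesis
    unfolding neumann_realization_iff[OF assms(1)]
    by (intro exI[of _ y] exI[of _ y1] exI[of _ "\<lambda>x. (of_real (q x) - w) * y x - g x"] conjI y AE_I2)
      (simp_all add: algebra_simps)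
qed

text \<open>Pairing g = u - w f with f gives t[f] = Re \<langle>g, f\<rangle> + Re w
  \<parallel>f\<parallel>^2, and the inner product is at most (\<parallel>g\<parallel>^2 +
  \<parallel>f\<parallel>^2)/2. The margin 1 between Re w and l makes the constant exactly 1, the
  same on every interval.\<close>

lemma neumann_bound_of_form:
  assumes "a < b" and q: "q absolutely_integrable_on {a..b}" and fu: "(f, u) \<in> neumann_realization q a b"
    and low: "\<And>y y1. form_dom a b y y1 \<Longrightarrow> l * sq_norm a b y \<le> qform q a b y y1" and w: "Re w + 1 \<le> l"
  shows "sq_norm a b f \<le> sq_norm a b (\<lambda>x. u x - w * f x)"
proof -
  obtain y y1 g where y: "neumann_sol a b y y1 (\<lambda>x. (of_real (q x) - w) * y x - g x)"
    and ae: "AE x in lebesgue_on {a<..<b}. f x = y x" "AE x in lebesgue_on {a<..<b}. u x - w * f x = g x"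
    and g: "g \<in> L2 (lebesgue_on {a<..<b})"
    using neumann_realizationE[OF assms(1) q fu] by blast
  note F = neumann_sol_form[OF y q less_imp_le[OF assms(1)]]
  have yc: "continuous_on {a..b} y" by (rule form_dom_continuous[OF F(1)])
  note ysq = continuous_square_integrable[OF yc]
  have gsq: "(\<lambda>x. (cmod (g x))\<^sup>2) integrable_on {a..b}" using g by (simp add: L2_iff_Ioo)
  have "qform q a b y y1 \<le> integral {a..b} (\<lambda>x. 1 / 2 * (cmod (g x))\<^sup>2 + (Re w + 1 / 2) * (cmod (y x))\<^sup>2)"
    unfolding F(3)[symmetric]
  proof (rule integral_le[OF F(2)])
    show "(\<lambda>x. 1 / 2 * (cmod (g x))\<^sup>2 + (Re w + 1 / 2) * (cmod (y x))\<^sup>2) integrable_on {a..b}"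
      by (intro integrable_add integrable_on_mult_right gsq ysq)
    fix x
    have "Re ((- ((of_real (q x) - w) * y x - g x) + of_real (q x) * y x) * cnj (y x))
        = Re (g x * cnj (y x)) + Re w * (cmod (y x))\<^sup>2"
      unfolding cmod_power2 by (simp add: power2_eq_square algebra_simps)
    moreover have "Re (g x * cnj (y x)) \<le> cmod (g x) * cmod (y x)"
      by (metis complex_Re_le_cmod complex_mod_cnj norm_mult)
    moreover have "2 * cmod (g x) * cmod (y x) \<le> (cmod (g x))\<^sup>2 + (cmod (y x))\<^sup>2"
      by (rule sum_squares_bound)
    ultimately show "Re ((- ((of_real (q x) - w) * y x - g x) + of_real (q x) * y x) * cnj (y x))
        \<le> 1 / 2 * (cmod (g x))\<^sup>2 + (Re w + 1 / 2) * (cmod (y x))\<^sup>2"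
      by (simp add: field_simps)
  qed
  also have "\<dots> = 1 / 2 * sq_norm a b g + (Re w + 1 / 2) * sq_norm a b y"
    unfolding Henstock_Kurzweil_Integration.integral_add[OF integrable_on_mult_right[OF gsq]
        integrable_on_mult_right[OF ysq]] sq_norm_def
    by simp
  finally have "l * sq_norm a b y \<le> 1 / 2 * sq_norm a b g + (Re w + 1 / 2) * sq_norm a b y"
    using low[OF F(1)] by linarith
  moreover have "(Re w + 1) * sq_norm a b y \<le> l * sq_norm a b y"
    using w sq_norm_nonneg[OF yc] by (rule mult_right_mono)
  ultimately have "sq_norm a b y \<le> sq_norm a b g" by (simp add: field_simps)
  then show ?thesis using sq_norm_AE_cong[OF ae(1)] sq_norm_AE_cong[OF ae(2)] by simp
qed

lemma neumann_resolvent_L2: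
  assumes "a < b" and q: "q absolutely_integrable_on {a..b}" and w: "\<not> neumann_eig q a b w"
  obtains K where "K \<ge> 0" "\<And>f u. (f, u) \<in> neumann_realization q a b \<Longrightarrow> sq_norm a b f \<le> K * sq_norm a b
      (\<lambda>x. u x - w * f x)"
    "\<And>g. g \<in> L2 (lebesgue_on {a<..<b}) \<Longrightarrow> \<exists>f. (f, \<lambda>x. w * f x + g x) \<in> neumann_realization q a b"
proof -
  obtain K where K: "K \<ge> 0" "\<And>g. g absolutely_integrable_on {a..b} \<Longrightarrow>
    \<exists>y y1. neumann_sol a b y y1 (\<lambda>x. (of_real (q x) - w) * y x - g x) \<and>
      (\<forall>x\<in>{a..b}. cmod (y x) \<le> K * integral {a..b} (\<lambda>t. cmod (g t)))"
    using neumann_resolvent[OF assms] by blast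
  show thesis
  \<comment> \<open>One factor b - a comes from integrating the sup bound, the other from the
    Cauchy-Schwarz inequality for the L^1 norm of g.\<close>
  proof (rule that[of "K\<^sup>2 * (b - a)\<^sup>2"])
    fix f u assume fu: "(f, u) \<in> neumann_realization q a b"
    obtain y y1 g where y: "neumann_sol a b y y1 (\<lambda>x. (of_real (q x) - w) * y x - g x)"
      and ae: "AE x in lebesgue_on {a<..<b}. f x = y x" "AE x in lebesgue_on {a<..<b}. u x - w * f x = g x"
      and g: "g \<in> L2 (lebesgue_on {a<..<b})"
      using neumann_realizationE[OF assms(1) q fu] by blast
    obtain z z1 where z: "neumann_sol a b z z1 (\<lambda>x. (of_real (q x) - w) * z x - g x)"
      "\<And>x. x \<in> {a..b} \<Longrightarrow> cmod (z x) \<le> K * integral {a..b} (\<lambda>t. cmod (g t))"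
      using K(2)[OF L2_Ioo_integrable(1)[OF g]] by blast
    have yb: "cmod (y x) \<le> K * integral {a..b} (\<lambda>t. cmod (g t))" if "x \<in> {a..b}" for x
      using z(2)[OF that] neumann_unique[OF assms y z(1) that] by simp
    have yc: "continuous_on {a..b} y" using y AC_continuous unfolding neumann_sol_def by blast
    have "sq_norm a b y \<le> integral {a..b} (\<lambda>x. (K * integral {a..b} (\<lambda>t. cmod (g t)))\<^sup>2)"
      unfolding sq_norm_def
    proof (rule integral_le[OF continuous_square_integrable[OF yc] integrable_const_ivl])
      show "(cmod (y x))\<^sup>2 \<le> (K * integral {a..b} (\<lambda>t. cmod (g t)))\<^sup>2" if "x \<in> {a..b}" for x
        by (intro power_mono yb that) auto
    qed
    also have "\<dots> = K\<^sup>2 * (b - a) * (integral {a..b} (\<lambda>t. cmod (g t)))\<^sup>2"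
      using assms(1) by (simp add: power_mult_distrib)
    also have "\<dots> \<le> K\<^sup>2 * (b - a) * ((b - a) * sq_norm a b g)"
      using assms(1) L2_Ioo_integrable(2)[OF g] by (intro mult_left_mono) auto
    finally show "sq_norm a b f \<le> K\<^sup>2 * (b - a)\<^sup>2 * sq_norm a b (\<lambda>x. u x - w * f x)"
      using sq_norm_AE_cong[OF ae(1)] sq_norm_AE_cong[OF ae(2)] by (simp add: power2_eq_square)
  next
    fix g assume g: "g \<in> L2 (lebesgue_on {a<..<b})"
    show "\<exists>f. (f, \<lambda>x. w * f x + g x) \<in> neumann_realization q a b"
      using K(2)[OF L2_Ioo_integrable(1)[OF g]] neumann_realizationI[OF assms(1) _ g] by blast
  qed simp
qed

text \<open>The right-hand side vanishes almost everywhere, so the representative y solves the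
  homogeneous equation. Both claims then rest on uniqueness of the initial value problem; for the
  second, y - y(a) c has zero initial data.\<close>

lemma eigenfunction_unique:
  assumes "a < b" and q: "q absolutely_integrable_on {a..b}" and fu: "(f, u) \<in> neumann_realization q a b"
    and eq: "AE x in lebesgue_on {a<..<b}. u x = w * f x"
  shows "\<not> neumann_eig q a b w \<Longrightarrow> AE x in lebesgue_on {a<..<b}. f x = 0"
    and "neumann_sol a b c c1 (\<lambda>x. (of_real (q x) - w) * c x) \<Longrightarrow> c a = 1 \<Longrightarrow>
      \<exists>\<alpha>. AE x in lebesgue_on {a<..<b}. f x = \<alpha> * c x"
proof -
  obtain y y1 g where y: "neumann_sol a b y y1 (\<lambda>x. (of_real (q x) - w) * y x - g x)"
    and ae: "AE x in lebesgue_on {a<..<b}. f x = y x" "AE x in lebesgue_on {a<..<b}. u x - w * f x = g x"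
    using neumann_realizationE[OF assms(1) q fu] by blast
  have g0: "AE x in lebesgue_on {a<..<b}. g x = 0"
    using ae(2) eq by eventually_elim simp
  obtain N where N: "negligible N" "\<And>x. x \<in> {a<..<b} - N \<Longrightarrow> g x = 0"
    using g0 by (subst (asm) AE_lebesgue_on_iff_negligible) auto
  have y': "AC a b y y1" "AC a b y1 (\<lambda>x. (of_real (q x) - w) * y x - g x)" "y1 a = 0" "y1 b = 0"
    using y unfolding neumann_sol_def by blast+
  have "AC a b y1 (\<lambda>x. (of_real (q x) - w) * y x)"
    by (rule AC_cong[OF y'(2), where N = "N \<union> {a, b}"]) (use N assms(1) in \<open>auto intro: negligible_Un\<close>)
  then have ys: "neumann_sol a b y y1 (\<lambda>x. (of_real (q x) - w) * y x)"
    using y' by (simp add: neumann_sol_def)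
  have AE_Icc: "AE x in lebesgue_on {a<..<b}. x \<in> {a..b}"
    by (rule AE_I2) auto
  show "AE x in lebesgue_on {a<..<b}. f x = 0" if "\<not> neumann_eig q a b w"
    using ae(1) AE_Icc
  proof eventually_elim
    case (elim x)
    then show ?case using neumann_eigI[OF ys _ _ q] that by metis
  qed
  show "\<exists>\<alpha>. AE x in lebesgue_on {a<..<b}. f x = \<alpha> * c x"
    if c: "neumann_sol a b c c1 (\<lambda>x. (of_real (q x) - w) * c x)" "c a = 1"
  proof (intro exI)
    show "AE x in lebesgue_on {a<..<b}. f x = y a * c x"
      using ae(1) AE_Icc
    proof eventually_elim
      case (elim x)
      have d: "neumann_sol a b (\<lambda>x. y x - y a * c x) (\<lambda>x. y1 x - y a * c1 x)
          (\<lambda>x. (of_real (q x) - w) * (y x - y a * c x) - (0 - 0))"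
        by (rule neumann_sol_diff[where g = "\<lambda>_. 0" and h = "\<lambda>_. 0"])
            (use ys neumann_sol_cmult[OF c(1)] in simp_all)
      have "y x - y a * c x = 0"
        by (rule ode_zero[of a b "\<lambda>x. y x - y a * c x" "\<lambda>x. y1 x - y a * c1 x" "\<lambda>x. of_real (q x) - w"])
           (use d c(2) assms(1) potential_integrable[OF q] elim in \<open>simp_all add: neumann_sol_def\<close>)
      then show ?case using elim by simp
    qed
  qed
qed

section \<open>Decomposition of the half-line into the intervals\<close>

text \<open>The components of the complement of \<Sigma>, recorded by their endpoints; that \<Sigma>
  has measure zero appears as the covering property \<open>null\<close>. As q is integrable up to
  both endpoints, each interval carries a regular problem.\<close>

locale interval_family =
  fixes q :: "real \<Rightarrow> real" and a b :: "nat \<Rightarrow> real"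
  assumes ab: "a k < b k"
    and a_nonneg: "0 \<le> a k"
    and disj: "i \<noteq> j \<Longrightarrow> {a i<..<b i} \<inter> {a j<..<b j} = {}"
    and null: "negligible ({0<..} - (\<Union>k. {a k<..<b k}))"
    and q_int: "q absolutely_integrable_on {a k..b k}"
begin

abbreviation "\<Delta> k \<equiv> {a k<..<b k}"
abbreviation "M \<equiv> lebesgue_on ({0<..}::real set)"
abbreviation "Mk k \<equiv> lebesgue_on {a k<..<b k}"
abbreviation "T \<equiv> neumann_sum q a b"

lemma sub: "\<Delta> k \<subseteq> {0<..}"
  using a_nonneg[of k] by (auto intro: le_less_trans)

lemma piece_eq:
  assumes "x \<in> \<Delta> j"
  shows "(if x \<in> \<Delta> k then h x else 0) = (if k = j then h x else 0)"
  using assms disj[of j k] by auto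

lemma piece_sums:
  fixes h :: "real \<Rightarrow> 'b::real_normed_vector"
  shows "(\<lambda>k. if x \<in> \<Delta> k then h x else 0) sums (if x \<in> (\<Union>k. \<Delta> k) then h x else 0)"
proof (cases "x \<in> (\<Union>k. \<Delta> k)")
  case True
  then obtain j where j: "x \<in> \<Delta> j" by blast
  then show ?thesis using piece_eq[OF j, of _ h] sums_single[of j "\<lambda>_. h x"] True by simp
next
  case False
  then have "(\<lambda>k. if x \<in> \<Delta> k then h x else 0) = (\<lambda>_. 0)"
    by (intro ext if_not_P) blast
  then show ?thesis using False by (simp only: if_False sums_zero)
qed

text \<open>Dominated convergence with majorant |h|, since at each point at most one piece differs
  from zero. It serves to decompose L^2 norms, and also to add up inequalities that are known on
  each interval separately.\<close>

lemma integral_sums: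
  fixes h :: "real \<Rightarrow> 'b::euclidean_space"
  assumes h: "h absolutely_integrable_on {0<..}"
  shows "(\<lambda>k. integral {a k..b k} h) sums integral {0<..} h"
proof -
  let ?h = "\<lambda>k x. if x \<in> \<Delta> k then h x else 0"
  have hk: "h integrable_on \<Delta> k" for k
    by (rule absolutely_integrable_imp_integrable_on[OF set_integrable_subset[OF h]]) (use sub in auto)
  then have hi: "?h k integrable_on UNIV" for k
    unfolding integrable_restrict_UNIV .
  have "(\<lambda>n. integral UNIV (\<lambda>x. \<Sum>k<n. ?h k x)) \<longlonglongrightarrow> integral UNIV (\<lambda>x. if x \<in> (\<Union>k. \<Delta> k) then h x else 0)"
  proof (rule dominated_convergence(2))
    show "(\<lambda>x. \<Sum>k<n. ?h k x) integrable_on UNIV" for n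
      by (intro integrable_sum hi) auto
    show "(\<lambda>x. if x \<in> {0<..} then norm (h x) else 0) integrable_on UNIV"
      using h unfolding integrable_restrict_UNIV by (simp add: absolutely_integrable_on_def)
    show "(\<lambda>n. \<Sum>k<n. ?h k x) \<longlonglongrightarrow> (if x \<in> (\<Union>k. \<Delta> k) then h x else 0)" for x
      using piece_sums[of x h] unfolding sums_def .
    show "norm (\<Sum>k<n. ?h k x) \<le> (if x \<in> {0<..} then norm (h x) else 0)" for n x
    proof (cases "x \<in> (\<Union>k. \<Delta> k)")
      case True
      then obtain j where j: "x \<in> \<Delta> j" by blast
      then have "x \<in> {0<..}" using sub by blast
      then show ?thesis unfolding piece_eq[OF j] by simp
    next
      case False
      then have "(\<Sum>k<n. ?h k x) = 0" by (intro sum.neutral) auto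
      then show ?thesis by (simp only:) simp
    qed
  qed
  moreover have "integral UNIV (\<lambda>x. \<Sum>k<n. ?h k x) = (\<Sum>k<n. integral {a k..b k} h)" for n
  proof -
    have "integral UNIV (\<lambda>x. \<Sum>k<n. ?h k x) = (\<Sum>k<n. integral UNIV (?h k))"
      by (intro integral_sum hi) auto
    then show ?thesis unfolding Henstock_Kurzweil_Integration.integral_restrict_UNIV integral_open_interval_real .
  qed
  moreover have "integral UNIV (\<lambda>x. if x \<in> (\<Union>k. \<Delta> k) then h x else 0) = integral {0<..} h"
    unfolding Henstock_Kurzweil_Integration.integral_restrict_UNIV by (rule integral_subset_negligible)
        (use sub null in auto)
  ultimately show ?thesis by (simp add: sums_def)
qed

lemma measurable_M:
  fixes f :: "real \<Rightarrow> complex"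
  assumes "\<And>k. f \<in> borel_measurable (Mk k)"
  shows "f \<in> borel_measurable M"
proof -
  have "(\<lambda>x. if x \<in> \<Delta> k then f x else 0) \<in> borel_measurable lebesgue" for k
    using assms[of k] by (subst borel_measurable_if) auto
  then have "(\<lambda>x. \<Sum>k. if x \<in> \<Delta> k then f x else 0) \<in> borel_measurable lebesgue"
    by (rule borel_measurable_suminf)
  moreover have "(\<lambda>x. \<Sum>k. if x \<in> \<Delta> k then f x else 0) = (\<lambda>x. if x \<in> (\<Union>k. \<Delta> k) then f x else 0)"
    using sums_unique[OF piece_sums[of _ f]] by (intro ext) simp
  ultimately have "(\<lambda>x. if x \<in> (\<Union>k. \<Delta> k) then f x else 0) \<in> borel_measurable lebesgue"
    by simp
  then have m: "(\<lambda>x. if x \<in> (\<Union>k. \<Delta> k) then f x else 0) \<in> borel_measurable M"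
    by (rule measurable_restrict_space1)
  show ?thesis
  proof (rule measurable_AE_cong[OF _ m])
    show "AE x in M. f x = (if x \<in> (\<Union>k. \<Delta> k) then f x else 0)"
      by (subst AE_lebesgue_on_iff_negligible, simp) (rule exI, rule conjI, rule null, auto)
  qed simp
qed

lemma AE_M: "(AE x in M. P x) \<longleftrightarrow> (\<forall>k. AE x in Mk k. P x)"
proof
  assume "AE x in M. P x"
  then obtain N where "negligible N" "\<forall>x\<in>{0<..} - N. P x"
    by (subst (asm) AE_lebesgue_on_iff_negligible) auto
  then have "\<exists>N. negligible N \<and> (\<forall>x\<in>\<Delta> k - N. P x)" for k
    using sub by (intro exI[of _ N]) blast
  then show "\<forall>k. AE x in Mk k. P x"
    by (subst AE_lebesgue_on_iff_negligible) auto
next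
  assume "\<forall>k. AE x in Mk k. P x"
  then have "\<forall>k. \<exists>N. negligible N \<and> (\<forall>x\<in>\<Delta> k - N. P x)"
    using AE_lebesgue_on_iff_negligible[OF sets_Ioo_lebesgue] by blast
  then obtain N where N: "\<And>k. negligible (N k)" "\<And>k x. x \<in> \<Delta> k - N k \<Longrightarrow> P x" by metis
  have "negligible ((\<Union>k. N k) \<union> ({0<..} - (\<Union>k. \<Delta> k)))"
    using N(1) null by (intro negligible_Un negligible_countable_Union) auto
  moreover have "\<forall>x\<in>{0<..} - ((\<Union>k. N k) \<union> ({0<..} - (\<Union>k. \<Delta> k))). P x"
    using N(2) by auto
  ultimately show "AE x in M. P x"
    by (subst AE_lebesgue_on_iff_negligible, simp) blast
qed

text \<open>For the converse, the squared moduli of the pieces form a series of nonnegative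
  functions with summable integrals, which may be integrated term by term.\<close>

lemma L2_M_iff:
  "f \<in> L2 M \<longleftrightarrow> (\<forall>k. f \<in> L2 (Mk k)) \<and> summable (\<lambda>k. sq_norm (a k) (b k) f)"
proof
  assume f: "f \<in> L2 M"
  have i: "(\<lambda>x. (cmod (f x))\<^sup>2) absolutely_integrable_on {0<..}"
    using f by (simp add: L2_def set_integrable_def integrable_restrict_space)
  have "f \<in> L2 (Mk k)" for k
  proof -
    have "f \<in> borel_measurable (Mk k)"
      using f sub[of k] by (auto simp: L2_def intro: measurable_restrict_mono)
    moreover have "(\<lambda>x. (cmod (f x))\<^sup>2) absolutely_integrable_on \<Delta> k"
      by (rule set_integrable_subset[OF i]) (use sub in auto)
    ultimately show ?thesis
      by (auto simp: L2_iff_Ioo integrable_on_open_interval_real[symmetric] dest: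
          absolutely_integrable_imp_integrable_on)
  qed
  moreover have "summable (\<lambda>k. sq_norm (a k) (b k) f)"
    unfolding sq_norm_def using integral_sums[OF i] by (rule sums_summable)
  ultimately show "(\<forall>k. f \<in> L2 (Mk k)) \<and> summable (\<lambda>k. sq_norm (a k) (b k) f)" by blast
next
  assume "(\<forall>k. f \<in> L2 (Mk k)) \<and> summable (\<lambda>k. sq_norm (a k) (b k) f)"
  then have f: "\<And>k. f \<in> L2 (Mk k)" and s: "summable (\<lambda>k. sq_norm (a k) (b k) f)" by auto
  let ?h = "\<lambda>k x. if x \<in> \<Delta> k then (cmod (f x))\<^sup>2 else 0"
  have hi: "integrable lebesgue (?h k)" for k
    using f[of k] by (subst Lebesgue_Measure.integrable_restrict_UNIV) (auto simp: L2_def)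
  have hint: "integral\<^sup>L lebesgue (?h k) = sq_norm (a k) (b k) f" for k
    using L2_norm_sq_Ioo[OF f[of k]] by (subst Lebesgue_Measure.integral_restrict_UNIV) (auto simp: L2_norm_sq)
  have "integrable lebesgue (\<lambda>x. \<Sum>k. ?h k x)"
  proof (rule integrable_suminf[OF hi])
    have "summable (\<lambda>k. norm (?h k x))" for x
      using sums_summable[OF piece_sums[of x "\<lambda>x. (cmod (f x))\<^sup>2"]] by (simp add: if_distrib cong: if_cong)
    then show "AE x in lebesgue. summable (\<lambda>k. norm (?h k x))" by simp
    have "(\<lambda>x. norm (?h k x)) = ?h k" for k by auto
    then show "summable (\<lambda>k. LINT x|lebesgue. norm (?h k x))" using s hint by simp
  qed
  moreover have "(\<lambda>x. \<Sum>k. ?h k x) = (\<lambda>x. if x \<in> (\<Union>k. \<Delta> k) then (cmod (f x))\<^sup>2 else 0)"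
    using sums_unique[OF piece_sums[of _ "\<lambda>x. (cmod (f x))\<^sup>2"]] by (intro ext) simp
  ultimately have "integrable lebesgue (\<lambda>x. if x \<in> (\<Union>k. \<Delta> k) then (cmod (f x))\<^sup>2 else 0)" by simp
  then have "(\<lambda>x. (cmod (f x))\<^sup>2) absolutely_integrable_on (\<Union>k. \<Delta> k)"
    unfolding set_integrable_def by (rule back_subst[of "integrable lebesgue"]) (auto simp: indicator_def)
  then have "(\<lambda>x. (cmod (f x))\<^sup>2) absolutely_integrable_on {0<..}"
    by (rule absolutely_integrable_spike_set)
      (use sub in \<open>auto intro!: negligible_subset[OF null] simp: subset_iff\<close>)
  then have "integrable M (\<lambda>x. (cmod (f x))\<^sup>2)"
    by (simp add: set_integrable_def integrable_restrict_space)
  moreover have "f \<in> borel_measurable M"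
    by (rule measurable_M) (use f in \<open>auto simp: L2_def\<close>)
  ultimately show "f \<in> L2 M" by (simp add: L2_def)
qed

lemma L2_norm_sums:
  assumes f: "f \<in> L2 M"
  shows "(\<lambda>k. sq_norm (a k) (b k) f) sums (L2_norm M f)\<^sup>2"
proof -
  have i: "(\<lambda>x. (cmod (f x))\<^sup>2) absolutely_integrable_on {0<..}"
    using f by (simp add: L2_def set_integrable_def integrable_restrict_space)
  have "(L2_norm M f)\<^sup>2 = integral {0<..} (\<lambda>x. (cmod (f x))\<^sup>2)"
    unfolding L2_norm_sq using f by (intro lebesgue_integral_eq_integral) (auto simp: L2_def)
  then show ?thesis using integral_sums[OF i] by (simp add: sq_norm_def)
qed

text \<open>The summability clause of the orthogonal sum says precisely that u is square-integrable
  on the half-line.\<close>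

lemma neumann_sum_iff:
  "(f, u) \<in> T \<longleftrightarrow> f \<in> L2 M \<and> u \<in> L2 M \<and> (\<forall>k. (f, u) \<in> neumann_realization q (a k) (b k))"
proof -
  have *: "u \<in> L2 (Mk k)" if "(f, u) \<in> neumann_realization q (a k) (b k)" for k
    using that by (simp add: neumann_realization_def) blast
  have "summable (\<lambda>k. (L2_norm (Mk k) u)\<^sup>2) \<longleftrightarrow> summable (\<lambda>k. sq_norm (a k) (b k) u)"
    if "\<forall>k. (f, u) \<in> neumann_realization q (a k) (b k)"
    using L2_norm_sq_Ioo[OF *] that by simp
  then show ?thesis
    unfolding neumann_sum_def orthogonal_sum_def L2_M_iff[of u] using * by blast
qed

end

subsection \<open>Discreteness in terms of the quadratic forms\<close>

text \<open>Gaussian elimination: each equation removes at most one unknown, so fewer equations than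
  unknowns leave a nonzero solution.\<close>

lemma homogeneous_system_solvable:
  fixes c :: "'i \<Rightarrow> 'e \<Rightarrow> complex"
  assumes "finite B" "finite J" "card B < card J"
  obtains \<alpha> where "\<exists>j\<in>J. \<alpha> j \<noteq> 0" "\<And>e. e \<in> B \<Longrightarrow> (\<Sum>j\<in>J. \<alpha> j * c j e) = 0"
proof -
  have "\<exists>\<alpha>. (\<exists>j\<in>J. \<alpha> j \<noteq> 0) \<and> (\<forall>e\<in>B. (\<Sum>j\<in>J. \<alpha> j * c j e) = 0)"
    using assms
  proof (induction B arbitrary: J c rule: finite_induct)
    case empty
    then have "J \<noteq> {}" by auto
    then show ?case by (intro exI[of _ "\<lambda>_. 1"]) auto
  next
    case (insert e B)
    show ?case
    proof (cases "\<forall>j\<in>J. c j e = 0")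
      case True
      have "card B < card J" using insert by simp
      then obtain \<alpha> where "\<exists>j\<in>J. \<alpha> j \<noteq> 0" "\<forall>e\<in>B. (\<Sum>j\<in>J. \<alpha> j * c j e) = 0"
        using insert.IH[of J c] insert.prems by blast
      then show ?thesis using True by (intro exI[of _ \<alpha>]) auto
    next
      case False
      then obtain p where p: "p \<in> J" "c p e \<noteq> 0" by blast
      define J' where "J' = J - {p}"
      \<comment> \<open>Coefficients after the unknown of the pivot \<open>p\<close> has been
        eliminated by means of equation \<open>e\<close>; those of equation \<open>e\<close> itself
        become zero.\<close>
      define d where "d j x = c j x - c j e / c p e * c p x" for j x
      have J': "finite J'" "card B < card J'" "p \<notin> J'" "J = insert p J'"
        using insert p by (auto simp: J'_def)
      obtain \<beta> where \<beta>: "\<exists>j\<in>J'. \<beta> j \<noteq> 0" "\<forall>x\<in>B. (\<Sum>j\<in>J'. \<beta> j * d j x) = 0"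
        using insert.IH[of J' d] J' by blast
      \<comment> \<open>Back substitution: the value at \<open>p\<close> is the one forced by
        equation \<open>e\<close>.\<close>
      define \<alpha> where "\<alpha> j = (if j = p then - (\<Sum>i\<in>J'. \<beta> i * (c i e / c p e)) else \<beta> j)" for j
      have eq: "(\<Sum>j\<in>J. \<alpha> j * c j x) = (\<Sum>j\<in>J'. \<beta> j * d j x)" for x
      proof -
        have "(\<Sum>j\<in>J'. \<alpha> j * c j x) = (\<Sum>j\<in>J'. \<beta> j * c j x)"
          by (rule sum.cong) (use J' in \<open>auto simp: \<alpha>_def\<close>)
        then show ?thesis
          using J' by (simp add: \<alpha>_def d_def right_diff_distrib sum_subtractf sum_distrib_right mult.assoc)
      qed
      have "(\<Sum>j\<in>J. \<alpha> j * c j x) = 0" if "x \<in> insert e B" for x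
        unfolding eq using that \<beta>(2) p by (auto simp: d_def)
      moreover have "\<exists>j\<in>J. \<alpha> j \<noteq> 0" using \<beta>(1) J' by (auto simp: \<alpha>_def)
      ultimately show ?thesis by blast
    qed
  qed
  then show thesis using that by blast
qed

text \<open>At an eigenfunction the form equals Re w times the squared norm.\<close>

lemma eigenvalue_ge_form_bound:
  assumes "a < b" and q: "q absolutely_integrable_on {a..b}" and e: "neumann_eig q a b w"
    and low: "\<And>y y1. form_dom a b y y1 \<Longrightarrow> l * sq_norm a b y \<le> qform q a b y y1"
  shows "l \<le> Re w"
proof -
  obtain c c1 where c: "neumann_sol a b c c1 (\<lambda>x. (of_real (q x) - w) * c x)" "c a = 1"
    using e unfolding neumann_eig_def by blast
  note F = neumann_sol_form[OF c(1) q less_imp_le[OF assms(1)]]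
  have cc: "continuous_on {a..b} c" by (rule form_dom_continuous[OF F(1)])
  have "Re ((- ((of_real (q x) - w) * c x) + of_real (q x) * c x) * cnj (c x)) = Re w * (cmod (c x))\<^sup>2" for x
    unfolding cmod_power2 by (simp add: power2_eq_square algebra_simps)
  then have "qform q a b c c1 = Re w * sq_norm a b c"
    using F(3) by (simp add: sq_norm_def)
  moreover have "sq_norm a b c > 0"
    unfolding sq_norm_def by (rule integral_norm_square_pos[OF assms(1) cc]) (simp add: c(2))
  ultimately show ?thesis using low[OF F(1)] by simp
qed

text \<open>If w is not an eigenvalue, the resolvent estimate at w, applied to an eigenfunction for
  v, gives 1 \<le> K |v - w|^2. As \<open>K\<close> compares squared norms, the radius 1/(K + 1)
  suffices: K/(K + 1)^2 < 1.\<close>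

lemma not_eigenvalue_near:
  assumes "a < b" and q: "q absolutely_integrable_on {a..b}"
  obtains \<delta> where "\<delta> > 0" "\<And>v. v \<noteq> w \<Longrightarrow> cmod (v - w) < \<delta> \<Longrightarrow> \<not> neumann_eig q a b v"
proof (cases "neumann_eig q a b w")
  case True
  then show thesis using neumann_eig_isolated[OF assms] that by blast
next
  case False
  obtain K where K: "K \<ge> 0" "\<And>f u. (f, u) \<in> neumann_realization q a b \<Longrightarrow> sq_norm a b f \<le> K * sq_norm a b
      (\<lambda>x. u x - w * f x)"
    using neumann_resolvent_L2[OF assms False] by metis
  have "\<not> neumann_eig q a b v" if v: "cmod (v - w) < 1 / (K + 1)" for v
  proof
    assume "neumann_eig q a b v"
    then obtain c c1 where c: "neumann_sol a b c c1 (\<lambda>x. (of_real (q x) - v) * c x)" "c a = 1"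
      unfolding neumann_eig_def by blast
    have cc: "continuous_on {a..b} c" using c(1) AC_continuous unfolding neumann_sol_def by blast
    have "(c, \<lambda>x. v * c x + 0) \<in> neumann_realization q a b"
      by (rule neumann_realizationI[OF assms(1)]) (use c in \<open>auto simp: L2_def\<close>)
    from K(2)[OF this] have "sq_norm a b c \<le> K * sq_norm a b (\<lambda>x. (v - w) * c x)"
      by (simp add: left_diff_distrib)
    also have "sq_norm a b (\<lambda>x. (v - w) * c x) = (cmod (v - w))\<^sup>2 * sq_norm a b c"
      by (simp add: sq_norm_def norm_mult power_mult_distrib)
    finally have "sq_norm a b c \<le> K * (cmod (v - w))\<^sup>2 * sq_norm a b c" by simp
    moreover have N: "sq_norm a b c > 0"
      unfolding sq_norm_def by (rule integral_norm_square_pos[OF assms(1) cc]) (simp add: c(2))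
    ultimately have "1 \<le> K * (cmod (v - w))\<^sup>2" by simp
    also have "\<dots> \<le> K * (1 / (K + 1))\<^sup>2" using v K(1) by (intro mult_left_mono power_mono) auto
    also have "\<dots> < 1" using K(1) by (simp add: power_divide power2_eq_square field_simps add_pos_nonneg)
    finally show False by simp
  qed
  then show thesis using that[of "1 / (K + 1)"] K(1) by auto
qed

lemma resolvent_setE:
  assumes "z \<in> resolvent_set N A"
  obtains C where "\<And>f u. (f, u) \<in> A \<Longrightarrow> L2_norm N f \<le> C * L2_norm N (\<lambda>x. u x - z * f x)"
proof -
  obtain C where C: "\<forall>(f, u)\<in>A. L2_norm N f \<le> C * L2_norm N (\<lambda>x. u x - z * f x)"
    using assms unfolding resolvent_set_def by blast
  show thesis
    by (rule that[of C]) (use bspec[OF C] in force)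
qed

context interval_family
begin

section \<open>The spectrum of the orthogonal sum\<close>

definition zero_ext :: "nat \<Rightarrow> (real \<Rightarrow> complex) \<Rightarrow> real \<Rightarrow> complex" where
  "zero_ext k c x = (if x \<in> \<Delta> k then c x else 0)"

lemma zero_ext_other: "x \<in> \<Delta> j \<Longrightarrow> j \<noteq> k \<Longrightarrow> zero_ext k c x = 0"
  using disj[of j k] by (auto simp: zero_ext_def)

lemma zero_ext_same: "x \<in> \<Delta> k \<Longrightarrow> zero_ext k c x = c x"
  by (simp add: zero_ext_def)

lemma sq_norm_cong_Ioo: "(\<And>x. x \<in> {s<..<t} \<Longrightarrow> f x = g x) \<Longrightarrow> sq_norm s t f = sq_norm s t g"
  by (rule sq_norm_AE_cong) (auto intro!: AE_I2)

lemma sq_norm_zero_ext: "sq_norm (a j) (b j) (zero_ext k c) = (if j = k then sq_norm (a k) (b k) c else 0)"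
proof (cases "j = k")
  case False
  then have "sq_norm (a j) (b j) (zero_ext k c) = sq_norm (a j) (b j) (\<lambda>_. 0)"
    by (intro sq_norm_cong_Ioo zero_ext_other)
  then show ?thesis using False by (simp add: sq_norm_def)
next
  case True
  then show ?thesis using sq_norm_cong_Ioo[OF zero_ext_same[of _ k c]] by simp
qed

lemma zero_ext_L2:
  assumes "continuous_on {a k..b k} c"
  shows "zero_ext k c \<in> L2 M" "(L2_norm M (zero_ext k c))\<^sup>2 = sq_norm (a k) (b k) c"
proof -
  have "zero_ext k c \<in> L2 (Mk j)" for j
  proof (cases "j = k")
    case True
    show ?thesis unfolding True
      by (rule L2_AE_cong(1)[OF sets_Ioo_lebesgue continuous_L2[OF assms]]) (auto intro!: AE_I2 simp: zero_ext_def)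
  next
    case False
    have "(\<lambda>_. 0) \<in> L2 (Mk j)" by (simp add: L2_def)
    then show ?thesis
      by (rule L2_AE_cong(1)[OF sets_Ioo_lebesgue]) (use False in \<open>auto intro!: AE_I2 zero_ext_other\<close>)
  qed
  moreover have "(\<lambda>j. sq_norm (a j) (b j) (zero_ext k c)) sums sq_norm (a k) (b k) c"
    unfolding sq_norm_zero_ext using sums_single[of k "\<lambda>_. sq_norm (a k) (b k) c"] by simp
  ultimately show L: "zero_ext k c \<in> L2 M"
    by (simp add: L2_M_iff sums_iff)
  show "(L2_norm M (zero_ext k c))\<^sup>2 = sq_norm (a k) (b k) c"
    using L2_norm_sums[OF L] \<open>(\<lambda>j. sq_norm (a j) (b j) (zero_ext k c)) sums sq_norm (a k) (b k) c\<close>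
        sums_unique2 by blast
qed

text \<open>The orthogonal sum imposes no matching condition between intervals, so an eigenfunction
  on one of them, extended by zero, is an eigenfunction of the sum.\<close>

lemma zero_ext_eigenfunction:
  assumes c: "neumann_sol (a k) (b k) c c1 (\<lambda>x. (of_real (q x) - w) * c x)" "c (a k) = 1"
  shows "(zero_ext k c, \<lambda>x. w * zero_ext k c x) \<in> T" "L2_norm M (zero_ext k c) > 0"
proof -
  have cc: "continuous_on {a k..b k} c" using c(1) AC_continuous unfolding neumann_sol_def by blast
  note P = zero_ext_L2[OF cc]
  have "(zero_ext k c, \<lambda>x. w * zero_ext k c x) \<in> neumann_realization q (a j) (b j)" for j
  proof (cases "j = k")
    case True
    have "(c, \<lambda>x. w * c x + 0) \<in> neumann_realization q (a k) (b k)"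
      by (rule neumann_realizationI[OF ab]) (use c in \<open>auto simp: L2_def\<close>)
    then show ?thesis unfolding True
      by (rule neumann_realization_cong[OF ab, rotated 2]) (auto simp: zero_ext_def)
  next
    case False
    have "neumann_sol (a j) (b j) (\<lambda>_. 0) (\<lambda>_. 0) (\<lambda>x. (of_real (q x) - w) * 0 - 0)"
      by (simp add: neumann_sol_def AC_const)
    then have "(\<lambda>_. 0, \<lambda>x. w * 0 + 0) \<in> neumann_realization q (a j) (b j)"
      by (rule neumann_realizationI[OF ab]) (simp add: L2_def)
    then show ?thesis
      by (rule neumann_realization_cong[OF ab, rotated 2]) (use False zero_ext_other in auto)
  qed
  moreover have "(\<lambda>x. w * zero_ext k c x) \<in> L2 M"
    using L2_linear[OF _ P(1), of "\<lambda>_. 0" w] by (simp add: L2_def)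
  ultimately show "(zero_ext k c, \<lambda>x. w * zero_ext k c x) \<in> T"
    using P(1) by (simp add: neumann_sum_iff)
  have "sq_norm (a k) (b k) c > 0"
    unfolding sq_norm_def by (rule integral_norm_square_pos[OF ab cc]) (simp add: c(2))
  then show "L2_norm M (zero_ext k c) > 0"
    using P(2) L2_norm_nonneg[of M "zero_ext k c"] by (metis less_le power_zero_numeral zero_less_power2)
qed

lemma L2_norm_cmult: "L2_norm N (\<lambda>x. c * f x) = cmod c * L2_norm N f"
  unfolding L2_norm_def by (simp add: norm_mult power_mult_distrib real_sqrt_mult)

lemma eigenvalue_in_spectrum:
  assumes "neumann_eig q (a k) (b k) w"
  shows "w \<in> spectrum M T"
proof (rule ccontr)
  assume "w \<notin> spectrum M T"
  then have "w \<in> resolvent_set M T" unfolding spectrum_def by simp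
  then obtain C where C: "\<And>f u. (f, u) \<in> T \<Longrightarrow> L2_norm M f \<le> C * L2_norm M (\<lambda>x. u x - w * f x)"
    by (rule resolvent_setE) blast
  obtain c c1 where c: "neumann_sol (a k) (b k) c c1 (\<lambda>x. (of_real (q x) - w) * c x)" "c (a k) = 1"
    using assms unfolding neumann_eig_def by blast
  note E = zero_ext_eigenfunction[OF c]
  from C[OF E(1)] have "L2_norm M (zero_ext k c) \<le> 0"
    by (simp add: L2_norm_def)
  then show False using E(2) by simp
qed

text \<open>Divergence of the optimal lower bounds, expressed without naming them: every level is a
  lower bound of all but finitely many forms.\<close>

definition form_bound_tends_to_infinity :: bool where
  "form_bound_tends_to_infinity \<longleftrightarrow>
     (\<forall>l. \<exists>K. \<forall>k\<ge>K. \<forall>y y1. form_dom (a k) (b k) y y1 \<longrightarrow> l * sq_norm (a k) (b k) y \<le> qform q (a k) (b k) y y1)"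

text \<open>A subsequence of the lowest eigenvalues that is bounded above is confined by
  \<open>l0\<close> from below, hence has a limit point m. The zero extensions are approximate
  eigenfunctions at m, which is therefore in the spectrum. Isolation forces the eigenvalues to equal
  m eventually, and the disjoint supports then contradict finite multiplicity.\<close>

lemma discrete_imp_form_bound:
  assumes discrete: "purely_discrete_spectrum M T"
    and low: "\<And>k y y1. form_dom (a k) (b k) y y1 \<Longrightarrow> l0 * sq_norm (a k) (b k) y \<le> qform q (a k) (b k) y y1"
  shows form_bound_tends_to_infinity
proof (rule ccontr)
  assume "\<not> form_bound_tends_to_infinity"
  then obtain L where L: "\<And>K. \<exists>k\<ge>K. \<exists>y y1. form_dom (a k) (b k) y y1 \<and> \<not> L * sq_norm (a k) (b k) y
      \<le> qform q (a k) (b k) y y1"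
    unfolding form_bound_tends_to_infinity_def by blast
  have "\<exists>l. neumann_eig q (a k) (b k) (of_real l) \<and> (\<forall>y y1. form_dom (a k) (b k) y y1
      \<longrightarrow> l * sq_norm (a k) (b k) y \<le> qform q (a k) (b k) y y1)" for k
    using lowest_eigenvalue[OF ab q_int] by blast
  then obtain l where eig: "\<And>k. neumann_eig q (a k) (b k) (of_real (l k))"
    and llow: "\<And>k y y1. form_dom (a k) (b k) y y1 \<Longrightarrow> l k * sq_norm (a k) (b k) y \<le> qform q (a k) (b k) y y1" by metis
  have lL: "\<exists>k\<ge>K. l k \<le> L" for K
  proof -
    obtain k y y1 where k: "k \<ge> K" and y: "form_dom (a k) (b k) y y1" "\<not> L * sq_norm (a k) (b k) y
        \<le> qform q (a k) (b k) y y1"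
      using L by blast
    have "l k \<le> L"
    proof (rule ccontr)
      assume "\<not> l k \<le> L"
      then have "L * sq_norm (a k) (b k) y \<le> l k * sq_norm (a k) (b k) y"
        using sq_norm_nonneg[OF form_dom_continuous[OF y(1)]] by (intro mult_right_mono) auto
      then show False using llow[OF y(1)] y(2) by linarith
    qed
    then show ?thesis using k by blast
  qed
  have l0: "l0 \<le> l k" for k
    using eigenvalue_ge_form_bound[OF ab q_int eig low] by simp
  have "infinite {k. l k \<le> L}"
    unfolding infinite_nat_iff_unbounded_le using lL by blast
  then obtain r :: "nat \<Rightarrow> nat" where r: "strict_mono r" "\<And>n. l (r n) \<le> L"
    using infinite_enumerate[of "{k. l k \<le> L}"] by auto
  have "\<And>n. (l \<circ> r) n \<in> {l0..L}" using r l0 by simp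
  then obtain m \<sigma> where \<sigma>: "strict_mono \<sigma>" "((l \<circ> r) \<circ> \<sigma>) \<longlonglongrightarrow> m"
    using compact_imp_seq_compact[OF compact_Icc, of l0 L] unfolding seq_compact_def by blast
  define s where "s n = r (\<sigma> n)" for n
  have s: "strict_mono s" using r(1) \<sigma>(1) by (simp add: s_def strict_mono_def)
  have lim: "(\<lambda>n. l (s n)) \<longlonglongrightarrow> m" using \<sigma>(2) by (simp add: s_def o_def)
  have "\<exists>c c1. neumann_sol (a k) (b k) c c1 (\<lambda>x. (of_real (q x) - of_real (l k)) * c x) \<and> c (a k) = 1" for k
    using eig[of k] unfolding neumann_eig_def .
  then obtain c c1 where c: "\<And>k. neumann_sol (a k) (b k) (c k) (c1 k) (\<lambda>x. (of_real (q x) - of_real (l k)) * c k x)"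
    "\<And>k. c k (a k) = 1" by metis
  define e where "e k = zero_ext k (c k)" for k
  have eT: "(e k, \<lambda>x. of_real (l k) * e k x) \<in> T" and e0: "L2_norm M (e k) > 0" for k
    using zero_ext_eigenfunction[OF c] by (simp_all add: e_def)
  have m: "of_real m \<in> spectrum M T"
  proof (rule ccontr)
    assume "of_real m \<notin> spectrum M T"
    then have "of_real m \<in> resolvent_set M T" unfolding spectrum_def by simp
    then obtain C where C: "\<And>f u. (f, u) \<in> T \<Longrightarrow> L2_norm M f \<le> C * L2_norm M (\<lambda>x. u x - of_real m * f x)"
      by (rule resolvent_setE) blast
    have "1 \<le> C * \<bar>l k - m\<bar>" for k
    proof -
      have "L2_norm M (e k) \<le> C * L2_norm M (\<lambda>x. of_real (l k - m) * e k x)"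
        using C[OF eT[of k]] by (simp add: left_diff_distrib)
      then have "1 * L2_norm M (e k) \<le> (C * \<bar>l k - m\<bar>) * L2_norm M (e k)"
        unfolding L2_norm_cmult by (simp only: norm_of_real mult_1 mult.assoc)
      then show ?thesis using e0[of k] by (simp only: mult_le_cancel_right_pos)
    qed
    moreover have "(\<lambda>n. C * \<bar>l (s n) - m\<bar>) \<longlonglongrightarrow> C * \<bar>m - m\<bar>"
      by (intro tendsto_intros lim)
    ultimately have "1 \<le> C * \<bar>m - m\<bar>" by (intro LIMSEQ_le_const) auto
    then show False by simp
  qed
  then have iso: "of_real m isolated_in spectrum M T" and fin: "finite_multiplicity M T (of_real m)"
    using discrete unfolding purely_discrete_spectrum_def by auto
  obtain \<epsilon> where \<epsilon>: "\<epsilon> > 0" "\<And>y. y \<in> spectrum M T \<Longrightarrow> dist (of_real m) y < \<epsilon> \<Longrightarrow> y = of_real m"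
    using iso unfolding isolated_in_dist_Ex_iff by blast
  obtain N where N: "\<And>n. n \<ge> N \<Longrightarrow> dist (l (s n)) m < \<epsilon>"
    using lim \<epsilon>(1) unfolding lim_sequentially by blast
  have lm: "l (s n) = m" if "n \<ge> N" for n
    using \<epsilon>(2)[OF eigenvalue_in_spectrum[OF eig[of "s n"]]] N[OF that] by (simp add: dist_of_real dist_commute)
  obtain B where B: "finite B" "\<And>f. f \<in> eigenspace M T (of_real m) \<Longrightarrow> \<exists>c. AE x in M. f x = (\<Sum>e\<in>B. c e * e x)"
    using fin unfolding finite_multiplicity_def by blast
  \<comment> \<open>One index more than \<open>card B\<close>, so that the coefficients with respect
    to \<open>B\<close> admit a nontrivial linear relation.\<close>
  define J where "J = s ` {N..N + card B}"
  have "inj s" using s by (rule strict_mono_imp_inj_on)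
  then have J: "finite J" "card B < card J"
    unfolding J_def by (auto simp: card_image inj_on_subset)
  have "\<exists>d. AE x in M. e j x = (\<Sum>f\<in>B. d f * f x)" if "j \<in> J" for j
  proof (rule B(2))
    have "l j = m" using that lm by (auto simp: J_def)
    then show "e j \<in> eigenspace M T (of_real m)"
      using eT[of j] unfolding eigenspace_def by auto
  qed
  then have "\<exists>d. \<forall>j\<in>J. AE x in M. e j x = (\<Sum>f\<in>B. d j f * f x)"
    by (intro bchoice) blast
  then obtain d where d: "\<And>j. j \<in> J \<Longrightarrow> AE x in M. e j x = (\<Sum>f\<in>B. d j f * f x)" by blast
  obtain \<alpha> where \<alpha>: "\<exists>j\<in>J. \<alpha> j \<noteq> 0" "\<And>f. f \<in> B \<Longrightarrow> (\<Sum>j\<in>J. \<alpha> j * d j f) = 0"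
    by (rule homogeneous_system_solvable[OF B(1) J, of d]) blast
  then obtain j0 where j0: "j0 \<in> J" "\<alpha> j0 \<noteq> 0" by blast
  have "AE x in M. \<forall>j\<in>J. e j x = (\<Sum>f\<in>B. d j f * f x)"
    by (rule AE_finite_allI[OF J(1) d])
  then have "AE x in M. (\<Sum>j\<in>J. \<alpha> j * e j x) = 0"
  proof eventually_elim
    case (elim x)
    then have "(\<Sum>j\<in>J. \<alpha> j * e j x) = (\<Sum>j\<in>J. \<Sum>f\<in>B. \<alpha> j * d j f * f x)"
      by (simp add: sum_distrib_left mult.assoc)
    also have "\<dots> = (\<Sum>f\<in>B. (\<Sum>j\<in>J. \<alpha> j * d j f) * f x)"
      by (subst sum.swap) (simp add: sum_distrib_right)
    also have "\<dots> = 0" using \<alpha>(2) by simp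
    finally show ?case .
  qed
  then have "AE x in Mk j0. (\<Sum>j\<in>J. \<alpha> j * e j x) = 0" using AE_M by blast
  moreover have "AE x in Mk j0. x \<in> \<Delta> j0" by (rule AE_I2) simp
  \<comment> \<open>On the interval with index \<open>j0\<close> all other eigenfunctions vanish,
    and the relation reduces to a nonzero multiple of \<open>e j0\<close>.\<close>
  ultimately have "AE x in Mk j0. e j0 x = 0"
  proof eventually_elim
    case (elim x)
    have "(\<Sum>j\<in>J. \<alpha> j * e j x) = (\<Sum>j\<in>J. if j = j0 then \<alpha> j0 * e j0 x else 0)"
      by (rule sum.cong) (use elim(2) zero_ext_other[of x j0] in \<open>auto simp: e_def\<close>)
    then show ?case using elim(1) j0 J(1) by simp
  qed
  then have "AE x in Mk k. e j0 x = 0" for k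
  proof (cases "k = j0")
    case False
    then show ?thesis using zero_ext_other[of _ k j0] by (auto intro!: AE_I2 simp: e_def)
  qed auto
  then have "AE x in M. e j0 x = 0" using AE_M by blast
  then have "L2_norm M (e j0) = 0"
    unfolding L2_norm_def by (subst integral_eq_zero_AE) auto
  then show False using e0[of j0] by simp
qed

text \<open>The inverses on the single intervals have to be uniformly bounded. Beyond
  \<open>K\<close> the form exceeds Re z + 1, which yields the bound 1; the finitely many remaining
  intervals may contribute any constants.\<close>

lemma resolvent_setI:
  assumes bound: form_bound_tends_to_infinity and ne: "\<And>k. \<not> neumann_eig q (a k) (b k) z"
  shows "z \<in> resolvent_set M T"
proof -
  obtain K where K: "\<And>k y y1. k \<ge> K \<Longrightarrow> form_dom (a k) (b k) y y1 \<Longrightarrow> (Re z + 1) * sq_norm (a k) (b k) y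
      \<le> qform q (a k) (b k) y y1"
    using bound unfolding form_bound_tends_to_infinity_def by blast
  define Q where "Q k C \<longleftrightarrow> C \<ge> 0
    \<and> (\<forall>f u. (f, u) \<in> neumann_realization q (a k) (b k) \<longrightarrow> sq_norm (a k) (b k) f \<le> C * sq_norm (a k) (b k)
        (\<lambda>x. u x - z * f x))
    \<and> (\<forall>g. g \<in> L2 (Mk k) \<longrightarrow> (\<exists>f. (f, \<lambda>x. z * f x + g x) \<in> neumann_realization q (a k) (b k)))" for k C
  have "\<exists>C. Q k C" for k
    unfolding Q_def by (rule neumann_resolvent_L2[OF ab[of k] q_int ne]) blast
  then obtain C where "\<And>k. Q k (C k)" by metis
  then have C0: "\<And>k. C k \<ge> 0"
    and Cb: "\<And>k f u. (f, u) \<in> neumann_realization q (a k) (b k) \<Longrightarrow> sq_norm (a k) (b k) f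
        \<le> C k * sq_norm (a k) (b k) (\<lambda>x. u x - z * f x)"
    and solve: "\<And>k g. g \<in> L2 (Mk k) \<Longrightarrow> \<exists>f. (f, \<lambda>x. z * f x + g x) \<in> neumann_realization q (a k) (b k)"
    unfolding Q_def by blast+
  define D where "D = 1 + (\<Sum>k<K. C k)"
  have D1: "D \<ge> 1" using C0 by (simp add: D_def sum_nonneg)
  have CD: "C k \<le> D" if "k < K" for k
    using member_le_sum[of k "{..<K}" C] that C0 by (simp add: D_def)
  have nsq0: "sq_norm (a k) (b k) f \<ge> 0" if "f \<in> L2 (Mk k)" for f k
    using L2_norm_sq_Ioo[OF that] by (metis zero_le_power2)
  have main: "sq_norm (a k) (b k) f \<le> D * sq_norm (a k) (b k) (\<lambda>x. u x - z * f x)"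
    if fu: "(f, u) \<in> neumann_realization q (a k) (b k)" for k f u
  proof -
    have g: "(\<lambda>x. u x - z * f x) \<in> L2 (Mk k)"
      using neumann_realizationE[OF ab q_int fu] L2_linear[of u "Mk k" f "- z"] by force
    show ?thesis
    proof (cases "k < K")
      case True
      have "C k * sq_norm (a k) (b k) (\<lambda>x. u x - z * f x) \<le> D * sq_norm (a k) (b k) (\<lambda>x. u x - z * f x)"
        by (intro mult_right_mono CD True nsq0 g)
      then show ?thesis using Cb[OF fu] by linarith
    next
      case False
      have "sq_norm (a k) (b k) f \<le> 1 * sq_norm (a k) (b k) (\<lambda>x. u x - z * f x)"
        using neumann_bound_of_form[OF ab q_int fu K, of z] False by simp
      also have "\<dots> \<le> D * sq_norm (a k) (b k) (\<lambda>x. u x - z * f x)"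
        by (intro mult_right_mono D1 nsq0 g)
      finally show ?thesis .
    qed
  qed
  have "L2_norm M f \<le> sqrt D * L2_norm M (\<lambda>x. u x - z * f x)" if fu: "(f, u) \<in> T" for f u
  proof -
    have f: "f \<in> L2 M" and g: "(\<lambda>x. u x - z * f x) \<in> L2 M"
      using fu L2_linear[of u M f "- z"] by (auto simp: neumann_sum_iff)
    have "(L2_norm M f)\<^sup>2 \<le> D * (L2_norm M (\<lambda>x. u x - z * f x))\<^sup>2"
      by (rule sums_le[OF _ L2_norm_sums[OF f] sums_mult[OF L2_norm_sums[OF g]]])
         (use main fu in \<open>auto simp: neumann_sum_iff\<close>)
    then have "sqrt ((L2_norm M f)\<^sup>2) \<le> sqrt (D * (L2_norm M (\<lambda>x. u x - z * f x))\<^sup>2)"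
      by (rule real_sqrt_le_mono)
    then show ?thesis by (simp add: real_sqrt_mult L2_norm_nonneg)
  qed
  then have A: "\<exists>C. \<forall>(f, u)\<in>T. L2_norm M f \<le> C * L2_norm M (\<lambda>x. u x - z * f x)" by blast
  have B: "\<exists>(f, u)\<in>T. AE x in M. u x - z * f x = g x" if g: "g \<in> L2 M" for g
  proof -
    have gk: "g \<in> L2 (Mk k)" for k using g L2_M_iff by blast
    obtain h where h: "\<And>k. (h k, \<lambda>x. z * h k x + g x) \<in> neumann_realization q (a k) (b k)"
      using solve[OF gk] by metis
    \<comment> \<open>Glues the local solutions; the points in no interval form a null set, so the
      value chosen there does not matter.\<close>
    define f where "f x = h (THE k. x \<in> \<Delta> k) x" for x
    have f_eq: "f x = h k x" if "x \<in> \<Delta> k" for x k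
    proof -
      have "(THE k. x \<in> \<Delta> k) = k"
        using that disj by (intro the_equality) blast+
      then show ?thesis by (simp add: f_def)
    qed
    have N: "(f, \<lambda>x. z * f x + g x) \<in> neumann_realization q (a k) (b k)" for k
      by (rule neumann_realization_cong[OF ab _ _ h[of k]]) (use f_eq in auto)
    have fk: "f \<in> L2 (Mk k)" for k
      by (rule neumann_realizationE[OF ab q_int N[of k]])
    have le: "norm (sq_norm (a k) (b k) f) \<le> D * sq_norm (a k) (b k) g" for k
      using main[OF N[of k]] nsq0[OF fk[of k]] by simp
    have "summable (\<lambda>k. sq_norm (a k) (b k) g)" using g L2_M_iff by blast
    then have "summable (\<lambda>k. D * sq_norm (a k) (b k) g)" by (rule summable_mult)
    then have "summable (\<lambda>k. sq_norm (a k) (b k) f)"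
      by (rule summable_comparison_test'[of _ 0]) (rule le)
    then have f: "f \<in> L2 M" unfolding L2_M_iff using fk by blast
    then have "(\<lambda>x. z * f x + g x) \<in> L2 M"
      using L2_linear[OF g f, of z] by (simp add: add.commute)
    then have "(f, \<lambda>x. z * f x + g x) \<in> T" using f N by (simp add: neumann_sum_iff)
    then show ?thesis by (intro bexI[of _ "(f, \<lambda>x. z * f x + g x)"]) auto
  qed
  show ?thesis unfolding resolvent_set_def using A B by blast
qed

text \<open>Every point of the spectrum is an eigenvalue on some interval, and within distance 1 of
  z only the intervals below \<open>K\<close> have eigenvalues. Each of the three properties is thus
  inherited from finitely many single intervals.\<close>

lemma form_bound_imp_discrete:
  assumes bound: form_bound_tends_to_infinity
  shows "purely_discrete_spectrum M T"
  unfolding purely_discrete_spectrum_def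
proof
  fix z assume z: "z \<in> spectrum M T"
  have spec: "\<exists>k. neumann_eig q (a k) (b k) v" if "v \<in> spectrum M T" for v
    using that resolvent_setI[OF bound, of v] unfolding spectrum_def by auto
  obtain K where K: "\<And>k y y1. k \<ge> K \<Longrightarrow> form_dom (a k) (b k) y y1 \<Longrightarrow> (Re z + 1) * sq_norm (a k) (b k) y
      \<le> qform q (a k) (b k) y y1"
    using bound unfolding form_bound_tends_to_infinity_def by blast
  have far: "\<not> neumann_eig q (a k) (b k) v" if "k \<ge> K" "cmod (v - z) < 1" for k v
  proof
    assume "neumann_eig q (a k) (b k) v"
    then have "Re z + 1 \<le> Re v"
      using eigenvalue_ge_form_bound[OF ab q_int _ K[OF that(1)]] by blast
    then show False using that(2) abs_Re_le_cmod[of "v - z"] by simp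
  qed
  have "\<exists>\<delta>>0. \<forall>v. v \<noteq> z \<longrightarrow> cmod (v - z) < \<delta> \<longrightarrow> \<not> neumann_eig q (a k) (b k) v" for k
    using not_eigenvalue_near[OF ab q_int] by metis
  then obtain \<delta> where \<delta>: "\<And>k. \<delta> k > 0" "\<And>k v. v \<noteq> z \<Longrightarrow> cmod (v - z) < \<delta> k \<Longrightarrow> \<not> neumann_eig q (a k) (b k) v"
    by metis
  \<comment> \<open>The entry 1 keeps away all intervals from \<open>K\<close> on, and makes the
    minimum meaningful when K = 0.\<close>
  define \<epsilon> where "\<epsilon> = Min (insert 1 (\<delta> ` {..<K}))"
  have \<epsilon>: "\<epsilon> > 0" "\<epsilon> \<le> 1" "\<And>k. k < K \<Longrightarrow> \<epsilon> \<le> \<delta> k"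
    using \<delta>(1) by (auto simp: \<epsilon>_def)
  have "z isolated_in spectrum M T"
    unfolding isolated_in_dist_Ex_iff
  proof (intro conjI z exI[of _ \<epsilon>] \<epsilon>(1) ballI impI)
    fix v assume v: "v \<in> spectrum M T" "dist z v < \<epsilon>"
    obtain k where k: "neumann_eig q (a k) (b k) v" using spec[OF v(1)] by blast
    have vz: "cmod (v - z) < \<epsilon>" using v(2) by (simp add: dist_norm norm_minus_commute)
    have "k < K" using far[of k v] k vz \<epsilon>(2) by force
    then show "v = z" using \<delta>(2)[of v k] \<epsilon>(3)[of k] vz k by fastforce
  qed
  moreover have "eigenvalue M T z"
  proof -
    obtain k where "neumann_eig q (a k) (b k) z" using spec[OF z] by blast
    then obtain c c1 where c: "neumann_sol (a k) (b k) c c1 (\<lambda>x. (of_real (q x) - z) * c x)" "c (a k) = 1"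
      unfolding neumann_eig_def by blast
    note E = zero_ext_eigenfunction[OF c]
    have "zero_ext k c \<in> eigenspace M T z" using E(1) unfolding eigenspace_def by auto
    moreover have "\<not> (AE x in M. zero_ext k c x = 0)"
    proof
      assume "AE x in M. zero_ext k c x = 0"
      then have "L2_norm M (zero_ext k c) = 0" unfolding L2_norm_def by (subst integral_eq_zero_AE) auto
      then show False using E(2) by simp
    qed
    ultimately show ?thesis unfolding eigenvalue_def by blast
  qed
  moreover have "finite_multiplicity M T z"
  proof -
    define I where "I = {k. neumann_eig q (a k) (b k) z}"
    have "I \<subseteq> {..<K}" using far[of _ z] by (auto simp: I_def not_le[symmetric])
    then have fI: "finite I" by (rule finite_subset) simp
    have "\<exists>c c1. neumann_sol (a k) (b k) c c1 (\<lambda>x. (of_real (q x) - z) * c x) \<and> c (a k) = 1" if "k \<in> I" for k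
      using that unfolding I_def neumann_eig_def by blast
    then obtain c c1 where c: "\<And>k. k \<in> I \<Longrightarrow> neumann_sol (a k) (b k) (c k) (c1 k) (\<lambda>x. (of_real (q x) - z) * c k x)"
      "\<And>k. k \<in> I \<Longrightarrow> c k (a k) = 1" by metis
    define E where "E k = zero_ext k (c k)" for k
    have E: "(E k, \<lambda>x. z * E k x) \<in> T" "L2_norm M (E k) > 0" if "k \<in> I" for k
      using zero_ext_eigenfunction[OF c[OF that]] by (simp_all add: E_def)
    have inj: "inj_on E I"
    proof (rule inj_onI)
      fix i j assume ij: "i \<in> I" "j \<in> I" "E i = E j"
      show "i = j"
      proof (rule ccontr)
        assume "i \<noteq> j"
        have "c i x = 0" if "x \<in> \<Delta> i" for x
          using ij(3) zero_ext_same[OF that, of "c i"] zero_ext_other[OF that \<open>i \<noteq> j\<close>, of "c j"] by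
              (simp add: E_def)
        then have "E i = (\<lambda>_. 0)" by (auto simp: E_def zero_ext_def)
        then show False using E(2)[OF ij(1)] by (simp add: L2_norm_def)
      qed
    qed
    show ?thesis unfolding finite_multiplicity_def
    proof (intro exI[of _ "E ` I"] conjI ballI)
      show "finite (E ` I)" using fI by simp
      show "E ` I \<subseteq> L2 M" using E(1) neumann_sum_iff by blast
      fix f assume "f \<in> eigenspace M T z"
      then obtain u where fu: "(f, u) \<in> T" "AE x in M. u x = z * f x" unfolding eigenspace_def by blast
      have fk: "(f, u) \<in> neumann_realization q (a k) (b k)" and uk: "AE x in Mk k. u x = z * f x" for k
        using fu by (auto simp: neumann_sum_iff AE_M)
      have "\<exists>\<alpha>. AE x in Mk k. f x = \<alpha> * c k x" if "k \<in> I" for k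
        using eigenfunction_unique(2)[OF ab q_int fk uk c(1)[OF that] c(2)[OF that]] .
      then have "\<exists>\<alpha>. \<forall>k\<in>I. AE x in Mk k. f x = \<alpha> k * c k x" by (intro bchoice) blast
      then obtain \<alpha> where \<alpha>: "\<And>k. k \<in> I \<Longrightarrow> AE x in Mk k. f x = \<alpha> k * c k x" by blast
      have "AE x in M. f x = (\<Sum>k\<in>I. \<alpha> k * E k x)"
        unfolding AE_M
      proof
        fix k
        have mem: "AE x in Mk k. x \<in> \<Delta> k" by (rule AE_I2) simp
        have sum: "(\<Sum>j\<in>I. \<alpha> j * E j x) = (if k \<in> I then \<alpha> k * c k x else 0)" if "x \<in> \<Delta> k" for x
        proof -
          have "(\<Sum>j\<in>I. \<alpha> j * E j x) = (\<Sum>j\<in>I. if j = k then \<alpha> k * c k x else 0)"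
            by (rule sum.cong) (use that zero_ext_other[OF that] zero_ext_same[OF that] in \<open>auto simp: E_def\<close>)
          then show ?thesis using fI by simp
        qed
        show "AE x in Mk k. f x = (\<Sum>k\<in>I. \<alpha> k * E k x)"
        proof (cases "k \<in> I")
          case True
          from \<alpha>[OF True] mem show ?thesis by eventually_elim (simp add: sum True)
        next
          case False
          then have "AE x in Mk k. f x = 0"
            using eigenfunction_unique(1)[OF ab q_int fk uk] by (simp add: I_def)
          then show ?thesis using mem by eventually_elim (simp add: sum False)
        qed
      qed
      \<comment> \<open>The definition of finite multiplicity indexes coefficients by functions;
        injectivity of \<open>E\<close> carries them back to interval indices.\<close>
      moreover have "(\<Sum>e\<in>E ` I. \<alpha> (inv_into I E e) * e x) = (\<Sum>k\<in>I. \<alpha> k * E k x)" for x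
        using inj by (simp add: sum.reindex)
      ultimately show "\<exists>c. AE x in M. f x = (\<Sum>e\<in>E ` I. c e * e x)"
        by (intro exI[of _ "\<lambda>e. \<alpha> (inv_into I E e)"]) simp
    qed
  qed
  ultimately show "z isolated_in spectrum M T \<and> eigenvalue M T z \<and> finite_multiplicity M T z" by blast
qed

end

subsection \<open>Molchanov's condition\<close>

text \<open>|y(s)|^2 \<le> 2 |y(t)|^2 + 2 (d - c) \<integral> |y'|^2 is averaged over t with weight
  p and then integrated over s. The length that the second integration produces is cancelled by the
  total weight, which is at least \<rho> (d - c). Only the mean of p enters, not its
  distribution.\<close>

lemma piece_estimate:
  fixes p :: "real \<Rightarrow> real"
  assumes y: "form_dom a b y y1" and sub: "a \<le> c" "c < d" "d \<le> b"
    and p: "p absolutely_integrable_on {a..b}" "\<And>x. p x \<ge> 0" and \<rho>: "\<rho> > 0" "\<rho> * (d - c) \<le> integral {c..d} p"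
  shows "sq_norm c d y \<le> 2 / \<rho> * integral {c..d} (\<lambda>x. p x * (cmod (y x))\<^sup>2)
      + 2 * (d - c)\<^sup>2 * integral {c..d} (\<lambda>x. (cmod (y1 x))\<^sup>2)"
proof -
  define Q where "Q = integral {c..d} p"
  define W where "W = integral {c..d} (\<lambda>x. p x * (cmod (y x))\<^sup>2)"
  define S where "S = integral {c..d} (\<lambda>x. (cmod (y1 x))\<^sup>2)"
  have Q: "Q \<ge> \<rho> * (d - c)" "Q > 0"
  proof -
    show "Q \<ge> \<rho> * (d - c)" using \<rho>(2) by (simp add: Q_def)
    moreover have "\<rho> * (d - c) > 0" using \<rho>(1) sub by simp
    ultimately show "Q > 0" by linarith
  qed
  have yc: "continuous_on {c..d} y" by (rule continuous_on_subset[OF form_dom_continuous[OF y]]) (use sub in auto)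
  have pc: "p absolutely_integrable_on {c..d}" by (rule absolutely_integrable_on_subinterval[OF p(1)])
      (use sub in auto)
  note Wi = weighted_square_integrable[OF pc yc]
  have W: "W \<ge> 0" unfolding W_def by (intro Henstock_Kurzweil_Integration.integral_nonneg Wi
      mult_nonneg_nonneg p(2)) auto
  have pt: "(cmod (y s))\<^sup>2 \<le> 2 / Q * W + 2 * (d - c) * S" if s: "s \<in> {c..d}" for s
  proof -
    have "(cmod (y s))\<^sup>2 * Q = integral {c..d} (\<lambda>t. (cmod (y s))\<^sup>2 * p t)" by (simp add: Q_def)
    also have "\<dots> \<le> integral {c..d} (\<lambda>t. 2 * (p t * (cmod (y t))\<^sup>2) + 2 * ((d - c) * S) * p t)"
    proof (rule integral_le)
      show "(\<lambda>t. (cmod (y s))\<^sup>2 * p t) integrable_on {c..d}"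
        by (intro integrable_on_mult_right absolutely_integrable_imp_integrable_on pc)
      show "(\<lambda>t. 2 * (p t * (cmod (y t))\<^sup>2) + 2 * ((d - c) * S) * p t) integrable_on {c..d}"
        by (intro integrable_add integrable_on_mult_right absolutely_integrable_imp_integrable_on[OF pc] Wi)
      fix t assume t: "t \<in> {c..d}"
      have "(cmod (y s))\<^sup>2 * p t \<le> (2 * (cmod (y t))\<^sup>2 + 2 * ((d - c) * S)) * p t"
        unfolding S_def using sub by (intro mult_right_mono p(2)
            form_dom_square_diff[OF y sub(1) _ sub(3) s t]) auto
      then show "(cmod (y s))\<^sup>2 * p t \<le> 2 * (p t * (cmod (y t))\<^sup>2) + 2 * ((d - c) * S) * p t"
        by (simp add: algebra_simps)
    qed
    also have "\<dots> = 2 * W + 2 * ((d - c) * S) * Q"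
      unfolding Henstock_Kurzweil_Integration.integral_add[OF integrable_on_mult_right[OF Wi]
          integrable_on_mult_right[OF absolutely_integrable_imp_integrable_on[OF pc]]]
      by (simp add: W_def Q_def)
    finally have "(cmod (y s))\<^sup>2 \<le> (2 * W + 2 * ((d - c) * S) * Q) / Q"
      using Q(2) by (simp only: pos_le_divide_eq)
    also have "\<dots> = 2 / Q * W + 2 * (d - c) * S" using Q(2) by (simp add: add_divide_distrib)
    finally show ?thesis .
  qed
  have "sq_norm c d y \<le> integral {c..d} (\<lambda>_. 2 / Q * W + 2 * (d - c) * S)"
    unfolding sq_norm_def by (rule integral_le[OF continuous_square_integrable[OF yc] integrable_const_ivl pt])
  also have "\<dots> = 2 * (d - c) / Q * W + 2 * (d - c)\<^sup>2 * S"
    using sub by (simp add: algebra_simps power2_eq_square)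
  also have "\<dots> \<le> 2 / \<rho> * W + 2 * (d - c)\<^sup>2 * S"
  proof (intro add_right_mono mult_right_mono W)
    show "2 * (d - c) / Q \<le> 2 / \<rho>" using Q \<rho>(1) by (simp add: field_simps)
  qed
  finally show ?thesis by (simp add: W_def S_def)
qed

text \<open>Pieces of length \<epsilon>/2 are cut off on the left as long as more than \<epsilon>
  remains; what is left over is then never shorter than \<epsilon>/2. Pieces must not become too
  short, since the condition on q fixes the length of the windows. \<open>n\<close> counts the
  cuts.\<close>

lemma split_estimate:
  fixes G :: "real \<Rightarrow> real"
  assumes G: "G integrable_on {a..b}" and \<epsilon>: "\<epsilon> > 0"
    and short: "\<And>c d. a \<le> c \<Longrightarrow> d \<le> b \<Longrightarrow> \<epsilon> / 2 \<le> d - c \<Longrightarrow> d - c \<le> \<epsilon> \<Longrightarrow> integral {c..d} G \<le> 0"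
    and "a \<le> c" "\<epsilon> / 2 \<le> b - c"
  shows "integral {c..b} G \<le> 0"
proof -
  obtain n where "(b - c) / (\<epsilon> / 2) \<le> real n" using real_arch_simple by blast
  then have "b - c \<le> real n * (\<epsilon> / 2)" using \<epsilon> by (simp add: field_simps)
  then show ?thesis using assms(4,5)
  proof (induction n arbitrary: c)
    case 0
    then show ?case using \<epsilon> by simp
  next
    case (Suc n)
    show ?case
    proof (cases "b - c \<le> \<epsilon>")
      case True
      then show ?thesis using Suc.prems by (intro short) auto
    next
      case False
      have "integral {c..c + \<epsilon> / 2} G \<le> 0" using False Suc.prems \<epsilon> by (intro short) auto
      moreover have "integral {c + \<epsilon> / 2..b} G \<le> 0"
        using False Suc.prems \<epsilon> by (intro Suc.IH) (auto simp: algebra_simps)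
      moreover have "integral {c..c + \<epsilon> / 2} G + integral {c + \<epsilon> / 2..b} G = integral {c..b} G"
        by (rule Henstock_Kurzweil_Integration.integral_combine)
           (use False Suc.prems \<epsilon> in \<open>auto intro: integrable_on_subinterval[OF G]\<close>)
      ultimately show ?thesis by linarith
    qed
  qed
qed

lemma absolutely_integrable_superset:
  fixes h :: "real \<Rightarrow> real"
  assumes "h absolutely_integrable_on S" "S \<subseteq> U" "\<And>x. x \<notin> S \<Longrightarrow> h x = 0"
  shows "h absolutely_integrable_on U"
proof (rule absolutely_integrable_spike_set[OF assms(1)])
  have "{x \<in> S - U. h x \<noteq> 0} = {}" "{x \<in> U - S. h x \<noteq> 0} = {}" using assms by auto
  then show "negligible {x \<in> S - U. h x \<noteq> 0}" "negligible {x \<in> U - S. h x \<noteq> 0}"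
    by (simp_all only: negligible_empty)
qed

locale bounded_family = interval_family +
  fixes C D :: real
  assumes D: "D > 0" "b k - a k \<le> D"
    and C: "C \<ge> 0" "integral {a k..b k} (\<lambda>x. (\<bar>q x\<bar> - q x) / 2) \<le> C * (b k - a k)"
    and q_loc: "q absolutely_integrable_on {0..c}"
begin

lemma q_Icc: "0 \<le> c \<Longrightarrow> q absolutely_integrable_on {c..d}"
  by (rule absolutely_integrable_on_subinterval[OF q_loc[of d]]) auto

lemma form_lower:
  obtains l0 where "\<And>k y y1. form_dom (a k) (b k) y y1 \<Longrightarrow> l0 * sq_norm (a k) (b k) y \<le> qform q (a k) (b k) y y1"
proof (rule qform_lower_bound[OF C(1) D(1)])
  fix C' :: real
  assume bound: "\<And>a b q y y1. a < b \<Longrightarrow> b - a \<le> D \<Longrightarrow> q absolutely_integrable_on {a..b} \<Longrightarrow>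
     integral {a..b} (\<lambda>x. (\<bar>q x\<bar> - q x) / 2) \<le> C * (b - a) \<Longrightarrow> form_dom a b y y1 \<Longrightarrow>
     1 / 2 * integral {a..b} (\<lambda>x. (cmod (y1 x))\<^sup>2) + integral {a..b} (\<lambda>x. (\<bar>q x\<bar>
         + q x) / 2 * (cmod (y x))\<^sup>2) - C' * sq_norm a b y
       \<le> qform q a b y y1"
  show thesis
  proof (rule that[of "- C'"])
    fix k y y1 assume y: "form_dom (a k) (b k) y y1"
    have "0 \<le> integral {a k..b k} (\<lambda>x. (cmod (y1 x))\<^sup>2)"
      by (rule Henstock_Kurzweil_Integration.integral_nonneg) (use y in \<open>auto simp: form_dom_def\<close>)
    moreover have "0 \<le> integral {a k..b k} (\<lambda>x. (\<bar>q x\<bar> + q x) / 2 * (cmod (y x))\<^sup>2)"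
      by (intro Henstock_Kurzweil_Integration.integral_nonneg weighted_square_integrable
          negative_part_integrable q_int form_dom_continuous[OF y]) auto
    ultimately show "- C' * sq_norm (a k) (b k) y \<le> qform q (a k) (b k) y y1"
      using bound[OF ab D(2) q_int C(2) y] by linarith
  qed
qed

lemma mean_tends_to_infinity:
  assumes bound: form_bound_tends_to_infinity
  shows "filterlim (\<lambda>k. 1 / (b k - a k) * integral {a k..b k} q) at_top sequentially"
  unfolding filterlim_at_top eventually_sequentially
proof
  fix Z
  obtain K where K: "\<And>k y y1. k \<ge> K \<Longrightarrow> form_dom (a k) (b k) y y1 \<Longrightarrow> Z * sq_norm (a k) (b k) y
      \<le> qform q (a k) (b k) y y1"
    using bound unfolding form_bound_tends_to_infinity_def by blast
  have "Z \<le> 1 / (b k - a k) * integral {a k..b k} q" if "k \<ge> K" for k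
  proof -
    have "form_dom (a k) (b k) (\<lambda>_. 1) (\<lambda>_. 0)" by (simp add: form_dom_def AC_const integrable_0)
    from K[OF that this] show ?thesis using ab[of k] by (simp add: sq_norm_def qform_def field_simps)
  qed
  then show "\<exists>N. \<forall>n\<ge>N. Z \<le> 1 / (b n - a n) * integral {a n..b n} q" by blast
qed

text \<open>The hypothesis controls q_- only on whole intervals, whereas the window may cut them.
  Summing over all intervals that meet the window gives a bound independent of x; x > D keeps the
  enlarged window in the half-line.\<close>

lemma negative_part_local_bound:
  assumes "x > D" "\<epsilon> > 0"
  shows "integral {x..x + \<epsilon>} (\<lambda>t. (\<bar>q t\<bar> - q t) / 2) \<le> C * (\<epsilon> + 2 * D)"
proof -
  define qm where "qm t = (\<bar>q t\<bar> - q t) / 2" for t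
  define g where "g t = (if t \<in> {x..x + \<epsilon>} then qm t else 0)" for t
  \<comment> \<open>An interval that meets the window [x, x + \<epsilon>] lies in this enlargement
    by \<open>D\<close>, where its share C (b_k - a_k) is just the integral of
    \<open>h\<close>.\<close>
  define h where "h t = (if t \<in> {x - D..x + \<epsilon> + D} then C else 0)" for t
  have qm0: "qm t \<ge> 0" for t by (simp add: qm_def)
  have qmi: "qm absolutely_integrable_on {c..d}" if "0 \<le> c" for c d
    unfolding qm_def by (rule negative_part_integrable(1)[OF q_Icc[OF that]])
  have gi: "g absolutely_integrable_on {0<..}"
  proof (rule absolutely_integrable_superset)
    show "g absolutely_integrable_on {x..x + \<epsilon>}"
      by (rule absolutely_integrable_spike[OF qmi negligible_empty]) (use assms D in \<open>auto simp: g_def\<close>)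
  qed (use assms D in \<open>auto simp: g_def\<close>)
  have hi: "h absolutely_integrable_on {0<..}"
  proof (rule absolutely_integrable_superset)
    show "h absolutely_integrable_on {x - D..x + \<epsilon> + D}"
      by (rule absolutely_integrable_spike[OF absolutely_integrable_continuous_real[OF
          continuous_on_const[of _ C]] negligible_empty])
         (auto simp: h_def)
  qed (use assms D in \<open>auto simp: h_def\<close>)
  have Ii: "integral {0<..} g = integral {x..x + \<epsilon>} qm"
  proof -
    have "integral {0<..} g = integral {x..x + \<epsilon>} g"
      by (rule integral_supp) (use assms D in \<open>auto simp: g_def split: if_splits\<close>)
    also have "\<dots> = integral {x..x + \<epsilon>} qm" by (rule integral_cong) (simp add: g_def)
    finally show ?thesis .
  qed
  have Ih: "integral {0<..} h = C * (\<epsilon> + 2 * D)"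
  proof -
    have "integral {0<..} h = integral {x - D..x + \<epsilon> + D} h"
      by (rule integral_supp) (use assms D in \<open>auto simp: h_def split: if_splits\<close>)
    also have "\<dots> = integral {x - D..x + \<epsilon> + D} (\<lambda>_. C)" by (rule integral_cong) (simp add: h_def)
    also have "\<dots> = C * (\<epsilon> + 2 * D)" using assms D(1) by (simp add: algebra_simps)
    finally show ?thesis .
  qed
  have "integral {a k..b k} g \<le> integral {a k..b k} h" for k
  proof (cases "{a k..b k} \<inter> {x..x + \<epsilon>} = {}")
    case True
    have "integral {a k..b k} g = integral {a k..b k} (\<lambda>_. 0)"
      by (rule integral_cong) (use True in \<open>auto simp: g_def\<close>)
    also have "\<dots> \<le> integral {a k..b k} h"
    proof (rule integral_le)
      show "h integrable_on {a k..b k}"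
        using absolutely_integrable_imp_integrable_on[OF set_integrable_subset[OF hi _ sub[of k]]] by
            (simp add: integrable_on_open_interval_real)
    qed (use C(1) in \<open>auto simp: h_def\<close>)
    finally show ?thesis .
  next
    case False
    then have sub': "{a k..b k} \<subseteq> {x - D..x + \<epsilon> + D}" using D(2)[of k] by fastforce
    have "integral {a k..b k} g \<le> integral {a k..b k} qm"
    proof (rule integral_le)
      show "g integrable_on {a k..b k}"
        using absolutely_integrable_imp_integrable_on[OF set_integrable_subset[OF gi _ sub[of k]]] by
            (simp add: integrable_on_open_interval_real)
      show "qm integrable_on {a k..b k}" by (rule absolutely_integrable_imp_integrable_on[OF qmi[OF a_nonneg]])
    qed (auto simp: g_def qm0)
    also have "\<dots> \<le> C * (b k - a k)" using C(2)[of k] unfolding qm_def .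
    also have "\<dots> = integral {a k..b k} (\<lambda>_. C)" using ab[of k] by simp
    also have "\<dots> = integral {a k..b k} h" by (rule integral_cong) (use sub' in \<open>auto simp: h_def\<close>)
    finally show ?thesis .
  qed
  then have "integral {0<..} g \<le> integral {0<..} h"
    by (rule sums_le[OF _ integral_sums[OF gi] integral_sums[OF hi]])
  then show ?thesis unfolding Ii Ih qm_def .
qed

text \<open>The form bounds at the restrictions of one bump are added over all intervals, and the
  pieces recombine to integrals over [x, x + \<epsilon>]. The bump need not vanish at the points of
  \<Sigma> that it covers.\<close>

lemma molchanov_condition:
  assumes bound: form_bound_tends_to_infinity and \<epsilon>: "\<epsilon> > 0"
  shows "filterlim (\<lambda>x. integral {x..x + \<epsilon>} q) at_top at_top"
  unfolding filterlim_at_top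
proof
  fix Z
  \<comment> \<open>The bump at the origin. Its integrals \<open>I\<close> and \<open>J\<close>
    agree with those of all translates, so that \<open>l\<close> can be fixed before x.\<close>
  define \<psi> where "\<psi> = bump_term 0 \<epsilon> 1 1 0"
  have \<psi>s: "smooth \<psi>" unfolding \<psi>_def by (rule smooth_bump_term) simp
  have \<psi>c: "continuous_on A \<psi>" "continuous_on A (deriv \<psi>)" for A
    using smooth_continuous[OF \<psi>s] smooth_continuous[OF smooth_deriv[OF \<psi>s]] by blast+
  define I where "I = integral {0..\<epsilon>} (\<lambda>t. (\<psi> t)\<^sup>2)"
  define J where "J = integral {0..\<epsilon>} (\<lambda>t. (deriv \<psi> t)\<^sup>2)"
  have I: "I > 0"
  proof -
    have c: "continuous_on {0..\<epsilon>} (\<lambda>t. (\<psi> t)\<^sup>2)" by (intro continuous_intros \<psi>c)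
    have "\<psi> (\<epsilon> / 2) \<noteq> 0" using \<epsilon> by (simp add: \<psi>_def bump_term_def)
    then have "I \<noteq> 0" unfolding I_def using integral_eq_0_iff[OF c \<epsilon>] \<epsilon> by force
    moreover have "I \<ge> 0" unfolding I_def
      by (intro Henstock_Kurzweil_Integration.integral_nonneg integrable_continuous_real c) auto
    ultimately show ?thesis by linarith
  qed
  \<comment> \<open>Chosen so that l I - J - C (\<epsilon> + 2 D), the lower bound obtained in the
    end for \<integral> q, equals \<open>Z\<close>.\<close>
  define l where "l = (Z + J + C * (\<epsilon> + 2 * D)) / I"
  have l: "l * I = Z + J + C * (\<epsilon> + 2 * D)" using I by (simp add: l_def)
  obtain K where K: "\<And>k y y1. k \<ge> K \<Longrightarrow> form_dom (a k) (b k) y y1 \<Longrightarrow> l * sq_norm (a k) (b k) y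
      \<le> qform q (a k) (b k) y y1"
    using bound unfolding form_bound_tends_to_infinity_def by blast
  \<comment> \<open>To the right of \<open>X\<close> the bump misses the first \<open>K\<close>
    intervals, for which no form bound is available; the entry D + 1 ensures x > D.\<close>
  define X where "X = Max (insert (D + 1) (b ` {..<K}))"
  have X: "D + 1 \<le> X" "\<And>k. k < K \<Longrightarrow> b k \<le> X" by (auto simp: X_def)
  have "Z \<le> integral {x..x + \<epsilon>} q" if x: "x \<ge> X" for x
  proof -
    have x0: "x > D" "x > 0" using x X(1) D(1) by auto
    define \<phi> where "\<phi> = bump_term x (x + \<epsilon>) 1 1 0"
    have \<phi>s: "smooth \<phi>" unfolding \<phi>_def by (rule smooth_bump_term) simp
    have \<phi>c: "continuous_on A \<phi>" "continuous_on A (deriv \<phi>)" for A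
      using smooth_continuous[OF \<phi>s] smooth_continuous[OF smooth_deriv[OF \<phi>s]] by blast+
    have \<phi>\<psi>: "\<phi> (t + x) = \<psi> t" for t by (simp add: \<phi>_def \<psi>_def bump_term_def algebra_simps)
    have d\<phi>\<psi>: "deriv \<phi> (t + x) = deriv \<psi> t" for t
    proof -
      have "((\<lambda>t. \<phi> (t + x)) has_real_derivative deriv \<phi> (t + x)) (at t)"
        using smooth_DERIV[OF \<phi>s, of "t + x"] by (simp add: DERIV_shift)
      then show ?thesis unfolding \<phi>\<psi> by (simp add: DERIV_imp_deriv)
    qed
    have \<phi>_out: "\<phi> t = 0" "deriv \<phi> t = 0" if "t \<notin> {x<..<x + \<epsilon>}" for t
    proof -
      show "\<phi> t = 0" using that by (auto simp: \<phi>_def bump_term_def)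
      have "(\<phi> has_real_derivative 0) (at t)"
        using bump_term_DERIV[of 1 x "x + \<epsilon>" 1 0 t] that unfolding \<phi>_def by (auto simp: bump_term_def)
      then show "deriv \<phi> t = 0" by (rule DERIV_imp_deriv)
    qed
    have \<phi>01: "0 \<le> \<phi> t" "\<phi> t \<le> 1" for t by (auto simp: \<phi>_def bump_term_def)
    \<comment> \<open>Integrand of the form shifted by \<open>l\<close>. Its integral over each
      interval is nonnegative: zero for k < K, and by the form bound otherwise.\<close>
    define H where "H t = (deriv \<phi> t)\<^sup>2 + q t * (\<phi> t)\<^sup>2 - l * (\<phi> t)\<^sup>2" for t
    have q\<phi>: "(\<lambda>t. q t * (\<phi> t)\<^sup>2) absolutely_integrable_on {c..d}" if "0 \<le> c" for c d
      by (intro absolutely_integrable_mult_continuous q_Icc that continuous_intros \<phi>c)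
    have Hc: "H absolutely_integrable_on {c..d}" if "0 \<le> c" for c d
      unfolding H_def
      by (intro set_integral_diff(1) set_integral_add(1) q\<phi> that absolutely_integrable_continuous_real
          continuous_intros \<phi>c)
    have Hout: "H t = 0" if "t \<notin> {x..x + \<epsilon>}" for t
      using \<phi>_out[of t] that by (auto simp: H_def)
    have Hi: "H absolutely_integrable_on {0<..}"
      by (rule absolutely_integrable_superset[where S = "{x..x + \<epsilon>}"]) (use Hc[of x "x + \<epsilon>"] x0 Hout in auto)
    have "0 \<le> integral {a k..b k} H" for k
    proof (cases "k < K")
      case True
      have "integral {a k..b k} H = integral {a k..b k} (\<lambda>_. 0)"
        by (rule integral_cong) (use \<phi>_out X(2)[OF True] x in \<open>auto simp: H_def\<close>)
      then show ?thesis by simp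
    next
      case False
      have c\<phi>: "continuous_on {a k..b k} (\<lambda>t. complex_of_real (deriv \<phi> t))" by (intro continuous_intros \<phi>c)
      have fd: "form_dom (a k) (b k) (\<lambda>t. of_real (\<phi> t)) (\<lambda>t. of_real (deriv \<phi> t))"
        unfolding form_dom_def using AC_of_C1[OF \<phi>s less_imp_le[OF ab]] continuous_square_integrable[OF c\<phi>] by blast
      have "l * sq_norm (a k) (b k) (\<lambda>t. of_real (\<phi> t)) \<le> qform q (a k) (b k) (\<lambda>t. of_real (\<phi> t))
          (\<lambda>t. of_real (deriv \<phi> t))"
        using K[OF _ fd] False by simp
      moreover have "integral {a k..b k} H = qform (\<lambda>t. q t - l) (a k) (b k) (\<lambda>t. of_real (\<phi> t))
          (\<lambda>t. of_real (deriv \<phi> t))"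
        unfolding qform_def by (rule integral_cong) (simp add: H_def algebra_simps)
      ultimately show ?thesis using qform_shift[OF fd q_int] by simp
    qed
    then have "0 \<le> integral {0<..} H"
      by (rule sums_le[OF _ sums_zero integral_sums[OF Hi]])
    also have "integral {0<..} H = integral {x..x + \<epsilon>} H"
      by (rule integral_supp) (use x0 Hout in auto)
    also have "\<dots> = integral {x..x + \<epsilon>} (\<lambda>t. (deriv \<phi> t)\<^sup>2) + integral {x..x + \<epsilon>}
        (\<lambda>t. q t * (\<phi> t)\<^sup>2) - l * integral {x..x + \<epsilon>} (\<lambda>t. (\<phi> t)\<^sup>2)"
    proof -
      have i1: "(\<lambda>t. (deriv \<phi> t)\<^sup>2) integrable_on {x..x + \<epsilon>}" and i3: "(\<lambda>t. (\<phi> t)\<^sup>2) integrable_on {x..x + \<epsilon>}"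
        by (intro integrable_continuous_real continuous_intros \<phi>c)+
      have i2: "(\<lambda>t. q t * (\<phi> t)\<^sup>2) integrable_on {x..x + \<epsilon>}"
        using x0 by (intro absolutely_integrable_imp_integrable_on q\<phi>) auto
      show ?thesis
        unfolding H_def Henstock_Kurzweil_Integration.integral_diff[OF integrable_add[OF i1 i2]
            integrable_on_mult_right[OF i3]]
          Henstock_Kurzweil_Integration.integral_add[OF i1 i2] by simp
    qed
    also have "integral {x..x + \<epsilon>} (\<lambda>t. (deriv \<phi> t)\<^sup>2) = J"
      using integral_shift[of 0 x \<epsilon> "\<lambda>t. (deriv \<phi> t)\<^sup>2"] \<phi>c
      by (simp add: J_def o_def d\<phi>\<psi> add.commute continuous_intros)
    also have "integral {x..x + \<epsilon>} (\<lambda>t. (\<phi> t)\<^sup>2) = I"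
      using integral_shift[of 0 x \<epsilon> "\<lambda>t. (\<phi> t)\<^sup>2"] \<phi>c
      by (simp add: I_def o_def \<phi>\<psi> add.commute continuous_intros)
    finally have 1: "Z + C * (\<epsilon> + 2 * D) \<le> integral {x..x + \<epsilon>} (\<lambda>t. q t * (\<phi> t)\<^sup>2)"
      unfolding l by linarith
    have qx: "q absolutely_integrable_on {x..x + \<epsilon>}" using x0 by (intro q_Icc) auto
    \<comment> \<open>Since 0 \<le> \<phi> \<le> 1, one has q \<phi>^2 \<le> q_+ = q + q_-; the
      local bound on q_- then leads back to q itself.\<close>
    have "integral {x..x + \<epsilon>} (\<lambda>t. q t * (\<phi> t)\<^sup>2) \<le> integral {x..x + \<epsilon>} (\<lambda>t. q t + (\<bar>q t\<bar> - q t) / 2)"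
    proof (rule integral_le)
      show "(\<lambda>t. q t * (\<phi> t)\<^sup>2) integrable_on {x..x + \<epsilon>}" using x0
          by (intro absolutely_integrable_imp_integrable_on q\<phi>) auto
      show "(\<lambda>t. q t + (\<bar>q t\<bar> - q t) / 2) integrable_on {x..x + \<epsilon>}"
        by (intro integrable_add absolutely_integrable_imp_integrable_on qx negative_part_integrable(1))
      fix t
      have \<phi>2: "0 \<le> (\<phi> t)\<^sup>2" "(\<phi> t)\<^sup>2 \<le> 1" using \<phi>01[of t] by (auto simp: power_le_one)
      show "q t * (\<phi> t)\<^sup>2 \<le> q t + (\<bar>q t\<bar> - q t) / 2"
      proof (cases "q t \<ge> 0")
        case True
        then have "q t * (\<phi> t)\<^sup>2 \<le> q t * 1" using \<phi>2 by (intro mult_left_mono) auto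
        then show ?thesis using True by simp
      next
        case False
        then have "q t * (\<phi> t)\<^sup>2 \<le> 0" using \<phi>2 by (intro mult_nonpos_nonneg) auto
        then show ?thesis using False by simp
      qed
    qed
    also have "\<dots> = integral {x..x + \<epsilon>} q + integral {x..x + \<epsilon>} (\<lambda>t. (\<bar>q t\<bar> - q t) / 2)"
      by (intro Henstock_Kurzweil_Integration.integral_add absolutely_integrable_imp_integrable_on qx
          negative_part_integrable(1))
    finally show ?thesis using 1 negative_part_local_bound[OF x0(1) \<epsilon>] by linarith
  qed
  then show "\<forall>\<^sub>F x in at_top. Z \<le> integral {x..x + \<epsilon>} q"
    unfolding eventually_at_top_linorder by blast
qed

section \<open>Sufficiency of the two conditions\<close>

text \<open>The intervals with a_k \<le> X are disjoint and lie in [0, X + D], so only finitely many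
  of them are longer than \<epsilon>. This holds for any enumeration; in the code the integrals of
  the indicator of [0, X + D] are the terms of a convergent series.\<close>

lemma long_intervals_far:
  assumes "\<epsilon> > 0"
  obtains K where "\<And>k. k \<ge> K \<Longrightarrow> \<epsilon> < b k - a k \<Longrightarrow> X < a k"
proof -
  define h :: "real \<Rightarrow> real" where "h t = (if t \<in> {0..X + D} then 1 else 0)" for t
  have "h absolutely_integrable_on UNIV"
  proof (rule absolutely_integrable_superset)
    show "h absolutely_integrable_on {0..X + D}"
      by (rule absolutely_integrable_spike[OF absolutely_integrable_continuous_real[OF
          continuous_on_const[of _ 1]] negligible_empty])
         (auto simp: h_def)
  qed (auto simp: h_def)
  then have hi: "h absolutely_integrable_on {0<..}"
    by (rule set_integrable_subset) auto
  have "(\<lambda>k. integral {a k..b k} h) \<longlonglongrightarrow> 0"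
    using integral_sums[OF hi] by (intro summable_LIMSEQ_zero sums_summable)
  then obtain K where K: "\<And>k. k \<ge> K \<Longrightarrow> \<bar>integral {a k..b k} h\<bar> < \<epsilon>"
    using assms unfolding lim_sequentially by (auto simp: dist_real_def)
  have "X < a k" if k: "k \<ge> K" "\<epsilon> < b k - a k" for k
  proof (rule ccontr)
    assume "\<not> X < a k"
    then have "{a k..b k} \<subseteq> {0..X + D}" using D(2)[of k] a_nonneg[of k] by auto
    then have "integral {a k..b k} h = integral {a k..b k} (\<lambda>_. 1)" by (intro integral_cong) (auto simp: h_def)
    then show False using K[OF k(1)] k(2) ab[of k] by simp
  qed
  then show thesis using that by blast
qed

text \<open>Since q_+ \<ge> q, both conditions serve as lower bounds on the mean of q_+ over pieces
  of length at most \<epsilon>. The piece estimate then controls the norm by the two terms that the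
  lower bound of the form has retained.\<close>

lemma form_bound_of_conditions:
  assumes molchanov: "\<And>\<epsilon>. \<epsilon> > 0 \<Longrightarrow> filterlim (\<lambda>x. integral {x..x + \<epsilon>} q) at_top at_top"
    and mean: "filterlim (\<lambda>k. 1 / (b k - a k) * integral {a k..b k} q) at_top sequentially"
  shows form_bound_tends_to_infinity
proof (rule qform_lower_bound[OF C(1) D(1)])
  fix C' :: real
  assume C': "C' \<ge> 0" and bound: "\<And>a b q y y1. a < b \<Longrightarrow> b - a \<le> D \<Longrightarrow> q absolutely_integrable_on {a..b} \<Longrightarrow>
     integral {a..b} (\<lambda>x. (\<bar>q x\<bar> - q x) / 2) \<le> C * (b - a) \<Longrightarrow> form_dom a b y y1 \<Longrightarrow>
     1 / 2 * integral {a..b} (\<lambda>x. (cmod (y1 x))\<^sup>2) + integral {a..b} (\<lambda>x. (\<bar>q x\<bar>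
         + q x) / 2 * (cmod (y x))\<^sup>2) - C' * sq_norm a b y
       \<le> qform q a b y y1"
  define p where "p x = (\<bar>q x\<bar> + q x) / 2" for x
  have p0: "p x \<ge> 0" and qp: "q x \<le> p x" for x by (auto simp: p_def)
  have pi: "p absolutely_integrable_on {c..d}" if "0 \<le> c" for c d
    unfolding p_def by (rule negative_part_integrable(2)[OF q_Icc[OF that]])
  show form_bound_tends_to_infinity
    unfolding form_bound_tends_to_infinity_def
  proof
    fix l
    define \<Lambda> where "\<Lambda> = \<bar>l\<bar> + C' + 1"
    have \<Lambda>: "\<Lambda> > 0" "l \<le> \<Lambda> - C'" using C' by (auto simp: \<Lambda>_def)
    \<comment> \<open>\<open>\<rho>\<close> and \<open>\<epsilon>\<close> make the coefficients
      \<open>2 / \<rho>\<close> and \<open>2 * \<epsilon>\<^sup>2\<close> of the piece estimate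
      equal to 1/\<Lambda> and 1/(2 \<Lambda>). Multiplied by \<Lambda>, these are the weights 1 and
      1/2 in the lower bound of the form.\<close>
    define \<rho> where "\<rho> = 2 * \<Lambda>"
    define \<epsilon> where "\<epsilon> = 1 / (2 * sqrt \<Lambda>)"
    have \<rho>: "\<rho> > 0" and \<epsilon>: "\<epsilon> > 0" using \<Lambda> by (auto simp: \<rho>_def \<epsilon>_def)
    have \<epsilon>2: "2 * \<epsilon>\<^sup>2 = 1 / (2 * \<Lambda>)" using \<Lambda> by (simp add: \<epsilon>_def power_divide power_mult_distrib)
    \<comment> \<open>A window of length \<epsilon>/2 fits into every piece. Demanding \<rho>
      \<epsilon> on it, instead of half of that, covers all piece lengths up to \<epsilon>.\<close>
    obtain X where X: "\<And>x. x \<ge> X \<Longrightarrow> \<rho> * \<epsilon> \<le> integral {x..x + \<epsilon> / 2} q"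
      using molchanov[of "\<epsilon> / 2"] \<epsilon> unfolding filterlim_at_top eventually_at_top_linorder by (metis half_gt_zero)
    obtain K1 where K1: "\<And>k. k \<ge> K1 \<Longrightarrow> \<rho> \<le> 1 / (b k - a k) * integral {a k..b k} q"
      using mean unfolding filterlim_at_top eventually_sequentially by blast
    obtain K2 where K2: "\<And>k. k \<ge> K2 \<Longrightarrow> \<epsilon> < b k - a k \<Longrightarrow> X < a k"
      using long_intervals_far[OF \<epsilon>] by blast
    have "l * sq_norm (a k) (b k) y \<le> qform q (a k) (b k) y y1"
      if k: "k \<ge> max K1 K2" and y: "form_dom (a k) (b k) y y1" for k y y1
    proof -
      \<comment> \<open>The estimate in the form \<integral> G \<le> 0, which is additive over the
        pieces of a long interval.\<close>
      define G where "G x = (cmod (y x))\<^sup>2 - (2 / \<rho> * (p x * (cmod (y x))\<^sup>2) + 2 * \<epsilon>\<^sup>2 * (cmod (y1 x))\<^sup>2)" for x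
      have yc: "continuous_on {a k..b k} y" by (rule form_dom_continuous[OF y])
      note pk = pi[OF a_nonneg[of k], of "b k"]
      have i1: "(\<lambda>x. (cmod (y x))\<^sup>2) integrable_on {a k..b k}" by (rule continuous_square_integrable[OF yc])
      have i2: "(\<lambda>x. p x * (cmod (y x))\<^sup>2) integrable_on {a k..b k}" by (rule weighted_square_integrable[OF pk yc])
      have i3: "(\<lambda>x. (cmod (y1 x))\<^sup>2) integrable_on {a k..b k}" using y by (simp add: form_dom_def)
      have Gi: "G integrable_on {a k..b k}"
        unfolding G_def by (intro integrable_diff integrable_add integrable_on_mult_right i1 i2 i3)
      have G_eq: "integral {c..d} G = sq_norm c d y - (2 / \<rho> * integral {c..d} (\<lambda>x. p x * (cmod (y x))\<^sup>2)
          + 2 * \<epsilon>\<^sup>2 * integral {c..d} (\<lambda>x. (cmod (y1 x))\<^sup>2))"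
        if "a k \<le> c" "d \<le> b k" for c d
      proof -
        have s: "{c..d} \<subseteq> {a k..b k}" using that by auto
        note j = integrable_on_subinterval[OF i1 s] integrable_on_subinterval[OF i2 s]
            integrable_on_subinterval[OF i3 s]
        show ?thesis
          unfolding G_def sq_norm_def Henstock_Kurzweil_Integration.integral_diff[OF j(1) integrable_add[OF
              integrable_on_mult_right[OF j(2)] integrable_on_mult_right[OF j(3)]]]
            Henstock_Kurzweil_Integration.integral_add[OF integrable_on_mult_right[OF j(2)]
                integrable_on_mult_right[OF j(3)]] by simp
      qed
      have short: "integral {c..d} G \<le> 0"
        if cd: "a k \<le> c" "c < d" "d \<le> b k" "d - c \<le> \<epsilon>" and m: "\<rho> * (d - c) \<le> integral {c..d} p" for c d
      proof -
        have "0 \<le> integral {c..d} (\<lambda>x. (cmod (y1 x))\<^sup>2)"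
          by (intro Henstock_Kurzweil_Integration.integral_nonneg integrable_on_subinterval[OF i3]) (use cd in auto)
        then have "2 * (d - c)\<^sup>2 * integral {c..d} (\<lambda>x. (cmod (y1 x))\<^sup>2) \<le> 2 * \<epsilon>\<^sup>2 * integral {c..d}
            (\<lambda>x. (cmod (y1 x))\<^sup>2)"
          using cd by (intro mult_right_mono mult_left_mono power_mono) auto
        then show ?thesis
          using piece_estimate[OF y cd(1,2,3) pk p0 \<rho> m] unfolding G_eq[OF cd(1,3)] by linarith
      qed
      have "integral {a k..b k} G \<le> 0"
      proof (cases "b k - a k \<le> \<epsilon>")
        case True
        have "\<rho> * (b k - a k) \<le> integral {a k..b k} q"
          using K1[of k] k ab[of k] by (simp add: field_simps)
        also have "\<dots> \<le> integral {a k..b k} p"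
          by (intro integral_le absolutely_integrable_imp_integrable_on q_int pk qp)
        finally show ?thesis using True ab[of k] by (intro short) auto
      next
        case False
        then have far: "X < a k" using K2[of k] k by simp
        show ?thesis
        proof (rule split_estimate[OF Gi \<epsilon>])
          fix c d assume cd: "a k \<le> c" "d \<le> b k" "\<epsilon> / 2 \<le> d - c" "d - c \<le> \<epsilon>"
          have c0: "0 \<le> c" using cd(1) a_nonneg[of k] by linarith
          have "\<rho> * (d - c) \<le> \<rho> * \<epsilon>" using cd(4) \<rho> by (intro mult_left_mono) auto
          also have "\<dots> \<le> integral {c..c + \<epsilon> / 2} q" using cd(1) far by (intro X) linarith
          also have "\<dots> \<le> integral {c..c + \<epsilon> / 2} p"
            by (intro integral_le absolutely_integrable_imp_integrable_on q_Icc pi c0 qp)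
          also have "\<dots> \<le> integral {c..d} p"
            using cd p0 by (intro integral_subset_le absolutely_integrable_imp_integrable_on pi c0) auto
          finally show "integral {c..d} G \<le> 0" using cd \<epsilon> by (intro short) auto
        qed (use False \<epsilon> in auto)
      qed
      then have "sq_norm (a k) (b k) y \<le> 1 / \<Lambda> * integral {a k..b k} (\<lambda>x. p x * (cmod (y x))\<^sup>2)
          + 1 / (2 * \<Lambda>) * integral {a k..b k} (\<lambda>x. (cmod (y1 x))\<^sup>2)"
        unfolding G_eq[OF order_refl order_refl] \<epsilon>2 by (simp add: \<rho>_def)
      then have "\<Lambda> * sq_norm (a k) (b k) y \<le> \<Lambda> * (1 / \<Lambda> * integral {a k..b k} (\<lambda>x. p x * (cmod (y x))\<^sup>2)
          + 1 / (2 * \<Lambda>) * integral {a k..b k} (\<lambda>x. (cmod (y1 x))\<^sup>2))"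
        using \<Lambda>(1) by (intro mult_left_mono) auto
      also have "\<dots> = integral {a k..b k} (\<lambda>x. p x * (cmod (y x))\<^sup>2) + 1 / 2 * integral {a k..b k}
          (\<lambda>x. (cmod (y1 x))\<^sup>2)"
        using \<Lambda>(1) by (simp add: distrib_left)
      finally have "(\<Lambda> - C') * sq_norm (a k) (b k) y \<le> qform q (a k) (b k) y y1"
        using bound[OF ab D(2) q_int C(2) y] unfolding p_def by (simp add: left_diff_distrib)
      moreover have "l * sq_norm (a k) (b k) y \<le> (\<Lambda> - C') * sq_norm (a k) (b k) y"
        using \<Lambda>(2) sq_norm_nonneg[OF yc] by (rule mult_right_mono)
      ultimately show ?thesis by linarith
    qed
    then show "\<exists>K. \<forall>k\<ge>K. \<forall>y y1. form_dom (a k) (b k) y y1 \<longrightarrow> l * sq_norm (a k) (b k) y \<le> qform q (a k) (b k) y y1"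
      by blast
  qed
qed

lemma discrete_iff:
  "purely_discrete_spectrum M T \<longleftrightarrow>
    (\<forall>\<epsilon>>0. filterlim (\<lambda>x. integral {x..x + \<epsilon>} q) at_top at_top) \<and>
    filterlim (\<lambda>k. 1 / (b k - a k) * integral {a k..b k} q) at_top sequentially"
proof
  assume "purely_discrete_spectrum M T"
  moreover obtain l0 where "\<And>k y y1. form_dom (a k) (b k) y y1 \<Longrightarrow> l0 * sq_norm (a k) (b k) y
      \<le> qform q (a k) (b k) y y1"
    using form_lower by blast
  ultimately have form_bound_tends_to_infinity
    by (rule discrete_imp_form_bound)
  then show "(\<forall>\<epsilon>>0. filterlim (\<lambda>x. integral {x..x + \<epsilon>} q) at_top at_top) \<and>
    filterlim (\<lambda>k. 1 / (b k - a k) * integral {a k..b k} q) at_top sequentially"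
    using molchanov_condition mean_tends_to_infinity by blast
next
  assume "(\<forall>\<epsilon>>0. filterlim (\<lambda>x. integral {x..x + \<epsilon>} q) at_top at_top) \<and>
    filterlim (\<lambda>k. 1 / (b k - a k) * integral {a k..b k} q) at_top sequentially"
  then show "purely_discrete_spectrum M T"
    by (intro form_bound_imp_discrete form_bound_of_conditions) blast+
qed

end

theorem theorem8p6:
  fixes q :: "real \<Rightarrow> real" and \<Sigma> :: "real set" and a b :: "nat \<Rightarrow> real"
  assumes "\<And>c. c > 0 \<Longrightarrow> integrable (lebesgue_on {0<..<c}) q"
    and "\<Sigma> \<subseteq> {0..}" and "closed \<Sigma>" and "\<not> bounded \<Sigma>" and "\<Sigma> \<in> null_sets lebesgue"
    and "bij_betw (\<lambda>k. {a k<..<b k}) UNIV (components ({0<..} - \<Sigma>))"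
    and "bdd_above (range (\<lambda>k. b k - a k))"
    and "lower_semibounded (lebesgue_on {0<..}) (neumann_sum q a b)"
    and "bdd_above (range (\<lambda>k. 1 / (b k - a k) *
           (LINT x|lebesgue_on {a k<..<b k}. (\<bar>q x\<bar> - q x) / 2)))"
  shows "purely_discrete_spectrum (lebesgue_on {0<..}) (neumann_sum q a b) \<longleftrightarrow>
    (\<forall>\<epsilon>>0. filterlim (\<lambda>x. LINT t|lebesgue_on {x..x + \<epsilon>}. q t) at_top at_top) \<and>
    filterlim (\<lambda>k. 1 / (b k - a k) * (LINT x|lebesgue_on {a k<..<b k}. q x)) at_top sequentially"
proof -
  let ?I = "\<lambda>k. {a k<..<b k}"
  have comp: "?I k \<in> components ({0<..} - \<Sigma>)" for k
    using bij_betwE[OF assms(6)] by blast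
  have ab: "a k < b k" for k
    using in_components_nonempty[OF comp[of k]] by (simp add: greaterThanLessThan_empty_iff not_le)
  have I_sub: "?I k \<subseteq> {0<..} - \<Sigma>" for k
    using in_components_subset[OF comp] .
  have a0: "0 \<le> a k" for k
  proof (rule ccontr)
    assume "\<not> 0 \<le> a k"
    then have "min (b k) 0 > a k" using ab[of k] by simp
    then obtain t where "a k < t" "t < min (b k) 0" using dense by blast
    then show False using I_sub[of k] by auto
  qed
  have disj: "?I i \<inter> ?I j = {}" if "i \<noteq> j" for i j
  proof -
    have "?I i \<noteq> ?I j"
      using bij_betw_imp_inj_on[OF assms(6)] that by (auto dest: inj_onD)
    then show ?thesis using components_nonoverlap[OF comp[of i] comp[of j]] by blast
  qed
  have "(\<Union>k. ?I k) = {0<..} - \<Sigma>"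
    using bij_betw_imp_surj_on[OF assms(6)] Union_components[of "{0<..} - \<Sigma>"] by simp
  then have null: "negligible ({0<..} - (\<Union>k. ?I k))"
    using negligible_subset[of \<Sigma> "{0<..} - (\<Union>k. ?I k)"] assms(5) by (auto simp: negligible_iff_null_sets)
  have q0: "q absolutely_integrable_on {0..c}" for c
  proof (cases "c > 0")
    case True
    then show ?thesis using assms(1) by (simp add: integrable_lebesgue_on_Ioo)
  next
    case False
    then have "negligible {0..c}" by (auto intro: negligible_subset[OF negligible_sing[of 0]])
    then show ?thesis by (rule absolutely_integrable_negligible)
  qed
  have qI: "q absolutely_integrable_on {c..d}" if "0 \<le> c" for c d
    by (rule absolutely_integrable_on_subinterval[OF q0[of d]]) (use that in auto)
  obtain D where D: "\<And>k. b k - a k \<le> D"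
    using assms(7) unfolding bdd_above_def by blast
  have D0: "D > 0" using D[of 0] ab[of 0] by simp
  have qm_eq: "(LINT x|lebesgue_on (?I k). (\<bar>q x\<bar> - q x) / 2) = integral {a k..b k} (\<lambda>x. (\<bar>q x\<bar> - q x) / 2)" for k
    by (intro integral_lebesgue_on_Ioo negative_part_integrable(1) qI a0)
  have q_eq: "(LINT x|lebesgue_on (?I k). q x) = integral {a k..b k} q" for k
    by (intro integral_lebesgue_on_Ioo qI a0)
  obtain C where C: "\<And>k. 1 / (b k - a k) * integral {a k..b k} (\<lambda>x. (\<bar>q x\<bar> - q x) / 2) \<le> C"
    using assms(9) unfolding bdd_above_def qm_eq by blast
  have Cb: "integral {a k..b k} (\<lambda>x. (\<bar>q x\<bar> - q x) / 2) \<le> max C 0 * (b k - a k)" for k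
  proof -
    have "1 / (b k - a k) * integral {a k..b k} (\<lambda>x. (\<bar>q x\<bar> - q x) / 2) \<le> max C 0"
      using C[of k] by simp
    then have "(b k - a k) * (1 / (b k - a k) * integral {a k..b k} (\<lambda>x. (\<bar>q x\<bar> - q x) / 2))
        \<le> (b k - a k) * max C 0"
      using ab[of k] by (intro mult_left_mono) auto
    moreover have "(b k - a k) * (1 / (b k - a k) * integral {a k..b k} (\<lambda>x. (\<bar>q x\<bar> - q x) / 2))
        = integral {a k..b k} (\<lambda>x. (\<bar>q x\<bar> - q x) / 2)"
      using ab[of k] by (simp only: mult.assoc[symmetric]) simp
    ultimately show ?thesis by (simp only: mult.commute)
  qed
  interpret bounded_family q a b "max C 0" D
    by unfold_locales (use ab a0 disj null qI D D0 Cb q0 in auto)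
  \<comment> \<open>The two integrals are compared only for x \<ge> 0, where q is known to be
    integrable; for the limit at infinity this is enough.\<close>
  have "filterlim (\<lambda>x. LINT t|lebesgue_on {x..x + \<epsilon>}. q t) at_top at_top
    \<longleftrightarrow> filterlim (\<lambda>x. integral {x..x + \<epsilon>} q) at_top at_top" for \<epsilon>
  proof (rule filterlim_cong[OF refl refl])
    have "(LINT t|lebesgue_on {x..x + \<epsilon>}. q t) = integral {x..x + \<epsilon>} q" if "x \<ge> 0" for x
      by (intro lebesgue_integral_eq_integral absolutely_integrable_imp_integrable qI that) auto
    then show "\<forall>\<^sub>F x in at_top. (LINT t|lebesgue_on {x..x + \<epsilon>}. q t) = integral {x..x + \<epsilon>} q"
      unfolding eventually_at_top_linorder by blast
  qed
  then show ?thesis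
    using discrete_iff unfolding q_eq by simp
qed


end
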